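(* Let $n\ge 2$. Let $\Omega_1,\dots,\Omega_n$ be r.e. infinite sets, and let $P_1\in\mathbb{P}(\Omega_1),\dots,P_n\in\mathbb{P}(\Omega_n)$ be discrete probability spaces. Let $\alpha_1,\dots,\alpha_n$ be ensembles for $P_1,\dots,P_n$, respectively. Suppose that $P_1,\dots,P_{n-1}$ are computable. Then the ensembles $\alpha_1,\dots,\alpha_n$ are independent if and only if for every $k=1,\dots,n-1$ it holds that $\alpha_k$ is Martin-Löf $P_k$-random relative to $\alpha_{k+1},\dots,\alpha_n$.
   Context: Alphabets and sequences. $\mathbb{N}=\{0,1,2,\dots\}$, $\mathbb{N}^+=\{1,2,3,\dots\}$. For a nonempty set $\Omega$ (alphabet), $\Omega^*$ is the set of finite strings over $\Omega$ (including the empty string $\lambda$), and $\Omega^\infty$ is the set of infinite sequences $\alpha=\alpha(1)\alpha(2)\alpha(3)\cdots$ over $\Omega$; $\alpha\upharpoonright_n$ is the string of the first $n$ elements of $\alpha$. A set $S\subset\Omega^*$ is prefix-free if no string in $S$ is a prefix of another string in $S$. For $S\subset\Omega^*$, $[S]^{\prec}=\{\alpha\in\Omega^\infty\mid \exists n\ge 0,\ \alpha\upharpoonright_n\in S\}$. An r.e. infinite set is an infinite recursively enumerable set (of finite objects usable as Turing machine inputs). Probability spaces. For a countably infinite set $\Omega$, a discrete probability space on $\Omega$ is a function $P\colon\Omega\to\mathbb{R}$ with $P(a)\ge 0$ for all $a$ and $\sum_{a\in\Omega}P(a)=1$; $\mathbb{P}(\Omega)$ is the set of all of them. For $\sigma=\sigma_1\cdots\sigma_n\in\Omega^*$,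 $P(\sigma)=P(\sigma_1)\cdots P(\sigma_n)$ and $P(\lambda)=1$. The generalized Bernoulli measure $\lambda_P$ is the probability measure on the Borel $\sigma$-field of $\Omega^\infty$ (generated by the open sets $[S]^{\prec}$, $S\subset\Omega^*$) determined by $\lambda_P([\{\sigma\}]^{\prec})=P(\sigma)$ for all $\sigma\in\Omega^*$. For $\Omega$ an r.e. infinite set, $P\in\mathbb{P}(\Omega)$ is computable if there is a partial recursive function $f$ with domain exactly $\Omega\times\mathbb{N}$ and values in $\mathbb{Q}$ such that $|P(a)-f(a,k)|\le 2^{-k}$ for all $a\in\Omega$, $k\in\mathbb{N}$. The computability of $P_n$ is not required. Ensembles. Let $\Omega$ be an r.e. infinite set and $P\in\mathbb{P}(\Omega)$. A Martin-Löf $P$-test is an r.e. set $\mathcal{C}\subset\mathbb{N}^+\times\Omega^*$ such that for every $n\in\mathbb{N}^+$ the set $\mathcal{C}_n=\{\sigma\mid(n,\sigma)\in\mathcal{C}\}$ is prefix-free and $\lambda_P([\mathcal{C}_n]^{\prec})<2^{-n}$. A sequence $\alpha\in\Omega^\infty$ is Martin-Löf $P$-random if for every Martin-Löf $P$-test $\mathcal{C}$ there is $n\in\mathbb{N}^+$ with $\alpha\notin[\mathcal{C}_n]^{\prec}$. An ensemble for $P$ is a Martin-Löf $P$-random sequence in $\Omega^\infty$. Relativization. Let $\beta_1,\dots,\beta_\ell$ be infinite sequences, each over an r.e. infinite set. A Martin-Löf $P$-test relative to $\beta_1,\dots,\beta_\ell$ is a set $\mathcal{C}\subset\mathbb{N}^+\times\Omega^*$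 that is the set of inputs in $\mathbb{N}^+\times\Omega^*$ accepted by some oracle Turing machine which may query any $(k,m)\in\{1,\dots,\ell\}\times\mathbb{N}^+$ and receives the answer $\beta_k(m)$, and such that for every $n\in\mathbb{N}^+$ the set $\mathcal{C}_n$ is prefix-free and $\lambda_P([\mathcal{C}_n]^{\prec})<2^{-n}$. A sequence $\alpha\in\Omega^\infty$ is Martin-Löf $P$-random relative to $\beta_1,\dots,\beta_\ell$ if for every such test there is $n\in\mathbb{N}^+$ with $\alpha\notin[\mathcal{C}_n]^{\prec}$. Independence of ensembles. $P_1\times\dots\times P_n\in\mathbb{P}(\Omega_1\times\dots\times\Omega_n)$ is given by $(a_1,\dots,a_n)\mapsto P_1(a_1)\cdots P_n(a_n)$. $\alpha_1\times\dots\times\alpha_n$ is the infinite sequence over $\Omega_1\times\dots\times\Omega_n$ whose $k$th element is $(\alpha_1(k),\dots,\alpha_n(k))$. Ensembles $\alpha_1,\dots,\alpha_n$ for $P_1,\dots,P_n$, respectively, are independent if $\alpha_1\times\dots\times\alpha_n$ is an ensemble for $P_1\times\dots\times P_n$. *)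

theory Defs
  imports
    "HOL-Probability.Probability"
    "HOL-Library.Nat_Bijection"
    "HOL-Library.Sublist"
begin

section \<open>Finite objects\<close>

text \<open>
  The finite objects on which machines operate are given to them through an injective coding
  by natural numbers.  The codings of tuples, strings and rational numbers are the usual ones.
\<close>

class encodable =
  fixes encode :: "'a \<Rightarrow> nat"
  assumes inj_encode: "inj encode"
begin

subclass countable
  using inj_encode by unfold_locales blast

end

instantiation nat :: encodable
begin
definition encode_nat :: "nat \<Rightarrow> nat" where "encode_nat n = n"
instance by standard (simp add: encode_nat_def inj_on_def)
end

instantiation prod :: (encodable, encodable) encodable
begin
definition encode_prod :: "'a \<times> 'b \<Rightarrow> nat" where
  "encode_prod p = prod_encode (encode (fst p), encode (snd p))"
instance
  by standard (auto simp: encode_prod_def inj_on_def prod_encode_eq injD[OF inj_encode] dest: injD[OF inj_encode])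
end

instantiation list :: (encodable) encodable
begin
definition encode_list :: "'a list \<Rightarrow> nat" where
  "encode_list xs = list_encode (map encode xs)"
instance
  by standard (auto simp: encode_list_def inj_on_def list_encode_eq inj_map_eq_map[OF inj_encode])
end

instantiation rat :: encodable
begin
definition encode_rat :: "rat \<Rightarrow> nat" where
  "encode_rat r = prod_encode (int_encode (fst (quotient_of r)), int_encode (snd (quotient_of r)))"
instance
  by standard (auto simp: encode_rat_def inj_on_def prod_encode_eq int_encode_eq prod_eq_iff
      intro: quotient_of_inject)
end


section \<open>Oracle Turing machines\<close>

text \<open>
  A tape \<open>(l, r)\<close> is infinite in both directions; \<open>r\<close> lists the cells from the head to the
  right, \<open>l\<close> those to the left of the head, nearest first.  All further cells carry the blank
  symbol \<open>0\<close>.  The number \<open>n\<close> is written on a tape in unary, as \<open>n\<close> consecutive symbols \<open>1\<close>.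
\<close>

type_synonym tape = "nat list \<times> nat list"

datatype move = GoLeft | GoRight | Stay

definition tape_read :: "tape \<Rightarrow> nat" where
  "tape_read t = (case snd t of [] \<Rightarrow> 0 | s # _ \<Rightarrow> s)"

fun tape_move :: "move \<Rightarrow> tape \<Rightarrow> tape" where
  "tape_move Stay t = t"
| "tape_move GoLeft (l, r) = (case l of [] \<Rightarrow> ([], 0 # r) | s # l' \<Rightarrow> (l', s # r))"
| "tape_move GoRight (l, r) = (case r of [] \<Rightarrow> (0 # l, []) | s # r' \<Rightarrow> (s # l, r'))"

fun tape_act :: "nat \<times> move \<Rightarrow> tape \<Rightarrow> tape" where
  "tape_act (s, m) (l, r) = tape_move m (l, s # tl r)"

definition unary_tape :: "nat \<Rightarrow> tape" where
  "unary_tape n = ([], replicate n 1)"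

definition tape_value :: "tape \<Rightarrow> nat" where
  "tape_value t = length (takeWhile (\<lambda>s. s = 1) (snd t))"

text \<open>
  A deterministic machine with an input/output tape (tape 0), a query tape (tape 1) and
  \<open>work_tapes\<close> many further tapes.  The transition function maps a state and the list of symbols
  read to the next state and, for each tape, the symbol to be written and the move.  In a state
  \<open>q\<close> with \<open>query_fun M q = Some q'\<close> the oracle is consulted and the machine proceeds in \<open>q'\<close>.
\<close>

record otm =
  work_tapes :: nat
  start_state :: nat
  accept_state :: nat
  trans_fun :: "nat \<times> nat list \<rightharpoonup> nat \<times> (nat \<times> move) list"
  query_fun :: "nat \<rightharpoonup> nat"

definition oracle_TM :: "otm \<Rightarrow> bool" where
  "oracle_TM M \<longleftrightarrow>
     finite (dom (trans_fun M)) \<and> finite (dom (query_fun M)) \<and>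
     (\<forall>q ss q' as. trans_fun M (q, ss) = Some (q', as) \<longrightarrow>
        length ss = work_tapes M + 2 \<and> length as = work_tapes M + 2)"

type_synonym config = "nat \<times> tape list"

definition init_config :: "otm \<Rightarrow> nat \<Rightarrow> config" where
  "init_config M x = (start_state M, unary_tape x # replicate (work_tapes M + 1) (unary_tape 0))"

text \<open>
  The oracle is a partial function on codes of queries.  A query replaces the contents of the
  query tape by the answer; a machine that asks a query outside the domain gets stuck (and hence
  does not accept).
\<close>

definition step :: "(nat \<rightharpoonup> nat) \<Rightarrow> otm \<Rightarrow> config \<Rightarrow> config option" where
  "step orc M c = (case c of (q, ts) \<Rightarrow>
     if q = accept_state M then None
     else case query_fun M q of
       Some q' \<Rightarrow>
         (case orc (tape_value (ts ! 1)) of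
            None \<Rightarrow> None
          | Some a \<Rightarrow> Some (q', ts[1 := unary_tape a]))
     | None \<Rightarrow>
         (case trans_fun M (q, map tape_read ts) of
            None \<Rightarrow> None
          | Some (q', as) \<Rightarrow> Some (q', map2 tape_act as ts)))"

definition reaches :: "(nat \<rightharpoonup> nat) \<Rightarrow> otm \<Rightarrow> config \<Rightarrow> config \<Rightarrow> bool" where
  "reaches orc M = (\<lambda>c d. step orc M c = Some d)\<^sup>*\<^sup>*"

definition accepts :: "(nat \<rightharpoonup> nat) \<Rightarrow> otm \<Rightarrow> nat \<Rightarrow> bool" where
  "accepts orc M x \<longleftrightarrow> (\<exists>ts. reaches orc M (init_config M x) (accept_state M, ts))"

definition computes :: "(nat \<rightharpoonup> nat) \<Rightarrow> otm \<Rightarrow> nat \<Rightarrow> nat \<Rightarrow> bool" where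
  "computes orc M x y \<longleftrightarrow>
     (\<exists>ts. reaches orc M (init_config M x) (accept_state M, ts) \<and> tape_value (ts ! 0) = y)"


section \<open>Recursively enumerable sets and partial recursive functions\<close>

text \<open>A Turing machine without oracle is one all of whose queries remain unanswered.\<close>

definition rec_enum :: "'a::encodable set \<Rightarrow> bool" where
  "rec_enum S \<longleftrightarrow> (\<exists>M. oracle_TM M \<and> encode ` S = {x. accepts Map.empty M x})"

definition partial_recursive :: "('a::encodable \<rightharpoonup> 'b::encodable) \<Rightarrow> bool" where
  "partial_recursive f \<longleftrightarrow>
     (\<exists>M. oracle_TM M \<and>
        (\<forall>i j. computes Map.empty M i j \<longleftrightarrow> (\<exists>x y. f x = Some y \<and> i = encode x \<and> j = encode y)))"


section \<open>Discrete probability spaces and generalized Bernoulli measures\<close>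

text \<open>
  A discrete probability space on \<open>\<Omega>\<close> is a probability mass function \<open>P\<close> with
  \<open>set_pmf P \<subseteq> \<Omega>\<close>; it vanishes outside \<open>\<Omega>\<close>.  Elements of \<open>streams \<Omega>\<close> are indexed from \<open>0\<close>:
  the \<open>m\<close>-th element of \<open>\<alpha>\<close> is \<open>\<alpha> !! (m - 1)\<close>.
\<close>

definition prob_on :: "'a set \<Rightarrow> 'a pmf set" where
  "prob_on \<Omega> = {P. set_pmf P \<subseteq> \<Omega>}"

definition computable_prob :: "'a::encodable set \<Rightarrow> 'a pmf \<Rightarrow> bool" where
  "computable_prob \<Omega> P \<longleftrightarrow>
     (\<exists>f :: 'a \<times> nat \<rightharpoonup> rat. partial_recursive f \<and> dom f = \<Omega> \<times> UNIV \<and>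
        (\<forall>a\<in>\<Omega>. \<forall>k. \<bar>pmf P a - of_rat (the (f (a, k)))\<bar> \<le> (1 / 2) ^ k))"

definition cylinder :: "'a set \<Rightarrow> 'a list set \<Rightarrow> 'a stream set" where
  "cylinder \<Omega> S = {\<alpha> \<in> streams \<Omega>. \<exists>n. stake n \<alpha> \<in> S}"

definition bernoulli_measure :: "'a pmf \<Rightarrow> 'a stream measure" where
  "bernoulli_measure P = stream_space (measure_pmf P)"

definition prefix_free :: "'a list set \<Rightarrow> bool" where
  "prefix_free S \<longleftrightarrow> (\<forall>\<sigma>\<in>S. \<forall>\<tau>\<in>S. \<not> strict_prefix \<sigma> \<tau>)"

lemma cylinder_eq_sstart:
  assumes "S \<subseteq> lists \<Omega>"
  shows "cylinder \<Omega> S = (\<Union>\<sigma>\<in>S. sstart \<Omega> \<sigma>)"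
proof (intro set_eqI iffI)
  fix \<alpha> assume "\<alpha> \<in> cylinder \<Omega> S"
  then obtain n where "\<alpha> \<in> streams \<Omega>" "stake n \<alpha> \<in> S"
    by (auto simp: cylinder_def)
  then show "\<alpha> \<in> (\<Union>\<sigma>\<in>S. sstart \<Omega> \<sigma>)"
    by (intro UN_I[of "stake n \<alpha>"]) (auto simp: sstart_eq)
next
  fix \<alpha> assume "\<alpha> \<in> (\<Union>\<sigma>\<in>S. sstart \<Omega> \<sigma>)"
  then obtain \<sigma> where \<sigma>: "\<sigma> \<in> S" "\<alpha> \<in> sstart \<Omega> \<sigma>" by blast
  then have \<alpha>: "\<alpha> \<in> streams \<Omega>"
    using assms sstart_in_streams[of \<sigma> \<Omega>] by blast
  then have "stake (length \<sigma>) \<alpha> = \<sigma>"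
    using \<sigma> by (intro nth_equalityI) (auto simp: sstart_eq)
  then show "\<alpha> \<in> cylinder \<Omega> S"
    using \<alpha> \<sigma> by (auto simp: cylinder_def intro!: exI[of _ "length \<sigma>"])
qed

lemma sets_cylinder:
  fixes \<Omega> :: "'a::countable set"
  assumes "S \<subseteq> lists \<Omega>"
  shows "cylinder \<Omega> S \<in> sets (bernoulli_measure P)"
proof -
  have "sets (bernoulli_measure P) = sets (stream_space (count_space UNIV))"
    unfolding bernoulli_measure_def by (intro sets_stream_space_cong) simp
  moreover have "(\<Union>\<sigma>\<in>S. sstart \<Omega> \<sigma>) \<in> sets (stream_space (count_space UNIV))"
    by (intro sets.countable_UN'' sets_sstart) auto
  ultimately show ?thesis
    using cylinder_eq_sstart[OF assms] by simp
qed

text \<open>The defining property of the generalized Bernoulli measure.\<close>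

lemma measure_bernoulli_cylinder:
  assumes "P \<in> prob_on \<Omega>" "\<sigma> \<in> lists \<Omega>"
  shows "measure (bernoulli_measure P) (cylinder \<Omega> {\<sigma>}) = prod_list (map (pmf P) \<sigma>)"
proof -
  interpret S: prob_space "stream_space (measure_pmf P)"
    by (rule prob_space.prob_space_stream_space[OF prob_space_measure_pmf])
  have meas: "sstart \<Omega> xs \<in> sets (stream_space (measure_pmf P))" for xs
    using sets_sstart[of \<Omega> xs] sets_stream_space_cong[of "measure_pmf P" "count_space UNIV"] by simp
  have "emeasure (stream_space (measure_pmf P)) (sstart \<Omega> \<sigma>) = ennreal (prod_list (map (pmf P) \<sigma>))"
    using assms(2)
  proof (induction \<sigma>)
    case Nil
    have "AE x in stream_space (measure_pmf P). x \<in> streams \<Omega>"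
      using assms(1) prob_space.AE_stream_all[OF prob_space_measure_pmf, of "\<lambda>x. x \<in> \<Omega>"]
      by (auto simp: prob_on_def streams_iff_sset subset_eq stream_all_def AE_measure_pmf_iff)
    then have "emeasure (stream_space (measure_pmf P)) (streams \<Omega>) = 1"
      using meas[of "[]"] by (intro S.emeasure_eq_1_AE) auto
    then show ?case by simp
  next
    case (Cons a \<sigma>)
    let ?e = "emeasure (stream_space (measure_pmf P)) (sstart \<Omega> \<sigma>)"
    have *: "{x \<in> space (stream_space (measure_pmf P)). t ## x \<in> sstart \<Omega> (a # \<sigma>)} =
        (if t = a then sstart \<Omega> \<sigma> else {})" for t
      by (auto simp: space_stream_space)
    have "emeasure (stream_space (measure_pmf P)) (sstart \<Omega> (a # \<sigma>)) =
        (\<integral>\<^sup>+ t. ?e * indicator {a} t \<partial>measure_pmf P)"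
      unfolding prob_space.emeasure_stream_space[OF prob_space_measure_pmf meas[of "a # \<sigma>"]] *
      by (intro nn_integral_cong) (auto simp: indicator_def)
    also have "\<dots> = ?e * ennreal (pmf P a)"
      by (simp add: nn_integral_cmult_indicator emeasure_pmf_single)
    also have "\<dots> = ennreal (prod_list (map (pmf P) (a # \<sigma>)))"
      using Cons by (simp add: ennreal_mult' mult.commute)
    finally show ?case .
  qed
  moreover have "0 \<le> prod_list (map (pmf P) \<sigma>)"
    by (induction \<sigma>) auto
  ultimately show ?thesis
    using assms(2) by (simp add: cylinder_eq_sstart bernoulli_measure_def measure_def)
qed


section \<open>Ensembles and relativized randomness\<close>

abbreviation section_at :: "(nat \<times> 'a list) set \<Rightarrow> nat \<Rightarrow> 'a list set" where
  "section_at C n \<equiv> {\<sigma>. (n, \<sigma>) \<in> C}"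

definition martin_lof_test :: "'a::encodable set \<Rightarrow> 'a pmf \<Rightarrow> (nat \<times> 'a list) set \<Rightarrow> bool" where
  "martin_lof_test \<Omega> P C \<longleftrightarrow>
     C \<subseteq> {1..} \<times> lists \<Omega> \<and> rec_enum C \<and>
     (\<forall>n\<ge>1. prefix_free (section_at C n) \<and>
        measure (bernoulli_measure P) (cylinder \<Omega> (section_at C n)) < (1 / 2) ^ n)"

definition martin_lof_random :: "'a::encodable set \<Rightarrow> 'a pmf \<Rightarrow> 'a stream \<Rightarrow> bool" where
  "martin_lof_random \<Omega> P \<alpha> \<longleftrightarrow>
     \<alpha> \<in> streams \<Omega> \<and>
     (\<forall>C. martin_lof_test \<Omega> P C \<longrightarrow> (\<exists>n\<ge>1. \<alpha> \<notin> cylinder \<Omega> (section_at C n)))"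

abbreviation ensemble :: "'a::encodable set \<Rightarrow> 'a pmf \<Rightarrow> 'a stream \<Rightarrow> bool" where
  "ensemble \<equiv> martin_lof_random"

text \<open>
  The oracle given by \<open>\<beta>\<^sub>1, \<dots>, \<beta>\<^sub>l\<close>: the query \<open>(k, m)\<close> with \<open>1 \<le> k \<le> l\<close> and \<open>m \<ge> 1\<close> is
  answered by the \<open>m\<close>-th element of \<open>\<beta>\<^sub>k\<close>.
\<close>

definition oracle_of :: "'a::encodable stream list \<Rightarrow> nat \<rightharpoonup> nat" where
  "oracle_of \<beta>s x = (case prod_decode x of (k, m) \<Rightarrow>
     if k \<in> {1..length \<beta>s} \<and> m \<ge> 1 then Some (encode (\<beta>s ! (k - 1) !! (m - 1))) else None)"

definition martin_lof_test_rel ::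
  "'b::encodable stream list \<Rightarrow> 'a::encodable set \<Rightarrow> 'a pmf \<Rightarrow> (nat \<times> 'a list) set \<Rightarrow> bool" where
  "martin_lof_test_rel \<beta>s \<Omega> P C \<longleftrightarrow>
     (\<exists>M. oracle_TM M \<and>
        C = {x \<in> {1..} \<times> lists \<Omega>. accepts (oracle_of \<beta>s) M (encode x)}) \<and>
     (\<forall>n\<ge>1. prefix_free (section_at C n) \<and>
        measure (bernoulli_measure P) (cylinder \<Omega> (section_at C n)) < (1 / 2) ^ n)"

definition martin_lof_random_rel ::
  "'b::encodable stream list \<Rightarrow> 'a::encodable set \<Rightarrow> 'a pmf \<Rightarrow> 'a stream \<Rightarrow> bool" where
  "martin_lof_random_rel \<beta>s \<Omega> P \<alpha> \<longleftrightarrow>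
     \<alpha> \<in> streams \<Omega> \<and>
     (\<forall>C. martin_lof_test_rel \<beta>s \<Omega> P C \<longrightarrow> (\<exists>n\<ge>1. \<alpha> \<notin> cylinder \<Omega> (section_at C n)))"


section \<open>Products and independence\<close>

text \<open>The tuple \<open>(a\<^sub>1, \<dots>, a\<^sub>n)\<close> is represented by the list of its components.\<close>

definition prod_alphabet :: "nat \<Rightarrow> (nat \<Rightarrow> 'a set) \<Rightarrow> 'a list set" where
  "prod_alphabet n \<Omega> = listset (map \<Omega> [1..<Suc n])"

primrec pmf_listprod :: "'a pmf list \<Rightarrow> 'a list pmf" where
  "pmf_listprod [] = return_pmf []"
| "pmf_listprod (p # ps) = map_pmf (\<lambda>(x, xs). x # xs) (pair_pmf p (pmf_listprod ps))"

definition prod_prob :: "nat \<Rightarrow> (nat \<Rightarrow> 'a pmf) \<Rightarrow> 'a list pmf" where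
  "prod_prob n P = pmf_listprod (map P [1..<Suc n])"

definition prod_seq :: "nat \<Rightarrow> (nat \<Rightarrow> 'a stream) \<Rightarrow> 'a list stream" where
  "prod_seq n \<alpha> = to_stream (\<lambda>m. map (\<lambda>i. \<alpha> i !! m) [1..<Suc n])"

lemma pmf_pmf_listprod:
  "length xs = length ps \<Longrightarrow> pmf (pmf_listprod ps) xs = (\<Prod>i<length ps. pmf (ps ! i) (xs ! i))"
proof (induction ps arbitrary: xs)
  case Nil
  then show ?case by simp
next
  case (Cons p ps)
  then obtain y ys where xs: "xs = y # ys" "length ys = length ps"
    by (cases xs) auto
  have "pmf (pmf_listprod (p # ps)) xs = pmf (pair_pmf p (pmf_listprod ps)) (y, ys)"
    using pmf_map_inj'[of "\<lambda>(x, xs). x # xs" "pair_pmf p (pmf_listprod ps)" "(y, ys)"]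
    by (auto simp: xs inj_on_def)
  then show ?case
    using Cons.IH[OF xs(2)] by (simp add: xs pmf_pair prod.lessThan_Suc_shift del: prod.lessThan_Suc)
qed

lemma pmf_prod_prob:
  assumes "length xs = n"
  shows "pmf (prod_prob n P) xs = (\<Prod>i\<in>{1..n}. pmf (P i) (xs ! (i - 1)))"
proof -
  have "pmf (prod_prob n P) xs = (\<Prod>i<n. pmf (P (Suc i)) (xs ! i))"
    using assms by (simp add: prod_prob_def pmf_pmf_listprod del: upt_Suc)
  also have "\<dots> = (\<Prod>i\<in>{1..n}. pmf (P i) (xs ! (i - 1)))"
    by (rule prod.reindex_bij_witness[of _ "\<lambda>i. i - 1" Suc]) auto
  finally show ?thesis .
qed

lemma prod_prob_in_prob_on:
  assumes "\<And>i. i \<in> {1..n} \<Longrightarrow> P i \<in> prob_on (\<Omega> i)"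
  shows "prod_prob n P \<in> prob_on (prod_alphabet n \<Omega>)"
proof -
  have "(\<forall>i\<in>set is. P i \<in> prob_on (\<Omega> i)) \<Longrightarrow>
      set_pmf (pmf_listprod (map P is)) \<subseteq> listset (map \<Omega> is)" for "is"
    by (induction "is") (auto simp: set_Cons_def prob_on_def)
  from this[of "[1..<Suc n]"] assms show ?thesis
    by (auto simp: prob_on_def prod_prob_def prod_alphabet_def)
qed

definition independent_ensembles ::
  "nat \<Rightarrow> (nat \<Rightarrow> 'a::encodable set) \<Rightarrow> (nat \<Rightarrow> 'a pmf) \<Rightarrow> (nat \<Rightarrow> 'a stream) \<Rightarrow> bool" where
  "independent_ensembles n \<Omega> P \<alpha> \<longleftrightarrow>
     ensemble (prod_alphabet n \<Omega>) (prod_prob n P) (prod_seq n \<alpha>)"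

end

theory Submission
  imports Defs
begin

text \<open>
  The theorem is van Lambalgen's theorem for Bernoulli measures over countable alphabets, used once
  for each \<open>k < n\<close>: the product of \<open>\<alpha>\<^sub>k, \<dots>, \<alpha>\<^sub>n\<close> is random if and only if the product \<open>Y\<close> of
  \<open>\<alpha>\<^sub>k\<^sub>+\<^sub>1, \<dots>, \<alpha>\<^sub>n\<close> is random and \<open>X =
      \<alpha>\<^sub>k\<close> is random relative to \<open>\<alpha>\<^sub>k\<^sub>+\<^sub>1, \<dots>, \<alpha>\<^sub>n\<close>.  Going down from
  \<open>k = n\<close>, where the product is \<open>\<alpha>\<^sub>n\<close> alone (\<open>random_singleton\<close>), this splits independence into the
  relative randomness of each \<open>\<alpha>\<^sub>k\<close>.  Only sums of probabilities of the first component \<open>P\<^sub>k\<close> are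
  ever computed.

  If \<open>X\<close> fails a test relative to \<open>Y\<close>, the machine of that test can be run with a prefix of any
  other \<open>Y'\<close> in place of \<open>Y\<close>.  As \<open>P\<^sub>k\<close> is computable, a finite stage of the enumerated set can be
  recognized as having total weight below \<open>2\<^sup>-\<^sup>m\<close>; the stages that are so recognized have a union of
  measure at most \<open>2\<^sup>-\<^sup>m\<close>, for every \<open>Y'\<close>, and by Fubini's theorem the pairs \<open>(X', Y')\<close> with \<open>X'\<close> in
  that union form a test for the product.  For the true \<open>Y\<close> every stage is recognized, so the pair
  \<open>(X, Y)\<close> fails this test (\<open>independent_imp_random_rel\<close>).  That the product of a random sequence
  projects to a random sequence is \<open>random_tail\<close>.

  Conversely let \<open>U\<^sub>m\<close> be a test for the product.  The \<open>Y'\<close> at which the section of \<open>U\<^sub>2\<^sub>m\<^sub>+\<^sub>1\<close> has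
  measure above \<open>2\<^sup>-\<^sup>m\<close> form an effectively open set, because lower bounds for sums of the weights
  \<open>P\<^sub>k\<close> can be enumerated; by Markov's inequality its measure is at most \<open>2\<^sup>-\<^sup>m\<^sup>-\<^sup>1\<close>.  The unions of its
  tails form a test, which the random \<open>Y\<close> avoids at some level \<open>j\<close>.  From there on the sections at
  \<open>Y\<close> are small: they are a test relative to \<open>Y\<close>, which \<open>X\<close> avoids
  (\<open>random_rel_imp_independent\<close>).

  Everything about machines enters through three facts.  A set \<open>{x. \<exists>w. f (x, w)}\<close> with \<open>f\<close> primitive
  recursive in the oracle is accepted by an oracle machine (\<open>re_in_machine\<close>).  Acceptance by a given
  machine is a set of this form, uniformly in an oracle that is given as a finite object
  (\<open>re_accepts\<close>).  A computation asks finitely many queries, so it is a computation with a prefix of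
  the oracle sequences as oracle (\<open>accepts_use\<close>).
\<close>

section \<open>Register programs on oracle Turing machines\<close>

text \<open>
  A register is a tape on which a number is written in unary.  Register 1 is the query tape: \<open>Ask\<close>
  replaces its contents by the answer of the oracle.
\<close>

datatype com = Skip | Inc nat | Dec nat | Ask | Seq com com | While nat com

inductive exec :: "(nat \<rightharpoonup> nat) \<Rightarrow> com \<Rightarrow> (nat \<Rightarrow> nat) \<Rightarrow> (nat \<Rightarrow>
    nat) \<Rightarrow> bool" for orc where
  exec_Skip: "exec orc Skip s s"
| exec_Inc: "exec orc (Inc r) s (s(r := Suc (s r)))"
| exec_Dec: "exec orc (Dec r) s (s(r := s r - 1))"
| exec_Ask: "orc (s 1) = Some a \<Longrightarrow> exec orc Ask s (s(1 := a))"
| exec_Seq: "exec orc c s t \<Longrightarrow> exec orc d t u \<Longrightarrow> exec orc (Seq c d) s u"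
| exec_While_False: "s r = 0 \<Longrightarrow> exec orc (While r c) s s"
| exec_While_True: "s r \<noteq> 0 \<Longrightarrow> exec orc c s t \<Longrightarrow> exec orc (While r c) t u \<Longrightarrow> exec orc (While r c) s u"

text \<open>
  Flat code with absolute jump targets; \<open>compile c q\<close> is the code of \<open>c\<close> when it is placed at
  address \<open>q\<close>, and it is left at the address \<open>q + clen c\<close>.
\<close>

datatype instr = IInc nat | IDec nat | IAsk | IJz nat nat | IGoto nat

fun clen :: "com \<Rightarrow> nat" where
  "clen Skip = 0"
| "clen (Inc r) = 1"
| "clen (Dec r) = 1"
| "clen Ask = 1"
| "clen (Seq c d) = clen c + clen d"
| "clen (While r c) = clen c + 2"

fun compile :: "com \<Rightarrow> nat \<Rightarrow> instr list" where
  "compile Skip q = []"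
| "compile (Inc r) q = [IInc r]"
| "compile (Dec r) q = [IDec r]"
| "compile Ask q = [IAsk]"
| "compile (Seq c d) q = compile c q @ compile d (q + clen c)"
| "compile (While r c) q = IJz r (q + clen c + 2) # compile c (Suc q) @ [IGoto q]"

lemma length_compile [simp]: "length (compile c q) = clen c"
  by (induction c arbitrary: q) auto

fun regs :: "com \<Rightarrow> nat set" where
  "regs Skip = {}"
| "regs (Inc r) = {r}"
| "regs (Dec r) = {r}"
| "regs Ask = {}"
| "regs (Seq c d) = regs c \<union> regs d"
| "regs (While r c) = insert r (regs c)"

lemma finite_regs: "finite (regs c)"
  by (induction c) auto

fun iregs :: "instr \<Rightarrow> nat set" where
  "iregs (IInc r) = {r}"
| "iregs (IDec r) = {r}"
| "iregs (IJz r q) = {r}"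
| "iregs _ = {}"

lemma iregs_compile: "i \<in> set (compile c q) \<Longrightarrow> iregs i \<subseteq> regs c"
  by (induction c arbitrary: q) fastforce+

fun iexec :: "(nat \<rightharpoonup> nat) \<Rightarrow> instr \<Rightarrow> nat \<times> (nat \<Rightarrow> nat) \<Rightarrow> (nat
    \<times> (nat \<Rightarrow> nat)) option" where
  "iexec orc (IInc r) (q, s) = Some (Suc q, s(r := Suc (s r)))"
| "iexec orc (IDec r) (q, s) = Some (Suc q, s(r := s r - 1))"
| "iexec orc IAsk (q, s) = map_option (\<lambda>a. (Suc q, s(1 := a))) (orc (s 1))"
| "iexec orc (IJz r q') (q, s) = Some (if s r = 0 then q' else Suc q, s)"
| "iexec orc (IGoto q') (q, s) = Some (q', s)"

definition istep :: "(nat \<rightharpoonup> nat) \<Rightarrow> instr list \<Rightarrow> nat \<times> (nat \<Rightarrow> nat) \<Rightarrow>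
    nat \<times> (nat \<Rightarrow> nat) \<Rightarrow> bool" where
  "istep orc p c d \<longleftrightarrow> fst c < length p \<and> iexec orc (p ! fst c) c = Some d"

lemma istep_append: "istep orc (pre @ i # post) (length pre, s) d \<longleftrightarrow> iexec orc i (length pre, s) = Some d"
  by (simp add: istep_def nth_append)

lemma compile_correct:
  assumes "exec orc c s t" "p = pre @ compile c (length pre) @ post"
  shows "(istep orc p)\<^sup>*\<^sup>* (length pre, s) (length pre + clen c, t)"
  using assms
proof (induction arbitrary: pre post rule: exec.induct)
  case (exec_Seq c s t d u)
  have "(istep orc p)\<^sup>*\<^sup>* (length pre, s) (length pre + clen c, t)"
    by (rule exec_Seq.IH(1)[of pre "compile d (length pre + clen c) @ post"]) (simp add: exec_Seq.prems)
  moreover have "(istep orc p)\<^sup>*\<^sup>* (length (pre @ compile c (length pre)), t) (length (pre @ compile c (length pre)) + clen d, u)"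
    by (rule exec_Seq.IH(2)[of _ post]) (simp add: exec_Seq.prems)
  ultimately show ?case by (simp add: add.assoc)
next
  case (exec_While_False s r c)
  then have "istep orc p (length pre, s) (length pre + clen c + 2, s)"
    by (simp add: istep_append)
  then show ?case by (simp add: r_into_rtranclp)
next
  case (exec_While_True s r c t u)
  let ?pre = "pre @ [IJz r (length pre + clen c + 2)]"
  let ?pre2 = "?pre @ compile c (Suc (length pre))"
  have 1: "istep orc p (length pre, s) (Suc (length pre), s)"
    using exec_While_True by (simp add: istep_append)
  have 2: "(istep orc p)\<^sup>*\<^sup>* (length ?pre, s) (length ?pre + clen c, t)"
    by (rule exec_While_True.IH(1)[of ?pre "[IGoto (length pre)] @ post"]) (simp add: exec_While_True.prems)
  have "istep orc (?pre2 @ IGoto (length pre) # post) (length ?pre2, t) (length pre, t)"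
    by (subst istep_append) simp
  then have 3: "istep orc p (length ?pre + clen c, t) (length pre, t)"
    by (simp add: exec_While_True.prems)
  have 4: "(istep orc p)\<^sup>*\<^sup>* (length pre, t) (length pre + clen (While r c), u)"
    by (rule exec_While_True.IH(2)) (rule exec_While_True.prems)
  show ?case
    using 1 2 rtranclp.rtrancl_into_rtrancl[OF 2 3] 4
    by (metis (no_types, lifting) converse_rtranclp_into_rtranclp length_append_singleton rtranclp_trans)
qed (auto simp: istep_append intro!: r_into_rtranclp)

text \<open>
  One turn of a loop takes the machine from the head of the loop back to it in at least one step.
  This is what is needed about loops that do not end.
\<close>

lemma compile_While_step:
  assumes "exec orc c s t" "s r \<noteq> 0" "p = pre @ compile (While r c) (length pre) @ post"
  shows "(istep orc p)\<^sup>+\<^sup>+ (length pre, s) (length pre, t)"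
proof -
  let ?pre = "pre @ [IJz r (length pre + clen c + 2)]"
  let ?pre2 = "?pre @ compile c (Suc (length pre))"
  have 1: "istep orc p (length pre, s) (Suc (length pre), s)"
    using assms by (simp add: istep_append)
  have 2: "(istep orc p)\<^sup>*\<^sup>* (length ?pre, s) (length ?pre + clen c, t)"
    by (rule compile_correct[OF assms(1), of _ ?pre "[IGoto (length pre)] @ post"]) (simp add: assms)
  have "istep orc (?pre2 @ IGoto (length pre) # post) (length ?pre2, t) (length pre, t)"
    by (subst istep_append) simp
  then have 3: "istep orc p (length ?pre + clen c, t) (length pre, t)"
    by (simp add: assms)
  show ?thesis
    using 1 rtranclp_into_tranclp1[OF 2 3] by (simp add: tranclp_into_tranclp2)
qed

definition keep :: "nat list \<Rightarrow> (nat \<times> move) list" where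
  "keep ss = map (\<lambda>a. (a, Stay)) ss"

text \<open>
  The state \<open>2 * q\<close> stands for the address \<open>q\<close>.  An increment needs two steps, moving left and then
  writing a \<open>1\<close>; the odd state \<open>2 * q + 1\<close> lies between them.
\<close>

fun itrans :: "instr \<Rightarrow> nat \<times> nat list \<Rightarrow> nat \<times> (nat \<times> move) list" where
  "itrans (IInc r) (q, ss) =
     (Suc q, if even q then (keep ss)[r := (ss ! r, GoLeft)] else (keep ss)[r := (1, Stay)])"
| "itrans (IDec r) (q, ss) = (q + 2, (keep ss)[r := (0, GoRight)])"
| "itrans (IJz r q') (q, ss) = (if ss ! r = 0 then 2 * q' else q + 2, keep ss)"
| "itrans (IGoto q') (q, ss) = (2 * q', keep ss)"
| "itrans IAsk (q, ss) = (q + 2, keep ss)"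

definition instr_otm :: "nat \<Rightarrow> instr list \<Rightarrow> otm" where
  "instr_otm k p = \<lparr> work_tapes = k, start_state = 0, accept_state = 2 * length p,
     trans_fun = (\<lambda>(q, ss). if q < 2 * length p \<and> length ss = k + 2 \<and> set ss \<subseteq> {0, 1}
        then Some (itrans (p ! (q div 2)) (q, ss)) else None),
     query_fun = (\<lambda>q. if q < 2 * length p \<and> p ! (q div 2) = IAsk then Some (q + 2) else None) \<rparr>"

lemma length_itrans: "itrans i (q, ss) = (q', as) \<Longrightarrow> length as = length ss"
  by (cases i) (auto simp: keep_def split: if_splits)

lemma oracle_TM_instr_otm: "oracle_TM (instr_otm k p)"
proof -
  have "dom (trans_fun (instr_otm k p)) \<subseteq> {..<2 * length p} \<times> {ss. set ss \<subseteq> {0, 1} \<and> length ss = k + 2}"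
    by (auto simp: instr_otm_def split: if_splits)
  moreover have "finite {ss. set ss \<subseteq> {0 :: nat, 1} \<and> length ss = k + 2}"
    by (rule finite_lists_length_eq) simp
  ultimately have "finite (dom (trans_fun (instr_otm k p)))"
    by (meson finite_SigmaI finite_lessThan finite_subset)
  moreover have "dom (query_fun (instr_otm k p)) \<subseteq> {..<2 * length p}"
    by (auto simp: instr_otm_def split: if_splits)
  then have "finite (dom (query_fun (instr_otm k p)))"
    using finite_subset by blast
  ultimately show ?thesis
    by (auto simp: oracle_TM_def) (auto simp: instr_otm_def length_itrans split: if_splits)
qed

text \<open>
  A decrement leaves a blank behind, to the left of the head, and a read beyond the end of the list of
  cells adds a blank on the right.  Hence blanks are allowed on both sides of the block of \<open>1\<close>s.
\<close>

definition holds_number :: "tape \<Rightarrow> nat \<Rightarrow> bool" where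
  "holds_number t n \<longleftrightarrow> set (fst t) \<subseteq> {0} \<and> (\<exists>k. snd t = replicate n 1 @ replicate k 0)"

lemma holds_number_unary: "holds_number (unary_tape n) n"
  by (auto simp: holds_number_def unary_tape_def)

lemma holds_number_value: "holds_number t n \<Longrightarrow> tape_value t = n"
proof -
  assume "holds_number t n"
  then obtain k where "snd t = replicate n 1 @ replicate k 0" by (auto simp: holds_number_def)
  moreover have "takeWhile (\<lambda>s. s = 1) (replicate n 1 @ replicate k 0) = replicate n (1 :: nat)"
    by (induction n) (cases k; simp)+
  ultimately show ?thesis by (simp add: tape_value_def)
qed

lemma holds_number_read: "holds_number t n \<Longrightarrow> tape_read t = (if n = 0 then 0 else 1)"
proof -
  assume "holds_number t n"
  then obtain k where "snd t = replicate n 1 @ replicate k 0" by (auto simp: holds_number_def)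
  then show ?thesis by (cases n; cases k) (auto simp: tape_read_def)
qed

lemma holds_number_keep: "holds_number t n \<Longrightarrow> holds_number (tape_act (tape_read t, Stay) t) n"
proof -
  assume a: "holds_number t n"
  obtain l r where t: "t = (l, r)" by (cases t)
  obtain k where k: "r = replicate n 1 @ replicate k 0" using a by (auto simp: holds_number_def t)
  show ?thesis
  proof (cases r)
    case Nil
    then show ?thesis using a k by (auto simp: t tape_read_def holds_number_def intro!: exI[of _ 1])
  next
    case (Cons s r')
    then show ?thesis using a by (auto simp: t tape_read_def)
  qed
qed

lemma holds_number_dec: "holds_number t n \<Longrightarrow> holds_number (tape_act (0, GoRight) t) (n - 1)"
proof -
  assume a: "holds_number t n"
  obtain l r where t: "t = (l, r)" by (cases t)
  obtain k where k: "r = replicate n 1 @ replicate k 0" using a by (auto simp: holds_number_def t)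
  show ?thesis
    using a k by (cases n; cases k) (auto simp: t holds_number_def intro: exI[of _ 0] exI[of _ k])
qed

lemma holds_number_inc:
  assumes "holds_number t n"
  shows "tape_read (tape_act (tape_read t, GoLeft) t) \<in> {0, 1}"
    and "holds_number (tape_act (1, Stay) (tape_act (tape_read t, GoLeft) t)) (Suc n)"
proof -
  obtain l r where t: "t = (l, r)" by (cases t)
  obtain k where k: "r = replicate n 1 @ replicate k 0" using assms by (auto simp: holds_number_def t)
  have *: "\<exists>k'. tape_read t # tl r = replicate n 1 @ replicate k' 0"
    using k by (cases n; cases k) (auto simp: t tape_read_def intro: exI[of _ k] exI[of _ 1])
  show "tape_read (tape_act (tape_read t, GoLeft) t) \<in> {0, 1}"
    using assms by (cases l) (auto simp: t tape_read_def holds_number_def)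
  show "holds_number (tape_act (1, Stay) (tape_act (tape_read t, GoLeft) t)) (Suc n)"
    using assms * by (cases l) (auto simp: t holds_number_def)
qed

definition represents :: "nat \<Rightarrow> config \<Rightarrow> nat \<times> (nat \<Rightarrow> nat) \<Rightarrow> bool" where
  "represents k c d \<longleftrightarrow> fst c = 2 * fst d \<and> length (snd c) = k + 2 \<and>
     (\<forall>i<k + 2. holds_number (snd c ! i) (snd d i))"

lemma map2_keep: "map2 tape_act (keep (map tape_read ts)) ts = map (\<lambda>t. tape_act (tape_read t, Stay) t) ts"
  by (rule nth_equalityI) (auto simp: keep_def)

lemma map2_keep_update:
  "r < length ts \<Longrightarrow> map2 tape_act ((keep (map tape_read ts))[r := a]) ts =
     (map (\<lambda>t. tape_act (tape_read t, Stay) t) ts)[r := tape_act a (ts ! r)]"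
  by (rule nth_equalityI) (auto simp: keep_def nth_list_update)

lemma instr_otm_step:
  assumes "istep orc p d d'" "represents k c d" "\<Union>(iregs ` set p) \<subseteq> {..<k + 2}"
  shows "\<exists>c'. (\<lambda>c d. step orc (instr_otm k p) c = Some d)\<^sup>+\<^sup>+ c c' \<and> represents k c' d'"
proof -
  obtain q s where d: "d = (q, s)" by (cases d)
  obtain ts where c: "c = (2 * q, ts)" using assms(2) by (cases c) (auto simp: represents_def d)
  have len: "length ts = k + 2" and ts: "\<And>i. i < k + 2 \<Longrightarrow> holds_number (ts ! i) (s i)"
    using assms(2) by (auto simp: represents_def c d)
  have q: "q < length p" and ex: "iexec orc (p ! q) (q, s) = Some d'"
    using assms(1) by (auto simp: istep_def d)
  have rg: "iregs (p ! q) \<subseteq> {..<k + 2}" using assms(3) q by (meson UN_subset_iff nth_mem)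
  let ?R = "\<lambda>c d. step orc (instr_otm k p) c = Some d"
  have bits: "set (map tape_read ts) \<subseteq> {0, 1}"
  proof
    fix x assume "x \<in> set (map tape_read ts)"
    then obtain i where "i < k + 2" "x = tape_read (ts ! i)" by (auto simp: in_set_conv_nth len)
    then show "x \<in> {0, 1}" using holds_number_read[OF ts] by simp
  qed
  have ac: "2 * q \<noteq> accept_state (instr_otm k p)" "2 * q < 2 * length p" "Suc (2 * q) < 2 * length p"
    "Suc (2 * q) \<noteq> accept_state (instr_otm k p)"
    using q by (simp_all add: instr_otm_def)
  have stepE: "?R (q', us) (q'', vs)"
    if "itrans (p ! q) (q', map tape_read us) = (q'', as)" "vs = map2 tape_act as us"
      "q' div 2 = q" "p ! q \<noteq> IAsk" "set (map tape_read us) \<subseteq> {0, 1}" "length us = k + 2"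
    for q' q'' us vs as
  proof -
    have "q' < 2 * length p" using that q by linarith
    then show ?thesis using that
      by (simp add: step_def instr_otm_def)
  qed
  have keep: "\<And>i. i < k + 2 \<Longrightarrow> holds_number (map (\<lambda>t. tape_act (tape_read t, Stay) t) ts ! i) (s i)"
    using ts holds_number_keep len by simp
  show ?thesis
  proof (cases "p ! q")
    case (IInc r)
    then have r: "r < k + 2" using rg by simp
    define us where "us = (map (\<lambda>t. tape_act (tape_read t, Stay) t) ts)[r := tape_act (tape_read (ts ! r), GoLeft) (ts ! r)]"
    have us_r: "us ! r = tape_act (tape_read (ts ! r), GoLeft) (ts ! r)" using r len by (simp add: us_def)
    have us_i: "us ! i = tape_act (tape_read (ts ! i), Stay) (ts ! i)" if "i < k + 2" "i \<noteq> r" for i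
      using r len that by (simp add: us_def)
    have lus: "length us = k + 2" by (simp add: us_def len)
    have "?R c (Suc (2 * q), us)"
      unfolding c us_def 
      by (rule stepE[where as = "(keep (map tape_read ts))[r := (tape_read (ts ! r), GoLeft)]"])
         (use IInc bits len r in \<open>simp_all add: map2_keep_update\<close>)
    moreover
    have bits': "set (map tape_read us) \<subseteq> {0, 1}"
    proof
      fix x assume "x \<in> set (map tape_read us)"
      then obtain i where i: "i < k + 2" "x = tape_read (us ! i)" by (auto simp: in_set_conv_nth lus)
      show "x \<in> {0, 1}"
      proof (cases "i = r")
        case True then show ?thesis using i us_r holds_number_inc(1)[OF ts[OF r]] by simp
      next
        case False then show ?thesis using i us_i[of i] holds_number_read[OF holds_number_keep[OF ts[of i]]] by simp
      qed
    qed
    define vs where "vs = (map (\<lambda>t. tape_act (tape_read t, Stay) t) us)[r := tape_act (1, Stay) (us ! r)]"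
    have "?R (Suc (2 * q), us) (2 * Suc q, vs)"
      unfolding vs_def 
      by (rule stepE[where as = "(keep (map tape_read us))[r := (1, Stay)]"])
         (use IInc bits' lus r in \<open>simp_all add: map2_keep_update\<close>)
    ultimately have "?R\<^sup>+\<^sup>+ c (2 * Suc q, vs)" by (meson tranclp.r_into_trancl tranclp.trancl_into_trancl)
    moreover have "represents k (2 * Suc q, vs) d'"
    proof -
      have "holds_number (vs ! i) ((s(r := Suc (s r))) i)" if "i < k + 2" for i
      proof (cases "i = r")
        case True
        then show ?thesis using holds_number_inc(2)[OF ts[OF r]] r by (simp add: vs_def us_r lus)
      next
        case False
        then show ?thesis using that holds_number_keep[OF holds_number_keep[OF ts[of i]]] by (simp add: vs_def us_i lus)
      qed
      then show ?thesis using ex IInc lus by (auto simp: represents_def vs_def)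
    qed
    ultimately show ?thesis by blast
  next
    case (IDec r)
    then have r: "r < k + 2" using rg by simp
    define us where "us = (map (\<lambda>t. tape_act (tape_read t, Stay) t) ts)[r := tape_act (0, GoRight) (ts ! r)]"
    have "?R c (2 * Suc q, us)"
      unfolding c us_def 
      by (rule stepE[where as = "(keep (map tape_read ts))[r := (0, GoRight)]"])
         (use IDec bits len r in \<open>simp_all add: map2_keep_update\<close>)
    moreover have "represents k (2 * Suc q, us) d'"
      using ex IDec r len keep holds_number_dec[OF ts[OF r]]
      by (auto simp: represents_def us_def nth_list_update)
    ultimately show ?thesis by blast
  next
    case IAsk
    then obtain a where a: "orc (s 1) = Some a" "d' = (Suc q, s(1 := a))" using ex by auto
    have "tape_value (ts ! 1) = s 1" using ts[of 1] holds_number_value by simp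
    then have "?R c (2 * Suc q, ts[1 := unary_tape a])"
      using a IAsk ac q by (simp add: step_def c instr_otm_def)
    moreover have "represents k (2 * Suc q, ts[1 := unary_tape a]) d'"
      using a ts len holds_number_unary by (auto simp: represents_def nth_list_update)
    ultimately show ?thesis by blast
  next
    case (IJz r q')
    then have r: "r < k + 2" using rg by simp
    have "?R c (if s r = 0 then 2 * q' else 2 * Suc q, map (\<lambda>t. tape_act (tape_read t, Stay) t) ts)"
      unfolding c 
      by (rule stepE[where as = "keep (map tape_read ts)"])
         (use IJz bits len r holds_number_read[OF ts[OF r]] in \<open>simp_all add: map2_keep\<close>)
    moreover have "represents k (if s r = 0 then 2 * q' else 2 * Suc q, map (\<lambda>t. tape_act (tape_read t, Stay) t) ts) d'"
      using ex IJz keep len by (auto simp: represents_def)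
    ultimately show ?thesis by blast
  next
    case (IGoto q')
    have "?R c (2 * q', map (\<lambda>t. tape_act (tape_read t, Stay) t) ts)"
      unfolding c 
      by (rule stepE[where as = "keep (map tape_read ts)"])
         (use IGoto bits len in \<open>simp_all add: map2_keep\<close>)
    moreover have "represents k (2 * q', map (\<lambda>t. tape_act (tape_read t, Stay) t) ts) d'"
      using ex IGoto keep len by (auto simp: represents_def)
    ultimately show ?thesis by blast
  qed
qed

lemma instr_otm_steps:
  assumes "(istep orc p)\<^sup>*\<^sup>* d d'" "represents k c d" "\<Union>(iregs ` set p) \<subseteq> {..<k + 2}"
  shows "\<exists>c'. reaches orc (instr_otm k p) c c' \<and> represents k c' d'"
  using assms(1,2)
proof (induction rule: rtranclp_induct)
  case base
  then show ?case unfolding reaches_def by (intro exI[of _ c]) simp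
next
  case (step y z)
  then obtain c' where "reaches orc (instr_otm k p) c c'" "represents k c' y" by blast
  moreover obtain c'' where "(\<lambda>c d. Defs.step orc (instr_otm k p) c = Some d)\<^sup>+\<^sup>+ c' c''" "represents k c'' z"
    using instr_otm_step[OF step(2) \<open>represents k c' y\<close> assms(3)] by blast
  ultimately show ?case unfolding reaches_def by (meson rtranclp_trans tranclp_into_rtranclp)
qed

lemma instr_otm_steps1:
  assumes "(istep orc p)\<^sup>+\<^sup>+ d d'" "represents k c d" "\<Union>(iregs ` set p) \<subseteq> {..<k + 2}"
  shows "\<exists>c'. (\<lambda>c d. step orc (instr_otm k p) c = Some d)\<^sup>+\<^sup>+ c c' \<and> represents k c' d'"
proof -
  obtain e where e: "istep orc p d e" "(istep orc p)\<^sup>*\<^sup>* e d'" using assms(1) by (meson tranclpD)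
  obtain c1 where c1: "(\<lambda>c d. step orc (instr_otm k p) c = Some d)\<^sup>+\<^sup>+ c c1" "represents k c1 e"
    using instr_otm_step[OF e(1) assms(2,3)] by blast
  obtain c2 where "reaches orc (instr_otm k p) c1 c2" "represents k c2 d'"
    using instr_otm_steps[OF e(2) c1(2) assms(3)] by blast
  then show ?thesis using c1(1) unfolding reaches_def by (blast intro: tranclp_rtranclp_tranclp)
qed

text \<open>
  A halting run of a deterministic machine has a length, and each passage from one stage to the next
  shortens what is left of it.
\<close>

lemma no_halt:
  fixes f :: "'a \<Rightarrow> 'a option"
  assumes prog: "\<And>i c. Q i c \<Longrightarrow> \<exists>c'. (\<lambda>c d. f c = Some d)\<^sup>+\<^sup>+ c c' \<and> Q (Suc i) c'"
    and "Q i c" "(\<lambda>c d. f c = Some d)\<^sup>*\<^sup>* c h" "f h = None"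
  shows False
proof -
  let ?R = "\<lambda>c d. f c = Some d"
  have det: "(?R ^^ m) c e \<Longrightarrow> (?R ^^ (m + n)) c h \<Longrightarrow> (?R ^^ n) e h" for m n c e
  proof (induction m arbitrary: c)
    case (Suc m)
    from Suc.prems(1) obtain c1 where "f c = Some c1" "(?R ^^ m) c1 e"
      by (blast dest: relpowp_Suc_D2)
    moreover from Suc.prems(2) obtain c2 where "f c = Some c2" "(?R ^^ (m + n)) c2 h"
      unfolding add_Suc by (blast dest: relpowp_Suc_D2)
    ultimately show ?case using Suc.IH by simp
  qed simp
  have halt: "m = 0" if "(?R ^^ m) h e" for m e
  proof (cases m)
    case (Suc m')
    from that have "\<exists>c. ?R h c \<and> (?R ^^ m') c e" unfolding Suc by (rule relpowp_Suc_D2)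
    then show ?thesis using assms(4) by simp
  qed simp
  have "Q i c \<Longrightarrow> (?R ^^ n) c h \<Longrightarrow> False" for n i c
  proof (induction n arbitrary: i c rule: less_induct)
    case (less n)
    then obtain c' where "?R\<^sup>+\<^sup>+ c c'" and Q': "Q (Suc i) c'" using prog by blast
    then obtain m where m: "m > 0" "(?R ^^ m) c c'" by (auto simp: tranclp_power)
    show False
    proof (cases "m \<le> n")
      case True
      then have "(?R ^^ (n - m)) c' h" using det[OF m(2), of "n - m"] less.prems by simp
      then show False using less.IH[of "n - m"] Q' m True by simp
    next
      case False
      obtain e where "(?R ^^ n) c e" "(?R ^^ (m - n)) e c'"
        using m(2) False relpowp_add[of n "m - n" ?R] by (auto simp: OO_def)
      moreover from this have "e = h" using det[of n c e 0] less.prems by simp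
      ultimately show False using halt False by (metis diff_is_0_eq nat_le_linear)
    qed
  qed
  then show False using assms(2,3) by (meson rtranclp_imp_relpowp)
qed

abbreviation clear :: "nat \<Rightarrow> com" where
  "clear r \<equiv> While r (Dec r)"

abbreviation mv :: "nat \<Rightarrow> nat \<Rightarrow> com" where
  "mv a b \<equiv> While a (Seq (Dec a) (Inc b))"

abbreviation dup :: "nat \<Rightarrow> nat \<Rightarrow> nat \<Rightarrow> com" where
  "dup a d b \<equiv> Seq (While a (Seq (Dec a) (Seq (Inc d) (Inc b)))) (mv b a)"

lemma exec_clear: "exec orc (clear r) s (s(r := 0))"
proof (induction "s r" arbitrary: s)
  case 0
  then show ?case using exec_While_False[of s r orc "Dec r"] by (metis fun_upd_triv)
next
  case (Suc n)
  have "exec orc (clear r) (s(r := s r - 1)) ((s(r := s r - 1))(r := 0))"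
    by (rule Suc.hyps(1)) (simp add: Suc.hyps(2)[symmetric])
  then show ?case using exec_While_True[OF _ exec_Dec[of orc r s]] Suc.hyps(2) by simp
qed

lemma exec_mv:
  assumes "a \<noteq> b"
  shows "exec orc (mv a b) s (s(a := 0, b := s b + s a))"
proof (induction "s a" arbitrary: s)
  case 0
  then have *: "s(a := 0, b := s b + s a) = s" by auto
  show ?case unfolding * by (rule exec_While_False) (simp add: 0[symmetric])
next
  case (Suc n)
  let ?t = "s(a := s a - 1, b := Suc (s b))"
  have "exec orc (mv a b) ?t (?t(a := 0, b := ?t b + ?t a))"
    by (rule Suc.hyps(1)) (use assms in \<open>simp add: Suc.hyps(2)[symmetric]\<close>)
  moreover have "?t(a := 0, b := ?t b + ?t a) = s(a := 0, b := s b + s a)"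
    using assms Suc.hyps(2) by (auto simp: fun_eq_iff)
  moreover have "exec orc (Seq (Dec a) (Inc b)) s ?t"
    using exec_Seq[OF exec_Dec[of orc a s] exec_Inc[of orc b]] assms by simp
  ultimately show ?case using exec_While_True[of s a orc _ ?t] Suc.hyps(2) by simp
qed

lemma exec_dup:
  assumes "distinct [a, d, b]" "s b = 0"
  shows "exec orc (dup a d b) s (s(d := s d + s a))"
proof -
  have "exec orc (While a (Seq (Dec a) (Seq (Inc d) (Inc b)))) s (s(a := 0, d := s d + s a, b := s b + s a))" for s
  proof (induction "s a" arbitrary: s)
    case 0
    then have *: "s(a := 0, d := s d + s a, b := s b + s a) = s" by auto
    show ?case unfolding * by (rule exec_While_False) (simp add: 0[symmetric])
  next
    case (Suc n)
    let ?c = "Seq (Dec a) (Seq (Inc d) (Inc b))"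
    let ?t = "s(a := s a - 1, d := Suc (s d), b := Suc (s b))"
    have "exec orc (While a ?c) ?t (?t(a := 0, d := ?t d + ?t a, b := ?t b + ?t a))"
      by (rule Suc.hyps(1)) (use assms in \<open>simp add: Suc.hyps(2)[symmetric]\<close>)
    moreover have "?t(a := 0, d := ?t d + ?t a, b := ?t b + ?t a) = s(a := 0, d := s d + s a, b := s b + s a)"
      using assms Suc.hyps(2) by (auto simp: fun_eq_iff)
    moreover have "exec orc ?c s ?t"
    proof -
      let ?t1 = "s(a := s a - 1)" and ?t2 = "s(a := s a - 1, d := Suc (s d))"
      have "exec orc (Inc d) ?t1 ?t2" using exec_Inc[of orc d ?t1] assms by simp
      moreover have "exec orc (Inc b) ?t2 ?t" using exec_Inc[of orc b ?t2] assms by simp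
      ultimately show ?thesis using exec_Dec[of orc a s] by (blast intro: exec_Seq)
    qed
    ultimately show ?case using exec_While_True[of s a orc _ ?t] Suc.hyps(2) by simp
  qed
  from this[of s] exec_mv[of b a orc "s(a := 0, d := s d + s a, b := s b + s a)"] assms
  have "exec orc (dup a d b) s ((s(a := 0, d := s d + s a, b := s b + s a))(b := 0, a := s a))"
    by (auto intro: exec_Seq)
  moreover have "(s(a := 0, d := s d + s a, b := s b + s a))(b := 0, a := s a) = s(d := s d + s a)"
    using assms by (auto simp: fun_eq_iff)
  ultimately show ?thesis by simp
qed

text \<open>
  Programs that evaluate \<open>F\<close> are composed by giving each of them fresh registers: the registers
  from \<open>b\<close> on and the query register hold \<open>0\<close> at the start, and again at the end.
\<close>

definition assigns :: "(nat \<rightharpoonup> nat) \<Rightarrow> nat \<Rightarrow> com \<Rightarrow> nat \<Rightarrow> (nat list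
    \<Rightarrow> nat) \<Rightarrow> nat list \<Rightarrow> bool" where
  "assigns orc b c d F rs \<longleftrightarrow> (\<forall>s. s d = 0 \<and> s 1 = 0 \<and> (\<forall>i\<ge>b. s i = 0) \<longrightarrow>
      exec orc c s (s(d := F (map s rs))))"

definition frame :: "nat \<Rightarrow> nat \<Rightarrow> nat \<Rightarrow> nat list \<Rightarrow> bool" where
  "frame k b d rs \<longleftrightarrow> 2 \<le> b \<and> length rs = k \<and> set rs \<subseteq> {..<b} - {1, d} \<and> d < b \<and> d \<noteq> 1"

text \<open>
  The program may depend on the choice of registers, but not on their contents.
\<close>

definition regc :: "(nat \<rightharpoonup> nat) \<Rightarrow> nat \<Rightarrow> (nat list \<Rightarrow> nat) \<Rightarrow> bool" where
  "regc orc k F \<longleftrightarrow> (\<forall>b d rs. frame k b d rs \<longrightarrow> (\<exists>c. assigns orc b c d F rs))"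

lemma regcI: "(\<And>b d rs. frame k b d rs \<Longrightarrow> \<exists>c. assigns orc b c d F rs) \<Longrightarrow> regc orc k F"
  unfolding regc_def by blast

lemma regcE:
  assumes "regc orc k F" "frame k b d rs"
  obtains c where "assigns orc b c d F rs"
  using assms unfolding regc_def by blast

lemma assignsI:
  "(\<And>s. s d = 0 \<Longrightarrow> s 1 = 0 \<Longrightarrow> (\<And>i. b \<le> i \<Longrightarrow> s i = 0) \<Longrightarrow>
      exec orc c s (s(d := F (map s rs)))) \<Longrightarrow>
     assigns orc b c d F rs"
  by (simp add: assigns_def)

lemma assignsD:
  "assigns orc b c d F rs \<Longrightarrow> s d = 0 \<Longrightarrow> s 1 = 0 \<Longrightarrow> (\<And>i. b \<le> i \<Longrightarrow> s i = 0) \<Longrightarrow>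
     exec orc c s (s(d := F (map s rs)))"
  by (simp add: assigns_def)

lemma frameD:
  assumes "frame k b d rs"
  shows "2 \<le> b" "length rs = k" "set rs \<subseteq> {..<b} - {1, d}" "d < b" "d \<noteq> 1"
  using assms by (simp_all add: frame_def)

lemma regc_cong:
  assumes "regc orc k F" "\<And>xs. length xs = k \<Longrightarrow> F xs = G xs"
  shows "regc orc k G"
  using assms unfolding regc_def assigns_def frame_def by simp

lemma regc_nth:
  assumes "i < k"
  shows "regc orc k (\<lambda>xs. xs ! i)"
proof (rule regcI)
  fix b d rs assume fr: "frame k b d rs"
  note * = frameD[OF fr]
  then have r: "rs ! i \<in> {..<b} - {1, d}" using assms nth_mem by blast
  show "\<exists>c. assigns orc b c d (\<lambda>xs. xs ! i) rs"
  proof (intro exI assignsI)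
    fix s :: "nat \<Rightarrow> nat" assume s: "s d = 0" "s 1 = 0" "\<And>i. b \<le> i \<Longrightarrow> s i = 0"
    have "exec orc (dup (rs ! i) d b) s (s(d := s d + s (rs ! i)))"
      by (rule exec_dup) (use r s * in auto)
    then show "exec orc (dup (rs ! i) d b) s (s(d := map s rs ! i))"
      using s assms * by simp
  qed
qed

lemma regc_const: "regc orc k (\<lambda>xs. n)"
proof (rule regcI)
  fix b d rs
  have ex: "exec orc (((\<lambda>c. Seq c (Inc d)) ^^ n) Skip) s (s(d := s d + n))" for s
  proof (induction n)
    case 0 then show ?case using exec_Skip[of orc s] by simp
  next
    case (Suc n)
    have "(s(d := s d + n))(d := Suc ((s(d := s d + n)) d)) = s(d := s d + Suc n)" by simp
    then show ?case using exec_Seq[OF Suc exec_Inc[of orc d]] by (simp del: fun_upd_upd fun_upd_apply)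
  qed
  show "\<exists>c. assigns orc b c d (\<lambda>xs. n) rs"
  proof (intro exI assignsI)
    fix s :: "nat \<Rightarrow> nat" assume "s d = 0"
    then show "exec orc (((\<lambda>c. Seq c (Inc d)) ^^ n) Skip) s (s(d := n))" using ex[of s] by simp
  qed
qed

lemma regc_Suc:
  assumes "regc orc k F"
  shows "regc orc k (\<lambda>xs. Suc (F xs))"
proof (rule regcI)
  fix b d rs assume fr: "frame k b d rs"
  note * = frameD[OF fr]
  obtain c where c: "assigns orc b c d F rs"
    using assms fr by (rule regcE)
  show "\<exists>c. assigns orc b c d (\<lambda>xs. Suc (F xs)) rs"
  proof (intro exI assignsI)
    fix s :: "nat \<Rightarrow> nat" assume s: "s d = 0" "s 1 = 0" "\<And>i. b \<le> i \<Longrightarrow> s i = 0"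
    show "exec orc (Seq c (Inc d)) s (s(d := Suc (F (map s rs))))"
      using exec_Seq[OF assignsD[OF c, of s] exec_Inc[of orc d]] s by simp
  qed
qed

lemma regc_comp:
  assumes "regc orc 1 G" "regc orc k F"
  shows "regc orc k (\<lambda>xs. G [F xs])"
proof (rule regcI)
  fix b d rs assume fr: "frame k b d rs"
  note * = frameD[OF fr]
  obtain c where c: "assigns orc (b + 1) c b F rs"
    by (rule regcE[OF assms(2), of "b + 1" b rs]) (use * in \<open>auto simp: frame_def\<close>)
  obtain e where e: "assigns orc (b + 1) e d G [b]"
    by (rule regcE[OF assms(1), of "b + 1" d "[b]"]) (use * in \<open>auto simp: frame_def\<close>)
  show "\<exists>c. assigns orc b c d (\<lambda>xs. G [F xs]) rs"
  proof (intro exI assignsI)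
    fix s :: "nat \<Rightarrow> nat" assume s: "s d = 0" "s 1 = 0" "\<And>i. b \<le> i \<Longrightarrow> s i = 0"
    let ?s = "s(b := F (map s rs))"
    have 1: "exec orc c s ?s" using s by (intro assignsD[OF c]) auto
    have 2: "exec orc e ?s (?s(d := G (map ?s [b])))" using s * by (intro assignsD[OF e]) auto
    have "?s(d := G (map ?s [b]), b := 0) = s(d := G [F (map s rs)])"
      using s * by (auto simp: fun_eq_iff)
    then show "exec orc (Seq c (Seq e (clear b))) s (s(d := G [F (map s rs)]))"
      using exec_Seq[OF 1 exec_Seq[OF 2 exec_clear[of orc b]]] by simp
  qed
qed

text \<open>
  The oracle is partial, and a query outside of its domain blocks the machine; so a query is
  allowed only if it is always answered.
\<close>

lemma regc_oracle:
  assumes "regc orc k F" "\<And>xs. length xs = k \<Longrightarrow> F xs \<in> dom orc"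
  shows "regc orc k (\<lambda>xs. the (orc (F xs)))"
proof (rule regcI)
  fix b d rs assume fr: "frame k b d rs"
  note * = frameD[OF fr]
  obtain c where c: "assigns orc (b + 1) c b F rs"
    by (rule regcE[OF assms(1), of "b + 1" b rs]) (use * in \<open>auto simp: frame_def\<close>)
  show "\<exists>c. assigns orc b c d (\<lambda>xs. the (orc (F xs))) rs"
  proof (intro exI assignsI)
    fix s :: "nat \<Rightarrow> nat" assume s: "s d = 0" "s 1 = 0" "\<And>i. b \<le> i \<Longrightarrow> s i = 0"
    let ?x = "F (map s rs)"
    have 1: "exec orc c s (s(b := ?x))" using s by (intro assignsD[OF c]) auto
    have 2: "exec orc (mv b 1) (s(b := ?x)) (s(1 := ?x))"
    proof -
      have "(s(b := ?x))(b := 0, 1 := (s(b := ?x)) 1 + (s(b := ?x)) b) = s(1 := ?x)"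
        using s * by (auto simp: fun_eq_iff)
      then show ?thesis using exec_mv[of b 1 orc "s(b := ?x)"] * by simp
    qed
    obtain a where a: "orc ?x = Some a" using assms(2)[of "map s rs"] * by auto
    have 3: "exec orc Ask (s(1 := ?x)) (s(1 := a))"
      using exec_Ask[of orc "s(1 := ?x)" a] a by simp
    have 4: "exec orc (mv 1 d) (s(1 := a)) (s(d := a))"
    proof -
      have "(s(1 := a))(1 := 0, d := (s(1 := a)) d + (s(1 := a)) 1) = s(d := a)"
        using s * by (auto simp: fun_eq_iff)
      then show ?thesis using exec_mv[of 1 d orc "s(1 := a)"] * by simp
    qed
    show "exec orc (Seq c (Seq (mv b 1) (Seq Ask (mv 1 d)))) s (s(d := the (orc ?x)))"
      using exec_Seq[OF 1 exec_Seq[OF 2 exec_Seq[OF 3 4]]] a by simp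
  qed
qed

text \<open>
  The register \<open>b\<close> counts down the remaining rounds, \<open>b + 1\<close> counts up, \<open>b + 2\<close> holds the
  current value and \<open>b + 3\<close> the next one.
\<close>

lemma regc_rec:
  assumes "regc orc k A" "regc orc (Suc (Suc k)) H" "regc orc k N"
  shows "regc orc k (\<lambda>xs. rec_nat (A xs) (\<lambda>i r. H (i # r # xs)) (N xs))"
proof (rule regcI)
  fix b d rs assume fr: "frame k b d rs"
  note * = frameD[OF fr]
  let ?n = b and ?i = "b + 1" and ?a = "b + 2" and ?x = "b + 3" and ?b = "b + 4"
  obtain cN where cN: "assigns orc ?b cN ?n N rs"
    by (rule regcE[OF assms(3), of ?b ?n rs]) (use * in \<open>auto simp: frame_def\<close>)
  obtain cA where cA: "assigns orc ?b cA ?a A rs"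
    by (rule regcE[OF assms(1), of ?b ?a rs]) (use * in \<open>auto simp: frame_def\<close>)
  obtain cH where cH: "assigns orc ?b cH ?x H (?i # ?a # rs)"
    by (rule regcE[OF assms(2), of ?b ?x "?i # ?a # rs"]) (use * in \<open>auto simp: frame_def\<close>)
  let ?body = "Seq (Dec ?n) (Seq cH (Seq (clear ?a) (Seq (mv ?x ?a) (Inc ?i))))"
  show "\<exists>c. assigns orc b c d (\<lambda>xs. rec_nat (A xs) (\<lambda>i r. H (i # r # xs)) (N xs)) rs"
  proof (intro exI assignsI)
    fix s :: "nat \<Rightarrow> nat" assume s: "s d = 0" "s 1 = 0" "\<And>i. b \<le> i \<Longrightarrow> s i = 0"
    define n where "n = N (map s rs)"
    define val where "val = rec_nat (A (map s rs)) (\<lambda>i r. H (i # r # map s rs))"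
    define S where "S i = s(?n := n - i, ?i := i, ?a := val i)" for i
    have map: "map t rs = map s rs" if "\<And>i. i < b \<Longrightarrow> i \<noteq> d \<Longrightarrow> t i = s i" for t
      using that * by (auto simp: subset_iff)
    have 1: "exec orc cN s (s(?n := n))" unfolding n_def using s * by (intro assignsD[OF cN]) auto
    have 2: "exec orc cA (s(?n := n)) (S 0)"
    proof -
      have "(s(?n := n))(?a := A (map (s(?n := n)) rs)) = S 0"
        using s map[of "s(?n := n)"] by (auto simp: S_def val_def simp del: map_eq_conv)
      moreover have "exec orc cA (s(?n := n)) ((s(?n := n))(?a := A (map (s(?n := n)) rs)))"
        using s * by (intro assignsD[OF cA]) auto
      ultimately show ?thesis by simp
    qed
    have body: "exec orc ?body (S i) (S (Suc i))" if "i < n" for i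
    proof -
      let ?S1 = "(S i)(?n := n - Suc i)"
      let ?S2 = "?S1(?x := val (Suc i))"
      let ?S3 = "?S2(?a := 0)"
      let ?S4 = "?S3(?x := 0, ?a := val (Suc i))"
      have "exec orc (Dec ?n) (S i) ?S1"
        using exec_Dec[of orc ?n "S i"] by (simp add: S_def)
      moreover have "exec orc cH ?S1 ?S2"
      proof -
        have "H (map ?S1 (?i # ?a # rs)) = val (Suc i)"
          using map[of ?S1] by (simp add: S_def val_def del: map_eq_conv)
        moreover have "exec orc cH ?S1 (?S1(?x := H (map ?S1 (?i # ?a # rs))))"
          using s * by (intro assignsD[OF cH]) (auto simp: S_def)
        ultimately show ?thesis by simp
      qed
      moreover have "exec orc (clear ?a) ?S2 ?S3" by (rule exec_clear)
      moreover have "exec orc (mv ?x ?a) ?S3 ?S4"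
        using exec_mv[of ?x ?a orc ?S3] by simp
      moreover have "exec orc (Inc ?i) ?S4 (S (Suc i))"
      proof -
        have "?S4(?i := Suc (?S4 ?i)) = S (Suc i)"
          using s by (auto simp: S_def fun_eq_iff)
        then show ?thesis using exec_Inc[of orc ?i ?S4] by simp
      qed
      ultimately show ?thesis by (blast intro: exec_Seq)
    qed
    have 3: "exec orc (While ?n ?body) (S i) (S n)" if "i \<le> n" for i
      using that
    proof (induction rule: inc_induct)
      case base
      then show ?case by (rule exec_While_False) (simp add: S_def)
    next
      case (step i)
      then show ?case by (intro exec_While_True[OF _ body step.IH]) (simp_all add: S_def)
    qed
    have 4: "exec orc (mv ?a d) (S n) ((S n)(?a := 0, d := val n))"
      using exec_mv[of ?a d orc "S n"] * s by (simp add: S_def)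
    have "(S n)(?a := 0, d := val n, ?i := 0) = s(d := val n)"
      using s * by (auto simp: S_def fun_eq_iff)
    then have 5: "exec orc (clear ?i) ((S n)(?a := 0, d := val n)) (s(d := val n))"
      using exec_clear[of orc ?i "(S n)(?a := 0, d := val n)"] by simp
    show "exec orc (Seq cN (Seq cA (Seq (While ?n ?body) (Seq (mv ?a d) (clear ?i))))) s
        (s(d := rec_nat (A (map s rs)) (\<lambda>i r. H (i # r # map s rs)) (N (map s rs))))"
      using exec_Seq[OF 1 exec_Seq[OF 2 exec_Seq[OF 3[of 0] exec_Seq[OF 4 5]]]] by (simp add: val_def n_def)
  qed
qed

text \<open>
  Register 2 holds the candidate \<open>w\<close>.  Register 3 controls the loop: it is \<open>1\<close> at first, to enter the
  loop, and then the last value of \<open>F\<close>.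
\<close>

theorem search_machine:
  assumes "regc orc 2 F"
  shows "\<exists>M. oracle_TM M \<and> (\<forall>x. accepts orc M x \<longleftrightarrow> (\<exists>w. F [x, w] = 0))"
proof -
  obtain c where c: "assigns orc 4 c 3 F [0, 2]"
    by (rule regcE[OF assms, of 4 3 "[0, 2]"]) (auto simp: frame_def)
  let ?body = "Seq (clear 3) (Seq c (Inc 2))"
  let ?prog = "compile (Seq (Inc 3) (While 3 ?body)) 0"
  define k where "k = Max (insert 4 (regs ?body))"
  define M where "M = instr_otm k ?prog"
  have rk: "\<Union>(iregs ` set ?prog) \<subseteq> {..<k + 2}"
  proof
    fix r assume "r \<in> \<Union>(iregs ` set ?prog)"
    then have "r \<in> regs (Seq (Inc 3) (While 3 ?body))" using iregs_compile by blast
    then have "r \<in> insert 4 (regs ?body) \<or> r = 3" by auto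
    moreover have "r \<le> k" if "r \<in> insert 4 (regs ?body)" for r
      unfolding k_def using that by (intro Max_ge) (auto simp: finite_regs)
    ultimately show "r \<in> {..<k + 2}" using \<open>\<And>r. r \<in> insert 4 (regs ?body) \<Longrightarrow> r \<le> k\<close>[of 4] by force
  qed
  let ?R = "\<lambda>c d. step orc M c = Some d"
  have prog: "?prog = [IInc 3] @ compile (While 3 ?body) (length [IInc 3]) @ []" by simp
  have "accepts orc M x \<longleftrightarrow> (\<exists>w. F [x, w] = 0)" for x
  proof -
    define s0 :: "nat \<Rightarrow> nat" where "s0 = (\<lambda>i. if i = 0 then x else 0)"
    define S where "S w = s0(2 := w, 3 := (case w of 0 \<Rightarrow> 1 | Suc v \<Rightarrow> F [x, v]))" for w
    have init: "represents k (init_config M x) (0, s0)"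
      using holds_number_unary
      by (auto simp: represents_def init_config_def M_def instr_otm_def s0_def nth_Cons split: nat.splits)
    have "istep orc ?prog (0, s0) (1, S 0)"
      by (auto simp: istep_def S_def s0_def fun_eq_iff)
    then have first: "(istep orc ?prog)\<^sup>*\<^sup>* (0, s0) (length [IInc 3], S 0)" by auto
    have body: "exec orc ?body (S w) (S (Suc w))" for w
    proof -
      have 1: "exec orc (clear 3) (S w) ((S w)(3 := 0))" by (rule exec_clear)
      have "exec orc c ((S w)(3 := 0)) (((S w)(3 := 0))(3 := F (map ((S w)(3 := 0)) [0, 2])))"
        by (rule assignsD[OF c]) (auto simp: S_def s0_def)
      then have 2: "exec orc c ((S w)(3 := 0)) ((S w)(3 := F [x, w]))"
        by (simp add: S_def s0_def)
      have 3: "exec orc (Inc 2) ((S w)(3 := F [x, w])) (S (Suc w))"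
      proof -
        have "((S w)(3 := F [x, w]))(2 := Suc (((S w)(3 := F [x, w])) 2)) = S (Suc w)"
          by (auto simp: S_def fun_eq_iff)
        then show ?thesis using exec_Inc[of orc 2 "(S w)(3 := F [x, w])"] by simp
      qed
      show ?thesis using exec_Seq[OF 1 exec_Seq[OF 2 3]] .
    qed
    show ?thesis
    proof
      assume "\<exists>w. F [x, w] = 0"
      then obtain w where w: "F [x, w] = 0" and least: "\<And>v. v < w \<Longrightarrow> F [x, v] \<noteq> 0"
        using exists_least_iff[of "\<lambda>w. F [x, w] = 0"] by auto
      have "exec orc (While 3 ?body) (S v) (S (Suc w))" if "v \<le> Suc w" for v
        using that
      proof (induction rule: inc_induct)
        case base
        then show ?case by (rule exec_While_False) (simp add: S_def w)
      next
        case (step v)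
        have "S v 3 \<noteq> 0" using least step by (cases v) (auto simp: S_def)
        then show ?case by (rule exec_While_True[OF _ body step.IH])
      qed
      from compile_correct[OF this[of 0] prog]
      have "(istep orc ?prog)\<^sup>*\<^sup>* (length [IInc 3], S 0) (length ?prog, S (Suc w))"
        by (simp add: prog)
      with first have "(istep orc ?prog)\<^sup>*\<^sup>* (0, s0) (length ?prog, S (Suc w))" by simp
      from instr_otm_steps[OF this init rk]
      show "accepts orc M x"
        by (auto simp: accepts_def represents_def M_def instr_otm_def)
    next
      assume "accepts orc M x"
      then obtain ts where ts: "reaches orc M (init_config M x) (accept_state M, ts)"
        by (auto simp: accepts_def)
      show "\<exists>w. F [x, w] = 0"
      proof (rule ccontr)
        assume no: "\<not> (\<exists>w. F [x, w] = 0)"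
        define Q where "Q w cf \<longleftrightarrow> (case w of 0 \<Rightarrow> represents k cf (0,
            s0) | Suc v \<Rightarrow> represents k cf (length [IInc 3], S v))" for w cf
        show False
        proof (rule no_halt[where f = "step orc M" and Q = Q])
          show "Q 0 (init_config M x)" using init by (simp add: Q_def)
          show "?R\<^sup>*\<^sup>* (init_config M x) (accept_state M, ts)" using ts by (simp add: reaches_def)
          show "step orc M (accept_state M, ts) = None" by (simp add: step_def)
          fix w cf assume Q: "Q w cf"
          show "\<exists>cf'. ?R\<^sup>+\<^sup>+ cf cf' \<and> Q (Suc w) cf'"
          proof (cases w)
            case 0
            have "(istep orc ?prog)\<^sup>+\<^sup>+ (0, s0) (length [IInc 3], S 0)"
              using \<open>istep orc ?prog (0, s0) (1, S 0)\<close> by auto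
            from instr_otm_steps1[OF this _ rk] Q 0 show ?thesis by (auto simp: Q_def M_def)
          next
            case (Suc v)
            have "S v 3 \<noteq> 0" using no by (cases v) (auto simp: S_def)
            from compile_While_step[OF body this prog]
            have "(istep orc ?prog)\<^sup>+\<^sup>+ (length [IInc 3], S v) (length [IInc 3], S (Suc v))" .
            from instr_otm_steps1[OF this _ rk] Q Suc show ?thesis by (auto simp: Q_def M_def)
          qed
        qed
      qed
    qed
  qed
  moreover have "oracle_TM M" by (simp add: M_def oracle_TM_instr_otm)
  ultimately show ?thesis by blast
qed

section \<open>Primitive recursion relative to an oracle\<close>

lemma exec_mono:
  assumes "exec orc c s t" "orc \<subseteq>\<^sub>m orc'"
  shows "exec orc' c s t"
  using assms(1)
proof induction
  case (exec_Ask s a)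
  then have "orc' (s 1) = Some a" using assms(2) by (metis domI map_le_def)
  then show ?case by (rule exec.exec_Ask)
qed (blast intro: exec.intros)+

lemma regc_mono:
  assumes "regc orc k F" "orc \<subseteq>\<^sub>m orc'"
  shows "regc orc' k F"
proof (rule regcI)
  fix b d rs assume "frame k b d rs"
  with assms(1) obtain c where "assigns orc b c d F rs" by (rule regcE)
  then show "\<exists>c. assigns orc' b c d F rs"
    unfolding assigns_def using exec_mono[OF _ assms(2)] by blast
qed

lemma regc_drop2:
  assumes "regc orc k F"
  shows "regc orc (Suc (Suc k)) (\<lambda>ys. F (drop 2 ys))"
proof (rule regcI)
  fix b d rs assume "frame (Suc (Suc k)) b d rs"
  then have "frame k b d (drop 2 rs)" using set_drop_subset[of 2 rs] by (auto simp: frame_def)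
  with assms obtain c where "assigns orc b c d F (drop 2 rs)" by (rule regcE)
  then show "\<exists>c. assigns orc b c d (\<lambda>ys. F (drop 2 ys)) rs"
    by (auto simp: assigns_def drop_map)
qed

lemma regc_if0:
  assumes "regc orc k F" "regc orc k G" "regc orc k H"
  shows "regc orc k (\<lambda>xs. if F xs = 0 then G xs else H xs)"
proof (rule regc_cong[OF regc_rec[OF assms(2) regc_drop2[OF assms(3)] assms(1)]])
  fix xs
  show "rec_nat (G xs) (\<lambda>i r. H (drop 2 (i # r # xs))) (F xs) = (if F xs = 0 then G xs else H xs)"
    by (cases "F xs") simp_all
qed

lemma regc_add:
  assumes "regc orc k F" "regc orc k G"
  shows "regc orc k (\<lambda>xs. F xs + G xs)"
proof (rule regc_cong[OF regc_rec[OF assms(1) regc_Suc[OF regc_nth[of 1]] assms(2)]])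
  have rec: "rec_nat m (\<lambda>i r. Suc r) n = m + n" for m n :: nat by (induction n) auto
  show "rec_nat (F xs) (\<lambda>i r. Suc ((i # r # xs) ! 1)) (G xs) = F xs + G xs" for xs
    using rec by simp
qed simp

lemma regc_pred:
  assumes "regc orc k F"
  shows "regc orc k (\<lambda>xs. F xs - 1)"
proof (rule regc_cong[OF regc_rec[OF regc_const[of _ _ 0] regc_nth[of 0] assms]])
  show "rec_nat 0 (\<lambda>i r. (i # r # xs) ! 0) (F xs) = F xs - 1" for xs
    by (cases "F xs") auto
qed simp

lemma regc_diff:
  assumes "regc orc k F" "regc orc k G"
  shows "regc orc k (\<lambda>xs. F xs - G xs)"
proof (rule regc_cong[OF regc_rec[OF assms(1) regc_pred[OF regc_nth[of 1]] assms(2)]])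
  have "rec_nat m (\<lambda>i r. r - 1) n = m - n" for m n :: nat by (induction n) auto
  then show "rec_nat (F xs) (\<lambda>i r. (i # r # xs) ! 1 - 1) (G xs) = F xs - G xs" for xs
    by simp
qed simp

lemma regc_mult:
  assumes "regc orc k F" "regc orc k G"
  shows "regc orc k (\<lambda>xs. F xs * G xs)"
proof (rule regc_cong[OF regc_rec[OF regc_const[of _ _ 0] regc_add[OF regc_nth[of 1] regc_drop2[OF assms(1)]] assms(2)]])
  have "rec_nat 0 (\<lambda>i r. r + m) n = m * n" for m n :: nat by (induction n) auto
  then show "rec_nat 0 (\<lambda>i r. (i # r # xs) ! 1 + F (drop 2 (i # r # xs))) (G xs) = F xs * G xs" for xs
    by simp
qed simp

lemma regc_triangle:
  assumes "regc orc k F"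
  shows "regc orc k (\<lambda>xs. triangle (F xs))"
proof (rule regc_cong[OF regc_rec[OF regc_const[of _ _ 0] regc_add[OF regc_nth[of 1] regc_Suc[OF regc_nth[of 0]]] assms]])
  have "rec_nat 0 (\<lambda>i r. r + Suc i) n = triangle n" for n :: nat by (induction n) auto
  then show "rec_nat 0 (\<lambda>i r. (i # r # xs) ! 1 + Suc ((i # r # xs) ! 0)) (F xs) = triangle (F xs)" for xs
    by simp
qed simp_all

lemma regc_prod_encode:
  assumes "regc orc k F" "regc orc k G"
  shows "regc orc k (\<lambda>xs. prod_encode (F xs, G xs))"
  using regc_add[OF regc_triangle[OF regc_add[OF assms]] assms(1)] by (simp add: prod_encode_def)

text \<open>
  The sum \<open>a + b\<close> of the pair with code \<open>n\<close>, found by walking along the codes: it increases exactly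
  at the triangular numbers.
\<close>

definition pair_diagonal :: "nat \<Rightarrow> nat" where
  "pair_diagonal n = rec_nat 0 (\<lambda>k d. if (Suc k - triangle (Suc d)) + (triangle (Suc d) - Suc k) = 0 then Suc d else d) n"

lemma triangle_mono: "m \<le> n \<Longrightarrow> triangle m \<le> triangle n"
  by (induction rule: dec_induct) auto

lemma pair_diagonal_bounds: "triangle (pair_diagonal n) \<le> n \<and> n < triangle (Suc (pair_diagonal n))"
  by (induction n) (auto simp: pair_diagonal_def)

lemma pair_diagonal: "pair_diagonal (prod_encode (a, b)) = a + b"
proof -
  let ?n = "prod_encode (a, b)" and ?d = "pair_diagonal (prod_encode (a, b))"
  have "triangle (a + b) \<le> ?n" "?n < triangle (Suc (a + b))" by (auto simp: prod_encode_def)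
  with pair_diagonal_bounds[of ?n] have "triangle (a + b) < triangle (Suc ?d)" "triangle ?d < triangle (Suc (a + b))"
    by linarith+
  then show ?thesis
    by (metis leD le_less_linear not_less_eq_eq order_antisym triangle_mono)
qed

lemma regc_pair_diagonal:
  assumes "regc orc k F"
  shows "regc orc k (\<lambda>xs. pair_diagonal (F xs))"
proof -
  have s: "regc orc (Suc (Suc k)) (\<lambda>ys. Suc (ys ! 0))" by (rule regc_Suc[OF regc_nth]) simp
  have d: "regc orc (Suc (Suc k)) (\<lambda>ys. ys ! 1)" by (rule regc_nth) simp
  have t: "regc orc (Suc (Suc k)) (\<lambda>ys. triangle (Suc (ys ! 1)))" by (rule regc_triangle[OF regc_Suc[OF d]])
  from regc_rec[OF regc_const[of _ _ 0] regc_if0[OF regc_add[OF regc_diff[OF s t] regc_diff[OF t s]] regc_Suc[OF d] d] assms]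
  show ?thesis unfolding pair_diagonal_def by (simp only: nth_Cons_0 One_nat_def nth_Cons_Suc)
qed

lemma regc_pair_fst:
  assumes "regc orc k F"
  shows "regc orc k (\<lambda>xs. fst (prod_decode (F xs)))"
proof (rule regc_cong[OF regc_diff[OF assms regc_triangle[OF regc_pair_diagonal[OF assms]]]])
  fix xs
  obtain a b where "F xs = prod_encode (a, b)" by (metis prod_decode_inverse surj_pair)
  then show "F xs - triangle (pair_diagonal (F xs)) = fst (prod_decode (F xs))"
    by (simp add: pair_diagonal) (simp add: prod_encode_def)
qed

lemma regc_pair_snd:
  assumes "regc orc k F"
  shows "regc orc k (\<lambda>xs. snd (prod_decode (F xs)))"
proof (rule regc_cong[OF regc_diff[OF regc_pair_diagonal[OF assms] regc_pair_fst[OF assms]]])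
  fix xs
  obtain a b where "F xs = prod_encode (a, b)" by (metis prod_decode_inverse surj_pair)
  then show "pair_diagonal (F xs) - fst (prod_decode (F xs)) = snd (prod_decode (F xs))"
    by (simp add: pair_diagonal)
qed

text \<open>
  A function between encodable types is primitive recursive in \<open>orc\<close> if some register program
  computes it on codes.  Nothing is said about numbers that are not codes.
\<close>

definition tracks :: "(nat \<rightharpoonup> nat) \<Rightarrow> (nat \<Rightarrow> nat) \<Rightarrow> ('a::encodable \<Rightarrow>
    'b::encodable) \<Rightarrow> bool" where
  "tracks orc g f \<longleftrightarrow> regc orc 1 (\<lambda>xs. g (xs ! 0)) \<and> (\<forall>x. g (encode x) = encode (f x))"

definition primrec_in :: "(nat \<rightharpoonup> nat) \<Rightarrow> ('a::encodable \<Rightarrow> 'b::encodable) \<Rightarrow> bool" where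
  "primrec_in orc f \<longleftrightarrow> (\<exists>g. tracks orc g f)"

lemma primrec_inI: "regc orc 1 (\<lambda>xs. g (xs ! 0)) \<Longrightarrow> (\<And>x. g (encode x) = encode (f x)) \<Longrightarrow> primrec_in orc f"
  by (auto simp: primrec_in_def tracks_def)

lemma primrec_inE: "primrec_in orc f \<Longrightarrow> (\<And>g. tracks orc g f \<Longrightarrow> thesis) \<Longrightarrow> thesis"
  by (auto simp: primrec_in_def)

lemma tracksD:
  assumes "tracks orc g f"
  shows "regc orc k F \<Longrightarrow> regc orc k (\<lambda>xs. g (F xs))" and "g (encode x) = encode (f x)"
  using assms regc_comp[of orc "\<lambda>xs. g (xs ! 0)" k F] by (simp_all add: tracks_def)

lemma primrec_in_mono: "primrec_in Map.empty f \<Longrightarrow> primrec_in orc f"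
  unfolding primrec_in_def tracks_def using regc_mono[of Map.empty _ _ orc] by auto

abbreviation primrec0 :: "('a::encodable \<Rightarrow> 'b::encodable) \<Rightarrow> bool" where
  "primrec0 \<equiv> primrec_in Map.empty"

named_theorems pr "closure rules for primitive recursive functions"

lemma regc_arg: "regc orc 1 (\<lambda>xs. xs ! 0)"
  by (rule regc_nth) simp

lemma primrec_id [pr]: "primrec_in orc (\<lambda>x. x)"
  by (rule primrec_inI[where g = "\<lambda>x. x"]) (auto intro: regc_nth)

lemma primrec_const [pr]: "primrec_in orc (\<lambda>x. c)"
  by (rule primrec_inI[where g = "\<lambda>x. encode c"]) (auto intro: regc_const)

lemma primrec_comp:
  assumes "primrec_in orc f" "primrec_in orc h"
  shows "primrec_in orc (\<lambda>x. f (h x))"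
proof -
  obtain f' where f': "tracks orc f' (\<lambda>x. f x)"
    using assms(1) by (rule primrec_inE)
  note f = tracksD[OF f']
  obtain h' where h': "tracks orc h' (\<lambda>x. h x)"
    using assms(2) by (rule primrec_inE)
  note h = tracksD[OF h']
  show ?thesis
    by (rule primrec_inI[where g = "\<lambda>x. f' (h' x)"]) (intro f(1) h(1) regc_arg, simp add: f(2) h(2))
qed

lemma primrec_encode [pr]: "primrec_in orc f \<Longrightarrow> primrec_in orc (\<lambda>x. encode (f x))"
  unfolding primrec_in_def tracks_def by (simp add: encode_nat_def)

lemma primrec_lift1:
  assumes op: "\<And>F. regc orc 1 F \<Longrightarrow> regc orc 1 (\<lambda>xs. g (F xs))"
    and "\<And>a. g (encode a) = encode (h a)" "primrec_in orc f"
  shows "primrec_in orc (\<lambda>x. h (f x))"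
proof -
  obtain f' where f': "tracks orc f' (\<lambda>x. f x)"
    using assms(3) by (rule primrec_inE)
  note f = tracksD[OF f']
  show ?thesis
    by (rule primrec_inI[where g = "\<lambda>x. g (f' x)"]) (rule op[OF f(1)[OF regc_arg]], simp add: f(2) assms(2))
qed

lemma primrec_lift2:
  assumes op: "\<And>F G. regc orc 1 F \<Longrightarrow> regc orc 1 G \<Longrightarrow> regc orc 1 (\<lambda>xs. g (F xs) (G xs))"
    and "\<And>a b. g (encode a) (encode b) = encode (h a b)" "primrec_in orc f1" "primrec_in orc f2"
  shows "primrec_in orc (\<lambda>x. h (f1 x) (f2 x))"
proof -
  obtain f' where f': "tracks orc f' (\<lambda>x. f1 x)"
    using assms(3) by (rule primrec_inE)
  note f = tracksD[OF f']
  obtain f'' where f'': "tracks orc f'' (\<lambda>x. f2 x)"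
    using assms(4) by (rule primrec_inE)
  note f2 = tracksD[OF f'']
  show ?thesis
    by (rule primrec_inI[where g = "\<lambda>x. g (f' x) (f'' x)"]) (rule op[OF f(1)[OF regc_arg] f2(1)[OF regc_arg]], simp add: f(2) f2(2) assms(2))
qed

lemma primrec_Suc [pr]: "primrec_in orc f \<Longrightarrow> primrec_in orc (\<lambda>x. Suc (f x))"
  by (rule primrec_lift1[where g = Suc]) (auto intro: regc_Suc simp: encode_nat_def)

lemma primrec_add [pr]: "primrec_in orc f \<Longrightarrow> primrec_in orc g \<Longrightarrow> primrec_in orc (\<lambda>x. f x + g x :: nat)"
  by (rule primrec_lift2[where g = "(+)"]) (auto intro: regc_add simp: encode_nat_def)

lemma primrec_diff [pr]: "primrec_in orc f \<Longrightarrow> primrec_in orc g \<Longrightarrow> primrec_in orc (\<lambda>x. f x - g x :: nat)"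
  by (rule primrec_lift2[where g = "(-)"]) (auto intro: regc_diff simp: encode_nat_def)

lemma primrec_mult [pr]: "primrec_in orc f \<Longrightarrow> primrec_in orc g \<Longrightarrow> primrec_in orc (\<lambda>x. f x * g x :: nat)"
  by (rule primrec_lift2[where g = "\<lambda>a b. a * b"]) (auto intro: regc_mult simp: encode_nat_def)

lemma primrec_Pair [pr]: "primrec_in orc f \<Longrightarrow> primrec_in orc g \<Longrightarrow> primrec_in orc (\<lambda>x. (f x, g x))"
  by (rule primrec_lift2[where g = "\<lambda>a b. prod_encode (a, b)"]) (auto intro: regc_prod_encode simp: encode_prod_def)

lemma primrec_fst [pr]: "primrec_in orc f \<Longrightarrow> primrec_in orc (\<lambda>x. fst (f x))"
  by (rule primrec_lift1[where g = "\<lambda>n. fst (prod_decode n)"]) (auto intro: regc_pair_fst simp: encode_prod_def)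

lemma primrec_snd [pr]: "primrec_in orc f \<Longrightarrow> primrec_in orc (\<lambda>x. snd (f x))"
  by (rule primrec_lift1[where g = "\<lambda>n. snd (prod_decode n)"]) (auto intro: regc_pair_snd simp: encode_prod_def)

instantiation bool :: encodable
begin
definition encode_bool :: "bool \<Rightarrow> nat" where "encode_bool b = of_bool b"
instance by standard (auto simp: encode_bool_def inj_on_def)
end

lemma primrec_if [pr]:
  assumes "primrec_in orc b" "primrec_in orc f" "primrec_in orc g"
  shows "primrec_in orc (\<lambda>x. if b x then f x else g x)"
proof -
  obtain b' where b': "tracks orc b' (\<lambda>x. b x)"
    using assms(1) by (rule primrec_inE)
  note b = tracksD[OF b']
  obtain f' where f': "tracks orc f' (\<lambda>x. f x)"
    using assms(2) by (rule primrec_inE)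
  note f = tracksD[OF f']
  obtain g' where g': "tracks orc g' (\<lambda>x. g x)"
    using assms(3) by (rule primrec_inE)
  note g = tracksD[OF g']
  show ?thesis
    by (rule primrec_inI[where g = "\<lambda>x. if b' x = 0 then g' x else f' x"])
       (auto intro!: regc_if0 b f g regc_nth simp: b(2) f(2) g(2) encode_bool_def)
qed

lemma primrec_eq [pr]:
  fixes f g :: "'a::encodable \<Rightarrow> 'b::encodable"
  assumes "primrec_in orc f" "primrec_in orc g"
  shows "primrec_in orc (\<lambda>x. f x = g x)"
proof (rule primrec_lift2[where g = "\<lambda>a b. if (a - b) + (b - a) = 0 then 1 else 0" and h = "(=)"])
  show "(if (encode a - encode b) + (encode b - encode a) = 0 then 1 else 0) = encode (a = b)" for a b :: 'b
  proof -
    have "(encode a - encode b) + (encode b - encode a) = 0 \<longleftrightarrow> encode a = encode b" by auto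
    also have "\<dots> \<longleftrightarrow> a = b" by (rule inj_eq[OF inj_encode])
    finally show ?thesis by (simp only: encode_bool_def) simp
  qed
  show "regc orc 1 (\<lambda>xs. if (F xs - G xs) + (G xs - F xs) = 0 then 1 else 0)"
    if "regc orc 1 F" "regc orc 1 G" for F G
    using that by (intro regc_if0 regc_add regc_diff regc_const)
qed (rule assms)+

lemma primrec_le [pr]:
  assumes "primrec_in orc f" "primrec_in orc g"
  shows "primrec_in orc (\<lambda>x. f x \<le> (g x :: nat))"
proof -
  have "primrec_in orc (\<lambda>x. f x - g x = 0)" by (intro pr assms)
  then show ?thesis by simp
qed

lemma primrec_not [pr]: "primrec_in orc p \<Longrightarrow> primrec_in orc (\<lambda>x. \<not> p x)"
  using primrec_eq[of orc p "\<lambda>x. False", OF _ primrec_const] by simp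

lemma primrec_less [pr]:
  assumes "primrec_in orc f" "primrec_in orc g"
  shows "primrec_in orc (\<lambda>x. f x < (g x :: nat))"
  using primrec_not[OF primrec_le[OF assms(2,1)]] by (simp add: not_le)

lemma if_False_right: "(if b then c else False) \<longleftrightarrow> b \<and> c"
  by simp

lemma primrec_conj [pr]:
  "primrec_in orc p \<Longrightarrow> primrec_in orc q \<Longrightarrow> primrec_in orc (\<lambda>x. p x \<and> q x)"
  using primrec_if[of orc p q "\<lambda>x. False", OF _ _ primrec_const] by (simp only: if_False_right)

text \<open>
  Here the argument is a number, so that every number is the code of an argument and \<open>f\<close> can be
  used on codes as it stands.
\<close>

lemma primrec_oracle:
  fixes f :: "nat \<Rightarrow> nat"
  assumes "primrec_in orc f" "\<And>x. f x \<in> dom orc"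
  shows "primrec_in orc (\<lambda>x. the (orc (f x)))"
proof -
  obtain f' where f': "tracks orc f' (\<lambda>x. f x)"
    using assms(1) by (rule primrec_inE)
  note f = tracksD[OF f']
  have "f' = f" using f(2) by (auto simp: encode_nat_def)
  then have "regc orc 1 (\<lambda>xs. the (orc (f (xs ! 0))))"
    using assms(2) f(1)[OF regc_arg] by (intro regc_oracle) auto
  then show ?thesis
    by (rule primrec_inI[where g = "\<lambda>x. the (orc (f x))"]) (simp add: encode_nat_def)
qed

lemma primrec_rec_nat [pr]:
  assumes "primrec_in orc a" "primrec_in orc (\<lambda>p. h (fst p) (fst (snd p)) (snd (snd p)))" "primrec_in orc n"
  shows "primrec_in orc (\<lambda>x. rec_nat (a x) (\<lambda>i r. h x i r) (n x))"
proof -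
  obtain a' where a': "tracks orc a' (\<lambda>x. a x)"
    using assms(1) by (rule primrec_inE)
  note a = tracksD[OF a']
  obtain h' where h': "tracks orc h' (\<lambda>x. h (fst x) (fst (snd x)) (snd (snd x)))"
    using assms(2) by (rule primrec_inE)
  note h = tracksD[OF h']
  obtain n' where n': "tracks orc n' (\<lambda>x. n x)"
    using assms(3) by (rule primrec_inE)
  note n = tracksD[OF n']
  let ?h = "\<lambda>x i r. h' (prod_encode (x, prod_encode (i, r)))"
  have h': "?h (encode x) i (encode r) = encode (h x i r)" for x i r
    using h(2)[of "(x, i, r)"] by (simp add: encode_prod_def encode_nat_def)
  have "regc orc 1 (\<lambda>xs. rec_nat (a' (xs ! 0)) (\<lambda>i r. ?h ((i # r # xs) ! 2) ((i # r # xs) ! 0) ((i # r # xs) ! 1)) (n' (xs ! 0)))"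
    by (rule regc_rec[of orc 1 "\<lambda>xs. a' (xs ! 0)" "\<lambda>ys. ?h (ys ! 2) (ys ! 0) (ys ! 1)" "\<lambda>xs. n' (xs ! 0)"])
       (auto intro!: a h n regc_prod_encode regc_nth)
  moreover have "rec_nat (encode (a x)) (?h (encode x)) m = encode (rec_nat (a x) (h x) m)" for x m
    by (induction m) (auto simp: h')
  ultimately show ?thesis
    by (intro primrec_inI[where g = "\<lambda>x. rec_nat (a' x) (?h x) (n' x)"]) (auto simp: a(2) n(2) encode_nat_def)
qed

lemma primrec_power [pr]:
  assumes "primrec_in orc f" "primrec_in orc n"
  shows "primrec_in orc (\<lambda>x. (f x :: nat) ^ n x)"
proof -
  have "rec_nat 1 (\<lambda>i r. b * r) m = b ^ m" for b m :: nat by (induction m) auto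
  moreover have "primrec_in orc (\<lambda>x. rec_nat 1 (\<lambda>i r. f x * r) (n x))"
    by (intro pr assms primrec_comp[OF assms(1)])
  ultimately show ?thesis by simp
qed

lemma primrec_min [pr]:
  assumes "primrec_in orc f" "primrec_in orc g"
  shows "primrec_in orc (\<lambda>x. min (f x :: nat) (g x))"
  unfolding min_def by (intro pr assms)

lemma primrec_div [pr]:
  assumes "primrec_in orc f" "primrec_in orc g"
  shows "primrec_in orc (\<lambda>x. (f x :: nat) div g x)"
proof -
  have *: "rec_nat 0 (\<lambda>i r. if Suc i * b \<le> a then Suc r else r) n = min n (a div b)" if "b > 0" for a b n :: nat
  proof (induction n)
    case (Suc n)
    have "Suc n * b \<le> a \<longleftrightarrow> Suc n \<le> a div b" using that by (simp add: less_eq_div_iff_mult_less_eq)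
    then show ?case using Suc by (auto simp: min_def)
  qed simp
  have "a div b = (if b = 0 then 0 else rec_nat 0 (\<lambda>i r. if Suc i * b \<le> a then Suc r else r) a)" for a b :: nat
    using *[of b a a] by (cases "b = 0") (simp_all add: min_absorb2)
  moreover have "primrec_in orc (\<lambda>x. if g x = 0 then 0 else rec_nat 0 (\<lambda>i r. if Suc i * g x \<le> f x then Suc r else r) (f x))"
    by (intro pr assms primrec_comp[OF assms(1)] primrec_comp[OF assms(2)])
  ultimately show ?thesis by simp
qed

lemma primrec_all_less [pr]:
  assumes "primrec_in orc (\<lambda>p. P (fst p) (snd p))" "primrec_in orc n"
  shows "primrec_in orc (\<lambda>x. \<forall>i<n x. P x (i :: nat))"
proof -
  have "rec_nat True (\<lambda>i r. r \<and> Q i) m \<longleftrightarrow> (\<forall>i<m. Q i)" for Q m by (induction m) (auto simp: less_Suc_eq)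
  moreover have "primrec_in orc (\<lambda>p. P (fst p) (fst (snd p)))"
    using primrec_comp[OF assms(1), of "\<lambda>p. (fst p, fst (snd p))"] by (simp add: pr)
  then have "primrec_in orc (\<lambda>x. rec_nat True (\<lambda>i r. r \<and> P x i) (n x))"
    by (intro pr assms)
  ultimately show ?thesis by simp
qed

lemma primrec_ex_less [pr]:
  assumes "primrec_in orc (\<lambda>p. P (fst p) (snd p))" "primrec_in orc n"
  shows "primrec_in orc (\<lambda>x. \<exists>i<n x. P x (i :: nat))"
proof -
  have "primrec_in orc (\<lambda>x. \<not> (\<forall>i<n x. \<not> P x i))" by (intro pr assms)
  then show ?thesis by simp
qed

lemma encode_Nil: "encode [] = 0"
  by (simp add: encode_list_def)

lemma encode_Cons: "encode (x # xs) = Suc (prod_encode (encode x, encode xs))"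
  by (simp add: encode_list_def)

lemma encode_nat_list: "encode (xs :: nat list) = list_encode xs"
  by (simp add: encode_list_def encode_nat_def[abs_def])

lemma encode_map_encode: "encode (map encode xs) = encode xs"
  by (simp add: encode_nat_list) (simp add: encode_list_def)

lemma length_le_encode: "length xs \<le> encode xs"
proof (induction xs)
  case (Cons x xs)
  then show ?case using le_prod_encode_2[of "encode xs" "encode x"] by (simp add: encode_Cons)
qed simp

lemma primrec_Cons [pr]:
  assumes "primrec_in orc f" "primrec_in orc g"
  shows "primrec_in orc (\<lambda>x. f x # g x)"
  by (rule primrec_lift2[where g = "\<lambda>a b. Suc (prod_encode (a, b))"])
     (auto intro: regc_prod_encode regc_Suc assms simp: encode_Cons)

lemma primrec_case_list [pr]:
  assumes "primrec_in orc xs" "primrec_in orc a"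
    "primrec_in orc (\<lambda>p. h (fst p) (fst (snd p)) (snd (snd p)))"
  shows "primrec_in orc (\<lambda>x. case xs x of [] \<Rightarrow> a x | e # r \<Rightarrow> h x e r)"
proof -
  obtain l where l': "tracks orc l xs" using assms(1) by (rule primrec_inE)
  obtain a' where a': "tracks orc a' a" using assms(2) by (rule primrec_inE)
  obtain h' where h': "tracks orc h' (\<lambda>p. h (fst p) (fst (snd p)) (snd (snd p)))" using assms(3) by (rule primrec_inE)
  note l = tracksD[OF l'] and a = tracksD[OF a'] and h = tracksD[OF h']
  show ?thesis
  proof (rule primrec_inI[where g = "\<lambda>x. if l x = 0 then a' x else h' (prod_encode (x, l x - 1))"])
    show "regc orc 1 (\<lambda>ys. if l (ys ! 0) = 0 then a' (ys ! 0) else h' (prod_encode (ys ! 0, l (ys ! 0) - 1)))"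
      by (intro regc_if0 l(1) a(1) h(1) regc_prod_encode regc_pred regc_arg)
    fix x
    show "(if l (encode x) = 0 then a' (encode x) else h' (prod_encode (encode x, l (encode x) - 1))) =
       encode (case xs x of [] \<Rightarrow> a x | e # r \<Rightarrow> h x e r)"
      using h(2)[of "(x, hd (xs x), tl (xs x))"]
      by (cases "xs x") (auto simp: l(2) a(2) encode_Nil encode_Cons encode_prod_def)
  qed
qed

text \<open>
  Recursion over a list: a pair of the remaining list and the accumulator is updated as often as the
  code of the list says.  This is often enough, since a code is at least the length of its list, and
  further rounds change nothing.
\<close>

lemma primrec_foldl [pr]:
  assumes "primrec_in orc (\<lambda>p. h (fst p) (fst (snd p)) (snd (snd p)))" "primrec_in orc a" "primrec_in orc xs"
  shows "primrec_in orc (\<lambda>x. foldl (\<lambda>acc e. h x acc e) (a x) (xs x))"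
proof -
  define it where "it x i q = (case fst q of [] \<Rightarrow> q | e # r \<Rightarrow> (r, h x (snd q) e))" for x q and i :: nat
  have stop: "rec_nat ([], b) (it x) n = ([], b)" for b x n
    by (induction n) (auto simp: it_def)
  have shift: "rec_nat q (it x) (Suc n) = rec_nat (it x 0 q) (it x) n" for q x n
    by (induction n) (auto simp: it_def)
  have run: "length l \<le> n \<Longrightarrow> snd (rec_nat (l, b) (it x) n) = foldl (\<lambda>acc e. h x acc e) b l" for l b x n
  proof (induction l arbitrary: b n)
    case Nil
    then show ?case by (simp add: stop)
  next
    case (Cons e l)
    then obtain m where n: "n = Suc m" and m: "length l \<le> m" by (cases n) auto
    have "it x 0 (e # l, b) = (l, h x b e)" by (simp add: it_def)
    then show ?case unfolding n shift by (simp add: Cons.IH[OF m])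
  qed
  have h: "primrec_in orc (\<lambda>p. h (fst (fst p)) (snd (snd (snd (fst p)))) (fst (snd p)))"
    using primrec_comp[OF assms(1), of "\<lambda>p. (fst (fst p), snd (snd (snd (fst p))), fst (snd p))"] by (simp add: pr)
  have "primrec_in orc (\<lambda>x. snd (rec_nat (xs x, a x) (\<lambda>i q. it x i q) (encode (xs x))))"
    unfolding it_def by (intro pr assms h)
  then show ?thesis using run[OF length_le_encode] by simp
qed

lemma primrec_length [pr]:
  assumes "primrec_in orc xs" shows "primrec_in orc (\<lambda>x. length (xs x))"
proof -
  have "foldl (\<lambda>n e. Suc n) m l = m + length l" for m and l :: "'b list" by (induction l arbitrary: m) auto
  moreover have "primrec_in orc (\<lambda>x. foldl (\<lambda>n e. Suc n) 0 (xs x))" by (intro pr assms)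
  ultimately show ?thesis by simp
qed

lemma primrec_rev [pr]:
  assumes "primrec_in orc xs" shows "primrec_in orc (\<lambda>x. rev (xs x))"
proof -
  have "foldl (\<lambda>r e. e # r) m l = rev l @ m" for m and l :: "'b list" by (induction l arbitrary: m) auto
  moreover have "primrec_in orc (\<lambda>x. foldl (\<lambda>r e. e # r) [] (xs x))" by (intro pr assms)
  ultimately show ?thesis by simp
qed

lemma primrec_append [pr]:
  assumes "primrec_in orc xs" "primrec_in orc ys" shows "primrec_in orc (\<lambda>x. xs x @ ys x)"
proof -
  have "foldl (\<lambda>r e. e # r) m l = rev l @ m" for m and l :: "'b list" by (induction l arbitrary: m) auto
  moreover have "primrec_in orc (\<lambda>x. foldl (\<lambda>r e. e # r) (ys x) (rev (xs x)))" by (intro pr assms)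
  ultimately show ?thesis by simp
qed

lemma primrec_map [pr]:
  assumes "primrec_in orc (\<lambda>p. f (fst p) (snd p))" "primrec_in orc xs"
  shows "primrec_in orc (\<lambda>x. map (\<lambda>e. f x e) (xs x))"
proof -
  have f: "primrec_in orc (\<lambda>p. f (fst p) (snd (snd p)))"
    using primrec_comp[OF assms(1), of "\<lambda>p. (fst p, snd (snd p))"] by (simp add: pr)
  have "foldl (\<lambda>r e. g e # r) m l = rev (map g l) @ m" for g :: "'b \<Rightarrow> 'c" and m l by (induction l arbitrary: m) auto
  moreover have "primrec_in orc (\<lambda>x. rev (foldl (\<lambda>r e. f x e # r) [] (xs x)))" by (intro pr assms f)
  ultimately show ?thesis by simp
qed

lemma primrec_filter [pr]:
  assumes "primrec_in orc (\<lambda>p. f (fst p) (snd p))" "primrec_in orc xs"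
  shows "primrec_in orc (\<lambda>x. filter (\<lambda>e. f x e) (xs x))"
proof -
  have f: "primrec_in orc (\<lambda>p. f (fst p) (snd (snd p)))"
    using primrec_comp[OF assms(1), of "\<lambda>p. (fst p, snd (snd p))"] by (simp add: pr)
  have "foldl (\<lambda>r e. if g e then e # r else r) m l = rev (filter g l) @ m" for g :: "'b \<Rightarrow> bool" and m l by (induction l arbitrary: m) auto
  moreover have "primrec_in orc (\<lambda>x. rev (foldl (\<lambda>r e. if f x e then e # r else r) [] (xs x)))" by (intro pr assms f)
  ultimately show ?thesis by simp
qed

lemma primrec_ball_set [pr]:
  assumes "primrec_in orc (\<lambda>p. f (fst p) (snd p))" "primrec_in orc xs"
  shows "primrec_in orc (\<lambda>x. \<forall>e\<in>set (xs x). f x e)"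
proof -
  have f: "primrec_in orc (\<lambda>p. f (fst p) (snd (snd p)))"
    using primrec_comp[OF assms(1), of "\<lambda>p. (fst p, snd (snd p))"] by (simp add: pr)
  have "foldl (\<lambda>r e. r \<and> g e) m l \<longleftrightarrow> m \<and>
      (\<forall>e\<in>set l. g e)" for g :: "'b \<Rightarrow> bool" and m l by (induction l arbitrary: m) auto
  moreover have "primrec_in orc (\<lambda>x. foldl (\<lambda>r e. r \<and> f x e) True (xs x))" by (intro pr assms f)
  ultimately show ?thesis by simp
qed

lemma primrec_bex_set [pr]:
  assumes "primrec_in orc (\<lambda>p. f (fst p) (snd p))" "primrec_in orc xs"
  shows "primrec_in orc (\<lambda>x. \<exists>e\<in>set (xs x). f x e)"
proof -
  have "primrec_in orc (\<lambda>x. \<not> (\<forall>e\<in>set (xs x). \<not> f x e))" by (intro pr assms)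
  then show ?thesis by simp
qed

lemma primrec_upt [pr]:
  assumes "primrec_in orc n"
  shows "primrec_in orc (\<lambda>x. [0..<n x])"
proof -
  have "rec_nat [] (\<lambda>i r. r @ [i]) m = [0..<m]" for m by (induction m) auto
  moreover have "primrec_in orc (\<lambda>x. rec_nat [] (\<lambda>i r. r @ [i]) (n x))" by (intro pr assms)
  ultimately show ?thesis by simp
qed

lemma primrec_tl [pr]:
  assumes "primrec_in orc xs" shows "primrec_in orc (\<lambda>x. tl (xs x))"
proof -
  have "primrec_in orc (\<lambda>x. case xs x of [] \<Rightarrow> [] | e # r \<Rightarrow> r)" by (intro pr assms)
  then show ?thesis by (simp add: tl_def)
qed

lemma primrec_drop [pr]:
  assumes "primrec_in orc xs" "primrec_in orc n" shows "primrec_in orc (\<lambda>x. drop (n x) (xs x))"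
proof -
  have "rec_nat l (\<lambda>i r. tl r) m = drop m l" for m and l :: "'b list"
    by (induction m) (auto simp: drop_Suc tl_drop)
  moreover have "primrec_in orc (\<lambda>x. rec_nat (xs x) (\<lambda>i r. tl r) (n x))" by (intro pr assms)
  ultimately show ?thesis by simp
qed

lemma primrec_take [pr]:
  assumes "primrec_in orc xs" "primrec_in orc n" shows "primrec_in orc (\<lambda>x. take (n x) (xs x))"
proof -
  have "primrec_in orc (\<lambda>x. rev (drop (length (xs x) - n x) (rev (xs x))))" by (intro pr assms)
  moreover have "rev (drop (length l - m) (rev l)) = take m l" for l :: "'b list" and m
    by (cases "m \<le> length l") (simp_all add: rev_drop)
  ultimately show ?thesis by simp
qed

text \<open>
  Unlike \<open>(!)\<close>, this has a known value outside of the range, and is thus computable.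
\<close>

definition nth_or :: "'a \<Rightarrow> 'a list \<Rightarrow> nat \<Rightarrow> 'a" where
  "nth_or d xs i = (case drop i xs of [] \<Rightarrow> d | e # r \<Rightarrow> e)"

lemma nth_or_nth: "i < length xs \<Longrightarrow> nth_or d xs i = xs ! i"
  by (simp add: nth_or_def Cons_nth_drop_Suc[symmetric])

lemma primrec_nth_or [pr]:
  assumes "primrec_in orc d" "primrec_in orc xs" "primrec_in orc i"
  shows "primrec_in orc (\<lambda>x. nth_or (d x) (xs x) (i x))"
  unfolding nth_or_def by (intro pr assms)

section \<open>Sets enumerable relative to an oracle\<close>

lemma primrec_list_decode [pr]: "primrec_in orc f \<Longrightarrow> primrec_in orc (\<lambda>x. list_decode (f x))"
  by (rule primrec_lift1[where g = "\<lambda>x. x"]) (simp_all add: encode_nat_list encode_nat_def)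

lemma primrec_prod_decode [pr]: "primrec_in orc f \<Longrightarrow> primrec_in orc (\<lambda>x. prod_decode (f x))"
  by (rule primrec_lift1[where g = "\<lambda>x. x"]) (simp_all add: encode_prod_def encode_nat_def)

lemma primrec_codes [pr]: "primrec_in orc f \<Longrightarrow> primrec_in orc (\<lambda>x. map encode (f x))"
  unfolding primrec_in_def tracks_def by (simp add: encode_map_encode)

text \<open>
  The normal form of the sets that are recursively enumerable in \<open>orc\<close>.
\<close>

definition re_in :: "(nat \<rightharpoonup> nat) \<Rightarrow> ('a::encodable \<Rightarrow> bool) \<Rightarrow> bool" where
  "re_in orc R \<longleftrightarrow> (\<exists>f :: 'a \<times> nat \<Rightarrow> bool. primrec_in orc f \<and>
      (\<forall>x. R x \<longleftrightarrow> (\<exists>w::nat. f (x, w))))"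

lemma re_inI: "primrec_in orc f \<Longrightarrow> (\<And>x. R x \<longleftrightarrow> (\<exists>w::nat. f (x, w))) \<Longrightarrow> re_in orc R"
  unfolding re_in_def by (rule exI[of _ f]) simp

lemma re_in_mono: "re_in Map.empty R \<Longrightarrow> re_in orc R"
  unfolding re_in_def using primrec_in_mono by blast

abbreviation re0 :: "('a::encodable \<Rightarrow> bool) \<Rightarrow> bool" where
  "re0 \<equiv> re_in Map.empty"

named_theorems re "closure rules for enumerable sets"

lemma re_primrec: "primrec_in orc R \<Longrightarrow> re_in orc R"
  by (rule re_inI[where f = "\<lambda>p. R (fst p)"], rule primrec_comp[of orc R fst], assumption) (auto intro!: pr)

lemma re_comp:
  assumes "re_in orc R" "primrec_in orc h"
  shows "re_in orc (\<lambda>x. R (h x))"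
proof -
  obtain f where f: "primrec_in orc f" "\<And>x. R x \<longleftrightarrow> (\<exists>w::nat. f (x, w))" using assms(1) unfolding re_in_def by blast
  have "primrec_in orc (\<lambda>p. f (h (fst p), snd p))"
    by (rule primrec_comp[OF f(1)]) (intro pr primrec_comp[OF assms(2)])
  then show ?thesis by (rule re_inI) (simp add: f(2))
qed

lemma re_ex_nat [re]:
  assumes "re_in orc (\<lambda>p. R (fst p) (snd p))"
  shows "re_in orc (\<lambda>x. \<exists>n::nat. R x n)"
proof -
  obtain f where f: "primrec_in orc f" "\<And>x. R (fst x) (snd x) \<longleftrightarrow> (\<exists>w::nat. f (x, w))" using assms unfolding re_in_def by blast
  have "primrec_in orc (\<lambda>p. f ((fst p, fst (prod_decode (snd p))), snd (prod_decode (snd p))))"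
    by (rule primrec_comp[OF f(1)]) (intro pr)
  then show ?thesis
  proof (rule re_inI)
    fix x
    have "(\<exists>n. R x n) \<longleftrightarrow> (\<exists>n w. f ((x, n), w))" using f(2)[of "(x, _)"] by simp
    also have "\<dots> \<longleftrightarrow> (\<exists>w. f ((x, fst (prod_decode w)), snd (prod_decode w)))"
      by (metis fst_conv snd_conv prod_encode_inverse)
    finally show "(\<exists>n. R x n) \<longleftrightarrow> (\<exists>w. f ((fst (x, w), fst (prod_decode (snd (x, w)))), snd (prod_decode (snd (x, w)))))"
      by simp
  qed
qed

text \<open>
  A witness \<open>y\<close> is searched through its code.  This requires that every number is the code of some
  \<open>y\<close>, as it is for numbers and for lists of numbers.
\<close>

lemma re_ex_surj:
  fixes R :: "'a::encodable \<Rightarrow> 'b::encodable \<Rightarrow> bool"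
  assumes "surj (encode :: 'b \<Rightarrow> nat)" "re_in orc (\<lambda>p. R (fst p) (snd p))"
  shows "re_in orc (\<lambda>x. \<exists>y. R x y)"
proof -
  define dec where "dec = (inv encode :: nat \<Rightarrow> 'b)"
  have enc: "encode (dec n) = n" for n unfolding dec_def by (rule surj_f_inv_f[OF assms(1)])
  have d: "primrec_in orc f \<Longrightarrow> primrec_in orc (\<lambda>x. dec (f x))" for f :: "'a \<times> nat \<Rightarrow> nat"
    by (rule primrec_lift1[where g = "\<lambda>x. x"]) (simp_all add: enc encode_nat_def)
  have "re_in orc (\<lambda>p. R (fst p) (dec (snd p)))"
    using re_comp[OF assms(2), of "\<lambda>p. (fst p, dec (snd p))"] by (simp add: pr d)
  then have "re_in orc (\<lambda>x. \<exists>n. R x (dec n))" by (rule re_ex_nat)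
  moreover have "(\<exists>n. R x (dec n)) \<longleftrightarrow> (\<exists>y. R x y)" for x
    by (metis enc inj_encode injD)
  ultimately show ?thesis by simp
qed

lemma surj_encode_nat: "surj (encode :: nat \<Rightarrow> nat)"
  by (auto simp: encode_nat_def surj_def)

lemma surj_encode_list: "surj (encode :: 'a::encodable \<Rightarrow> nat) \<Longrightarrow> surj (encode :: 'a list \<Rightarrow> nat)"
proof -
  assume s: "surj (encode :: 'a \<Rightarrow> nat)"
  have "encode (map (inv encode) (list_decode n) :: 'a list) = n" for n
    by (simp add: encode_list_def comp_def surj_f_inv_f[OF s])
  then show ?thesis by (rule surjI)
qed

lemma re_conj [re]:
  assumes "re_in orc R" "re_in orc S"
  shows "re_in orc (\<lambda>x. R x \<and> S x)"
proof -
  obtain f where f: "primrec_in orc f" "\<And>x. R x \<longleftrightarrow> (\<exists>w::nat. f (x, w))" using assms(1) unfolding re_in_def by blast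
  obtain g where g: "primrec_in orc g" "\<And>x. S x \<longleftrightarrow> (\<exists>w::nat. g (x, w))" using assms(2) unfolding re_in_def by blast
  have "re_in orc (\<lambda>p. f (fst (fst p), snd (fst p)) \<and> g (fst (fst p), snd p))"
    by (intro re_primrec pr primrec_comp[OF f(1)] primrec_comp[OF g(1)])
  from re_ex_nat[OF re_ex_nat[of orc "\<lambda>p n. f (fst p, snd p) \<and> g (fst p, n)", OF this]]
  show ?thesis by (simp add: f(2) g(2) re_ex_nat)
qed

lemma re_ex_less [re]:
  assumes "re_in orc (\<lambda>p. R (fst p) (snd p))" "primrec_in orc n"
  shows "re_in orc (\<lambda>x. \<exists>i<n x. R x (i :: nat))"
  by (intro re assms re_primrec pr primrec_comp[OF assms(2)])

text \<open>
  Finitely many witnesses have a common bound, and a bounded search for each of them is primitive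
  recursive.
\<close>

lemma re_ball_set [re]:
  assumes "re_in orc (\<lambda>p. R (fst p) (snd p))" "primrec_in orc xs"
  shows "re_in orc (\<lambda>x. \<forall>e\<in>set (xs x). R x e)"
proof -
  obtain f where f: "primrec_in orc f" "\<And>x. R (fst x) (snd x) \<longleftrightarrow> (\<exists>w::nat. f (x, w))" using assms(1) unfolding re_in_def by blast
  have "primrec_in orc (\<lambda>p. \<forall>e\<in>set (xs (fst p)). \<exists>w<snd p. f ((fst p, e), w))"
    by (intro pr primrec_comp[OF f(1)] primrec_comp[OF assms(2)])
  then show ?thesis
  proof (rule re_inI)
    fix x
    have "(\<forall>e\<in>set l. \<exists>w. f ((x, e), w)) \<longleftrightarrow> (\<exists>B. \<forall>e\<in>set l. \<exists>w<B. f ((x, e), w))" for l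
    proof (induction l)
      case (Cons a l)
      show ?case
      proof
        assume a: "\<forall>e\<in>set (a # l). \<exists>w. f ((x, e), w)"
        then obtain B where B: "\<forall>e\<in>set l. \<exists>w<B. f ((x, e), w)" using Cons by auto
        obtain w where w: "f ((x, a), w)" using a by auto
        have "\<forall>e\<in>set (a # l). \<exists>w'<B + Suc w. f ((x, e), w')"
        proof
          fix e assume "e \<in> set (a # l)"
          then consider "e \<in> set l" | "e = a" by auto
          then show "\<exists>w'<B + Suc w. f ((x, e), w')"
          proof cases
            case 1
            then obtain v where "v < B" "f ((x, e), v)" using B by blast
            then show ?thesis by (intro exI[of _ v]) simp
          next
            case 2
            then show ?thesis using w by (intro exI[of _ w]) simp
          qed
        qed
        then show "\<exists>B. \<forall>e\<in>set (a # l). \<exists>w<B. f ((x, e), w)" by blast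
      qed blast
    qed simp
    then show "(\<forall>e\<in>set (xs x). R x e) \<longleftrightarrow> (\<exists>w. \<forall>e\<in>set (xs (fst (x,
        w))). \<exists>w'<snd (x, w). f ((fst (x, w), e), w'))"
      using f(2)[of "(x, _)"] by simp
  qed
qed

theorem re_in_machine:
  fixes R :: "nat \<Rightarrow> bool"
  assumes "re_in orc R"
  shows "\<exists>M. oracle_TM M \<and> (\<forall>x. accepts orc M x \<longleftrightarrow> R x)"
proof -
  obtain f where f: "primrec_in orc f" "\<And>x. R x \<longleftrightarrow> (\<exists>w::nat. f (x, w))" using assms unfolding re_in_def by blast
  obtain g where g: "tracks orc g f" using f(1) by (rule primrec_inE)
  have "regc orc 2 (\<lambda>xs. 1 - g (prod_encode (xs ! 0, xs ! 1)))"
    by (intro regc_diff regc_const tracksD(1)[OF g] regc_prod_encode regc_nth) auto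
  from search_machine[OF this] obtain M where
    M: "oracle_TM M" "\<And>x. accepts orc M x \<longleftrightarrow> (\<exists>w. 1 - g (prod_encode (x, w)) = 0)" by auto
  have "1 - g (prod_encode (x, w)) = 0 \<longleftrightarrow> f (x, w)" for x w
    using tracksD(2)[OF g, of "(x, w)"] by (simp add: encode_prod_def encode_nat_def encode_bool_def)
  then show ?thesis using M f(2) by auto
qed

text \<open>
  The transition function of a machine is a finite table, looked up entry by entry.
\<close>

lemma primrec_table:
  assumes "finite K" "\<And>k. k \<in> K \<Longrightarrow> primrec_in orc (G k)" "primrec_in orc key" "primrec_in orc D"
  shows "primrec_in orc (\<lambda>x. if key x \<in> K then G (key x) x else D x)"
  using assms(1,2)
proof (induction K)
  case empty
  then show ?case using assms(4) by simp
next
  case (insert k K)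
  have "primrec_in orc (\<lambda>x. if key x = k then G k x else (if key x \<in> K then G (key x) x else D x))"
    by (rule primrec_if[OF primrec_eq[OF assms(3) primrec_const]]) (use insert in auto)
  moreover have "(if key x = k then G k x else (if key x \<in> K then G (key x) x else D x)) =
     (if key x \<in> insert k K then G (key x) x else D x)" for x by simp
  ultimately show ?case by simp
qed

lemma primrec_tape_read [pr]: "primrec_in orc f \<Longrightarrow> primrec_in orc (\<lambda>x. tape_read (f x))"
  unfolding tape_read_def by (intro pr)

lemma primrec_tape_act: "primrec_in orc (tape_act a)"
proof -
  obtain s m where a: "a = (s, m)" by (cases a)
  have "primrec_in orc (tape_move m)"
  proof (cases m)
    case GoLeft
    have "tape_move GoLeft = (\<lambda>t. case fst t of [] \<Rightarrow> ([], 0 # snd t) | s # l' \<Rightarrow> (l', s # snd t))"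
      by (auto simp: fun_eq_iff split: list.splits)
    then show ?thesis using GoLeft by (simp only:) (intro pr)
  next
    case GoRight
    have "tape_move GoRight = (\<lambda>t. case snd t of [] \<Rightarrow> (0 # fst t, []) | s # l' \<Rightarrow> (s # fst t, l'))"
      by (auto simp: fun_eq_iff split: list.splits)
    then show ?thesis using GoRight by (simp only:) (intro pr)
  next
    case Stay
    have "tape_move Stay = (\<lambda>t. t)" by (auto simp: fun_eq_iff)
    then show ?thesis using Stay by (simp only:) (intro pr)
  qed
  then have "primrec_in orc (\<lambda>t. tape_move m (fst t, s # tl (snd t)))"
    by (rule primrec_comp) (intro pr)
  moreover have "tape_act a = (\<lambda>t. tape_move m (fst t, s # tl (snd t)))"
    by (auto simp: a fun_eq_iff)
  ultimately show ?thesis by simp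
qed

lemma primrec_map2_tape_act: "primrec_in orc (\<lambda>ts. map2 tape_act as ts)"
proof (induction as)
  case Nil
  then show ?case by (simp add: pr)
next
  case (Cons a as)
  have "map2 tape_act (a # as) ts = (case ts of [] \<Rightarrow> [] | t # ts' \<Rightarrow> tape_act a t # map2 tape_act as ts')" for ts
    by (cases ts) auto
  moreover have "primrec_in orc (\<lambda>ts. case ts of [] \<Rightarrow> [] | t # ts' \<Rightarrow> tape_act a t # map2 tape_act as ts')"
    by (intro pr primrec_comp[OF primrec_tape_act] primrec_comp[OF Cons.IH])
  ultimately show ?case by simp
qed

lemma primrec_tape_value [pr]:
  assumes "primrec_in orc f" shows "primrec_in orc (\<lambda>x. tape_value (f x))"
proof -
  define h where "h = (\<lambda>(r :: nat \<times> bool) s. if snd r \<and> s = (1 :: nat) then (Suc (fst r), True) else (fst r, False))"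
  have 1: "foldl h (n, False) l = (n, False)" for n l by (induction l) (auto simp: h_def)
  have 2: "fst (foldl h (n, True) l) = n + length (takeWhile (\<lambda>s. s = 1) l)" for n l
  proof (induction l arbitrary: n)
    case (Cons s l)
    have "h (n, True) s = (if s = 1 then (Suc n, True) else (n, False))" by (simp add: h_def)
    then show ?case using Cons by (simp add: 1)
  qed simp
  have "primrec_in orc (\<lambda>x. fst (foldl (\<lambda>r s. if snd r \<and> s = (1 :: nat) then (Suc (fst r), True) else (fst r, False)) (0, True) (snd (f x))))"
    by (intro pr assms)
  then show ?thesis using 2[of 0] by (simp add: tape_value_def h_def)
qed

lemma primrec_unary_tape [pr]:
  assumes "primrec_in orc f" shows "primrec_in orc (\<lambda>x. unary_tape (f x))"
proof -
  have "rec_nat [] (\<lambda>i r. 1 # r) n = replicate n (1 :: nat)" for n by (induction n) auto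
  moreover have "primrec_in orc (\<lambda>x. ([] :: nat list, rec_nat [] (\<lambda>i r. (1 :: nat) # r) (f x)))" by (intro pr assms)
  ultimately show ?thesis by (simp add: unary_tape_def)
qed

lemma primrec_list_update [pr]:
  assumes "primrec_in orc xs" "primrec_in orc i" "primrec_in orc y"
  shows "primrec_in orc (\<lambda>x. (xs x)[i x := y x])"
proof -
  have "l[n := v] = (if n < length l then take n l @ v # drop (Suc n) l else l)" for l :: "'b list" and n v
    by (simp add: upd_conv_take_nth_drop list_update_beyond)
  moreover have "primrec_in orc (\<lambda>x. if i x < length (xs x) then take (i x) (xs x) @ y x # drop (Suc (i x)) (xs x) else xs x)"
    by (intro pr assms)
  ultimately show ?thesis by simp
qed

text \<open>
  A step of the machine as a total function, which stays in place where the machine halts.  It agrees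
  with \<open>step\<close> on configurations with the right number of tapes (\<open>sim_step_eq\<close>).
\<close>

definition sim_step :: "(nat \<rightharpoonup> nat) \<Rightarrow> otm \<Rightarrow> config \<Rightarrow> config" where
  "sim_step orc M c = (if fst c = accept_state M then c
     else case query_fun M (fst c) of
       Some q' \<Rightarrow> (case orc (tape_value (nth_or ([], []) (snd c) 1)) of
           None \<Rightarrow> c | Some a \<Rightarrow> (q', (snd c)[1 := unary_tape a]))
     | None \<Rightarrow> (case trans_fun M (fst c, map tape_read (snd c)) of
           None \<Rightarrow> c | Some qa \<Rightarrow> (fst qa, map2 tape_act (snd qa) (snd c))))"

definition sim :: "(nat \<rightharpoonup> nat) \<Rightarrow> otm \<Rightarrow> nat \<Rightarrow> nat \<Rightarrow> config" where
  "sim orc M x t = rec_nat (init_config M x) (\<lambda>i c. sim_step orc M c) t"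

definition proper :: "otm \<Rightarrow> config \<Rightarrow> bool" where
  "proper M c \<longleftrightarrow> length (snd c) = work_tapes M + 2"

lemma sim_step_eq: "proper M c \<Longrightarrow> sim_step orc M c = (case step orc M c of None \<Rightarrow> c | Some d \<Rightarrow> d)"
  by (cases c) (auto simp: sim_step_def step_def proper_def nth_or_nth split: option.splits)

lemma proper_step: "oracle_TM M \<Longrightarrow> proper M c \<Longrightarrow> step orc M c = Some d \<Longrightarrow> proper M d"
  by (auto simp: step_def proper_def oracle_TM_def split: prod.splits if_splits option.splits)

lemma proper_init: "proper M (init_config M x)"
  by (simp add: proper_def init_config_def)

lemma reaches_iff_sim:
  assumes "oracle_TM M"
  shows "reaches orc M (init_config M x) d \<longleftrightarrow> (\<exists>t. sim orc M x t = d)"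
proof
  assume "reaches orc M (init_config M x) d"
  then show "\<exists>t. sim orc M x t = d" unfolding reaches_def
  proof (induction rule: rtranclp_induct)
    case base
    then show ?case by (auto simp: sim_def intro: exI[of _ 0])
  next
    case (step y z)
    then obtain t where t: "sim orc M x t = y" by blast
    have "proper M (sim orc M x t)" for t
      by (induction t) (auto simp: sim_def proper_init sim_step_eq intro: proper_step[OF assms] split: option.splits)
    then have "sim orc M x (Suc t) = z"
      using step(2) t by (simp add: sim_def) (metis sim_step_eq option.simps(5) t sim_def)
    then show ?case by blast
  qed
next
  assume "\<exists>t. sim orc M x t = d"
  then obtain t where "sim orc M x t = d" by blast
  moreover have "reaches orc M (init_config M x) (sim orc M x t) \<and> proper M (sim orc M x t)"
  proof (induction t)
    case 0
    then show ?case by (simp add: sim_def reaches_def proper_init)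
  next
    case (Suc t)
    have "sim orc M x (Suc t) = sim_step orc M (sim orc M x t)" by (simp add: sim_def)
    with Suc show ?case
      by (cases "step orc M (sim orc M x t)")
         (auto simp: sim_step_eq reaches_def intro: proper_step[OF assms] rtranclp.rtrancl_into_rtrancl)
  qed
  ultimately show "reaches orc M (init_config M x) d" by blast
qed

lemma accepts_iff_sim:
  "oracle_TM M \<Longrightarrow> accepts orc M x \<longleftrightarrow> (\<exists>t. fst (sim orc M x t) = accept_state M)"
  by (auto simp: accepts_def reaches_iff_sim) (metis fst_conv, metis prod.collapse)

lemma sim_halted:
  assumes "fst (sim orc M x t) = accept_state M" "t \<le> t'"
  shows "sim orc M x t' = sim orc M x t"
  using assms(2) by (induction rule: dec_induct) (use assms(1) in \<open>auto simp: sim_def sim_step_def\<close>)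

lemma case_option_dom: "(case m k of None \<Rightarrow> d | Some v \<Rightarrow> g v) = (if k \<in> dom m then g (the (m k)) else d)"
  by (auto split: option.splits)

text \<open>
  The oracle is computed from a finite object \<open>e\<close>; the simulation itself asks no queries.
\<close>

lemma primrec_sim:
  fixes orc :: "'e::encodable \<Rightarrow> nat \<rightharpoonup> nat"
  assumes M: "oracle_TM M"
    and orc: "primrec0 (\<lambda>p. case orc (fst p) (snd p) of None \<Rightarrow> 0 | Some a \<Rightarrow> Suc a)"
    and "primrec0 e" "primrec0 x" "primrec0 t"
  shows "primrec0 (\<lambda>p. sim (orc (e p)) M (x p) (t p))"
proof -
  define ans where "ans p = (case orc (fst p) (snd p) of None \<Rightarrow> 0 | Some a \<Rightarrow> Suc a)" for p
  have ans: "primrec0 ans" using orc by (simp add: ans_def[abs_def])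
  have case_ans: "(case orc e k of None \<Rightarrow> d | Some a \<Rightarrow> g a) = (if ans (e, k) = 0 then d else g (ans (e, k) - 1))"
    for e k and d :: config and g by (auto simp: ans_def split: option.splits)
  have K: "finite (dom (query_fun M))" "finite (dom (trans_fun M))" using M by (auto simp: oracle_TM_def)
  have q: "primrec0 (\<lambda>p :: 'e \<times> config.
     if ans (fst p, tape_value (nth_or ([], []) (snd (snd p)) 1)) = 0 then snd p
     else (the (query_fun M k), (snd (snd p))[1 := unary_tape (ans (fst p, tape_value (nth_or ([], []) (snd (snd p)) 1)) - 1)]))" for k
    by (intro pr primrec_comp[OF ans])
  have tr: "primrec0 (\<lambda>p :: 'e \<times> config.
     (fst (the (trans_fun M k)), map2 tape_act (snd (the (trans_fun M k))) (snd (snd p))))" for k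
    by (intro pr primrec_comp[OF primrec_map2_tape_act])
  have id: "primrec0 (\<lambda>p :: 'e \<times> config. snd p)"
    and key1: "primrec0 (\<lambda>p :: 'e \<times> config. fst (snd p))"
    and key2: "primrec0 (\<lambda>p :: 'e \<times> config. (fst (snd p), map tape_read (snd (snd p))))"
    by (intro pr)+
  note table = primrec_table[OF K(1) q key1 primrec_table[OF K(2) tr key2 id]]
  have "primrec0 (\<lambda>p :: 'e \<times> config. fst (snd p) = accept_state M)" by (intro pr)
  from primrec_if[OF this id table]
  have st: "primrec0 (\<lambda>p :: 'e \<times> config. sim_step (orc (fst p)) M (snd p))"
    unfolding sim_step_def case_ans by (simp only: case_option_dom)
  have ini: "primrec0 (\<lambda>p. init_config M (x p))"
    unfolding init_config_def by (intro pr assms)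
  show ?thesis unfolding sim_def
    by (intro pr assms ini primrec_comp[OF st, of "\<lambda>p. (e (fst p), snd (snd p))", simplified] primrec_comp[OF assms(3)])
qed

theorem re_accepts:
  fixes orc :: "'e::encodable \<Rightarrow> nat \<rightharpoonup> nat"
  assumes M: "oracle_TM M"
    and orc: "primrec0 (\<lambda>p. case orc (fst p) (snd p) of None \<Rightarrow> 0 | Some a \<Rightarrow> Suc a)"
  shows "re0 (\<lambda>p. accepts (orc (fst p)) M (snd p))"
proof -
  have "primrec0 (\<lambda>p. fst (sim (orc (fst (fst p))) M (snd (fst p)) (snd p)) = accept_state M)"
    by (intro pr primrec_sim[OF assms])
  then show ?thesis by (rule re_inI) (simp add: accepts_iff_sim[OF M])
qed

lemma rec_enum_iff: "rec_enum S \<longleftrightarrow> re0 (\<lambda>n. n \<in> encode ` S)"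
proof
  assume "rec_enum S"
  then obtain M where M: "oracle_TM M" "encode ` S = {x. accepts Map.empty M x}" by (auto simp: rec_enum_def)
  have "re0 (\<lambda>p :: nat \<times> nat. accepts ((\<lambda>_. Map.empty) (fst p)) M (snd p))"
    by (rule re_accepts[OF M(1)]) (simp add: pr)
  from re_comp[OF this, of "\<lambda>n. (0, n)"] show "re0 (\<lambda>n. n \<in> encode ` S)"
    using M(2) by (simp add: pr)
next
  assume "re0 (\<lambda>n. n \<in> encode ` S)"
  from re_in_machine[OF this] show "rec_enum S" by (auto simp: rec_enum_def)
qed

lemma rec_enum_re:
  fixes S :: "'a::encodable set"
  shows "rec_enum S \<Longrightarrow> re0 (\<lambda>x. x \<in> S)"
  using re_comp[of Map.empty "\<lambda>n. n \<in> encode ` S" "encode :: 'a \<Rightarrow> nat", OF _ primrec_encode[OF primrec_id]]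
  by (simp add: rec_enum_iff inj_image_mem_iff[OF inj_encode])

lemma rec_enum_lists:
  assumes "rec_enum S" shows "rec_enum (lists S)"
proof -
  have "n \<in> encode ` lists S \<longleftrightarrow> (\<forall>c\<in>set (list_decode n). c \<in> encode ` S)" for n
  proof
    assume "\<forall>c\<in>set (list_decode n). c \<in> encode ` S"
    then have "list_decode n \<in> lists (encode ` S)" by (auto simp: in_lists_conv_set)
    then obtain xs where "xs \<in> lists S" "list_decode n = map encode xs" by (auto simp: lists_image)
    then show "n \<in> encode ` lists S" by (metis encode_list_def image_eqI list_decode_inverse)
  qed (auto simp: encode_list_def)
  then show ?thesis unfolding rec_enum_iff
    using assms by (simp only: rec_enum_iff) (intro re_ball_set re_comp[OF _ primrec_snd[OF primrec_id]] pr)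
qed

lemma rec_enum_listset:
  assumes "\<And>S. S \<in> set Ss \<Longrightarrow> rec_enum S"
  shows "rec_enum (listset Ss)"
  using assms
proof (induction Ss)
  case Nil
  have "re0 (\<lambda>n :: nat. n = 0)" by (intro re_primrec pr)
  then show ?case by (simp add: rec_enum_iff encode_Nil)
next
  case (Cons S Ss)
  have "n \<in> encode ` listset (S # Ss) \<longleftrightarrow>
    n \<noteq> 0 \<and> fst (prod_decode (n - 1)) \<in> encode ` S \<and> snd (prod_decode (n - 1)) \<in> encode ` listset Ss" for n
  proof
    assume "n \<noteq> 0 \<and> fst (prod_decode (n - 1)) \<in> encode ` S \<and> snd (prod_decode (n - 1)) \<in> encode ` listset Ss"
    then obtain a as where a: "a \<in> S" "as \<in> listset Ss" "fst (prod_decode (n - 1)) = encode a"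
      "snd (prod_decode (n - 1)) = encode as" and n: "n \<noteq> 0" by auto
    then have "n = encode (a # as)"
      by (metis encode_Cons Suc_pred' bot_nat_0.not_eq_extremum prod.collapse prod_decode_inverse diff_Suc_1 Suc_diff_1)
    then show "n \<in> encode ` listset (S # Ss)" using a by (auto simp: set_Cons_def)
  qed (auto simp: set_Cons_def encode_Cons)
  moreover have S: "re0 (\<lambda>n. n \<in> encode ` S)" and Ss: "re0 (\<lambda>n. n \<in> encode ` listset Ss)"
    using Cons by (simp_all add: rec_enum_iff)
  have "re0 (\<lambda>n. n \<noteq> 0 \<and> fst (prod_decode (n - 1)) \<in> encode ` S \<and> snd (prod_decode (n - 1)) \<in> encode ` listset Ss)"
    by (intro re_conj re_primrec[of _ "\<lambda>n. n \<noteq> 0"] re_comp[OF S] re_comp[OF Ss] pr)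
  ultimately show ?case by (simp add: rec_enum_iff)
qed

section \<open>Bernoulli measures and their sections\<close>

abbreviation mu :: "'a pmf \<Rightarrow> 'a stream set \<Rightarrow> real" where
  "mu P \<equiv> measure (bernoulli_measure P)"

abbreviation stream_events :: "'a stream set set" where
  "stream_events \<equiv> sets (stream_space (count_space UNIV))"

lemma prob_space_bernoulli: "prob_space (bernoulli_measure P)"
  unfolding bernoulli_measure_def by (rule prob_space.prob_space_stream_space[OF prob_space_measure_pmf])

lemma sets_bernoulli: "sets (bernoulli_measure P) = stream_events"
  unfolding bernoulli_measure_def by (intro sets_stream_space_cong) simp

lemma space_bernoulli [simp]: "space (bernoulli_measure P) = UNIV"
  by (simp add: bernoulli_measure_def space_stream_space)

lemma cylinder_UN: "cylinder \<Omega> S = (\<Union>\<sigma>\<in>S. cylinder \<Omega> {\<sigma>})"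
  by (auto simp: cylinder_def)

lemma cylinder_mono: "S \<subseteq> T \<Longrightarrow> cylinder \<Omega> S \<subseteq> cylinder \<Omega> T"
  by (auto simp: cylinder_def)

lemma measure_cylinder_finite_le:
  fixes \<Omega> :: "'a::countable set"
  assumes "P \<in> prob_on \<Omega>" "finite F" "F \<subseteq> lists \<Omega>"
  shows "mu P (cylinder \<Omega> F) \<le> (\<Sum>\<sigma>\<in>F. prod_list (map (pmf P) \<sigma>))"
proof -
  interpret prob_space "bernoulli_measure P" by (rule prob_space_bernoulli)
  have "mu P (cylinder \<Omega> F) \<le> (\<Sum>\<sigma>\<in>F. mu P (cylinder \<Omega> {\<sigma>}))"
    unfolding cylinder_UN[of \<Omega> F]
    using assms(2,3) by (intro finite_measure_subadditive_finite image_subsetI sets_cylinder) blast+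
  also have "\<dots> = (\<Sum>\<sigma>\<in>F. prod_list (map (pmf P) \<sigma>))"
    using assms by (intro sum.cong refl measure_bernoulli_cylinder) auto
  finally show ?thesis .
qed

lemma measure_cylinder_finite:
  fixes \<Omega> :: "'a::countable set"
  assumes "P \<in> prob_on \<Omega>" "finite F" "F \<subseteq> lists \<Omega>" "prefix_free F"
  shows "mu P (cylinder \<Omega> F) = (\<Sum>\<sigma>\<in>F. prod_list (map (pmf P) \<sigma>))"
proof -
  interpret prob_space "bernoulli_measure P" by (rule prob_space_bernoulli)
  have "disjoint_family_on (\<lambda>\<sigma>. cylinder \<Omega> {\<sigma>}) F"
    unfolding disjoint_family_on_def
  proof (intro ballI impI)
    fix \<sigma> \<tau> assume *: "\<sigma> \<in> F" "\<tau> \<in> F" "\<sigma> \<noteq> \<tau>"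
    have "strict_prefix (stake m \<alpha>) (stake n \<alpha>)" if "m < n" for m n and \<alpha> :: "'a stream"
    proof -
      have "stake n \<alpha> = stake m \<alpha> @ stake (n - m) (sdrop m \<alpha>)" using that by (simp add: stake_add)
      then show ?thesis using that by (metis add.right_neutral length_stake nat_neq_iff prefixI strict_prefix_def)
    qed
    then have "False" if "stake m \<alpha> = \<sigma>" "stake n \<alpha> = \<tau>" for m n \<alpha>
      using that * assms(4) unfolding prefix_free_def by (metis nat_neq_iff)
    then show "cylinder \<Omega> {\<sigma>} \<inter> cylinder \<Omega> {\<tau>} = {}" by (auto simp: cylinder_def)
  qed
  then have "mu P (cylinder \<Omega> F) = (\<Sum>\<sigma>\<in>F. mu P (cylinder \<Omega> {\<sigma>}))"
    unfolding cylinder_UN[of \<Omega> F]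
    using assms(2,3) by (intro finite_measure_finite_Union image_subsetI sets_cylinder) blast+
  also have "\<dots> = (\<Sum>\<sigma>\<in>F. prod_list (map (pmf P) \<sigma>))"
    using assms by (intro sum.cong refl measure_bernoulli_cylinder) auto
  finally show ?thesis .
qed

text \<open>
  A cylinder is the increasing limit of cylinders of finite sets of strings, and for these the measure
  is at most the sum of the weights.
\<close>

lemma measure_cylinder_le:
  fixes \<Omega> :: "'a::countable set"
  assumes P: "P \<in> prob_on \<Omega>" and S: "S \<subseteq> lists \<Omega>"
    and le: "\<And>F. finite F \<Longrightarrow> F \<subseteq> S \<Longrightarrow> (\<Sum>\<sigma>\<in>F. prod_list (map (pmf P) \<sigma>)) \<le> c"
  shows "mu P (cylinder \<Omega> S) \<le> c"
proof (cases "S = {}")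
  case True
  then show ?thesis using le[of "{}"] by (simp add: cylinder_def)
next
  case False
  interpret prob_space "bernoulli_measure P" by (rule prob_space_bernoulli)
  define e where "e = from_nat_into S"
  have e: "range e = S" unfolding e_def by (rule range_from_nat_into[OF False]) simp
  define A where "A n = cylinder \<Omega> (e ` {..n})" for n
  have sub: "e ` {..n} \<subseteq> S" for n using e by blast
  have "(\<Union>n. A n) = cylinder \<Omega> S"
    unfolding e[symmetric] by (auto simp: A_def cylinder_def)
  moreover have "incseq A"
    unfolding A_def by (intro monoI cylinder_mono image_mono) auto
  moreover have "range A \<subseteq> sets (bernoulli_measure P)"
    using sub S by (auto simp: A_def intro!: sets_cylinder)
  ultimately have "(\<lambda>n. mu P (A n)) \<longlonglongrightarrow> mu P (cylinder \<Omega> S)"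
    using finite_Lim_measure_incseq[of A] by simp
  moreover have "mu P (A n) \<le> c" for n
    unfolding A_def using sub S
    by (intro order_trans[OF measure_cylinder_finite_le[OF P]] le) auto
  ultimately show ?thesis by (intro LIMSEQ_le_const2) auto
qed

lemma emeasure_bernoulli_sstart:
  "emeasure (bernoulli_measure P) (sstart UNIV \<sigma>) = ennreal (prod_list (map (pmf P) \<sigma>))"
proof -
  interpret prob_space "bernoulli_measure P" by (rule prob_space_bernoulli)
  have "mu P (cylinder UNIV {\<sigma>}) = prod_list (map (pmf P) \<sigma>)"
    by (rule measure_bernoulli_cylinder) (auto simp: prob_on_def)
  then show ?thesis by (simp add: cylinder_eq_sstart emeasure_eq_measure)
qed

abbreviation scons :: "'a stream \<Rightarrow> 'a list stream \<Rightarrow> 'a list stream" where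
  "scons \<equiv> smap2 (#)"

lemma measurable_scons:
  fixes p :: "'a::countable pmf"
  shows "(\<lambda>(X, Y). scons X Y) \<in> measurable (bernoulli_measure p \<Otimes>\<^sub>M bernoulli_measure q) (stream_space (count_space UNIV))"
proof (rule measurable_stream_space2)
  fix n
  let ?C = "\<lambda>(x, y). x # y"
  have X: "(\<lambda>X. X !! n) \<in> measurable (bernoulli_measure r) (count_space UNIV)" for r :: "'b pmf"
    unfolding bernoulli_measure_def by (rule measurable_compose[OF measurable_snth]) simp
  have "(\<lambda>\<omega>. (fst \<omega> !! n, snd \<omega> !! n)) \<in> measurable (bernoulli_measure p \<Otimes>\<^sub>M
      bernoulli_measure q) (count_space UNIV \<Otimes>\<^sub>M count_space UNIV)"
    by (intro measurable_Pair measurable_compose[OF measurable_fst X] measurable_compose[OF measurable_snd])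
       (auto simp: bernoulli_measure_def intro!: measurable_compose[OF measurable_snth])
  then have "(\<lambda>\<omega>. (fst \<omega> !! n, snd \<omega> !! n)) \<in> measurable (bernoulli_measure p \<Otimes>\<^sub>M
      bernoulli_measure q) (count_space (UNIV :: ('a \<times> 'a list) set))"
    by (simp add: pair_measure_countable)
  from measurable_compose[OF this, of ?C "count_space UNIV"]
  show "(\<lambda>x. (case x of (X, Y) \<Rightarrow> scons X Y) !! n) \<in> measurable (bernoulli_measure p \<Otimes>\<^sub>M bernoulli_measure q) (count_space UNIV)"
    by (simp add: split_beta)
qed

lemma scons_in_sstart:
  "[] \<notin> set \<sigma> \<Longrightarrow> scons X Y \<in> sstart UNIV \<sigma> \<longleftrightarrow>
      X \<in> sstart UNIV (map hd \<sigma>) \<and> Y \<in> sstart UNIV (map tl \<sigma>)"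
proof (induction \<sigma> arbitrary: X Y)
  case (Cons a \<sigma>)
  then show ?case by (cases a) auto
qed simp

lemma scons_notin_sstart: "[] \<in> set \<sigma> \<Longrightarrow> scons X Y \<notin> sstart UNIV \<sigma>"
  by (induction \<sigma> arbitrary: X Y) auto

definition cons_pmf :: "'a pmf \<Rightarrow> 'a list pmf \<Rightarrow> 'a list pmf" where
  "cons_pmf p q = map_pmf (\<lambda>(x, xs). x # xs) (pair_pmf p q)"

lemma pmf_cons_pmf: "pmf (cons_pmf p q) (a # as) = pmf p a * pmf q as"
proof -
  have "pmf (cons_pmf p q) ((\<lambda>(x, xs). x # xs) (a, as)) = pmf (pair_pmf p q) (a, as)"
    unfolding cons_pmf_def by (rule pmf_map_inj') (auto simp: inj_on_def)
  then show ?thesis by (simp add: pmf_pair)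
qed

lemma pmf_cons_pmf_Nil: "pmf (cons_pmf p q) [] = 0"
  by (auto simp: cons_pmf_def pmf_eq_0_set_pmf)

text \<open>
  The cylinders of strings generate the events, and both measures give a cylinder the product of the
  weights of its rows.
\<close>

lemma bernoulli_cons:
  fixes p :: "'a::countable pmf"
  shows "bernoulli_measure (cons_pmf p q) =
    distr (bernoulli_measure p \<Otimes>\<^sub>M bernoulli_measure q) (stream_space (count_space UNIV)) (\<lambda>(X, Y). scons X Y)"
    (is "?M = ?N")
proof -
  let ?PQ = "bernoulli_measure p \<Otimes>\<^sub>M bernoulli_measure q"
  interpret p: prob_space "bernoulli_measure p" by (rule prob_space_bernoulli)
  interpret q: prob_space "bernoulli_measure q" by (rule prob_space_bernoulli)
  interpret pq: pair_prob_space "bernoulli_measure p" "bernoulli_measure q" ..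
  have ss: "sstart UNIV \<sigma> \<in> sets (bernoulli_measure r)" for \<sigma> and r :: "'b::countable pmf"
    unfolding sets_bernoulli by (rule sets_sstart)
  show ?thesis
  proof (rule stream_space_eq_sstart[of UNIV])
    show "prob_space ?M" by (rule prob_space_bernoulli)
    show "prob_space ?N" by (rule pq.prob_space_distr) (rule measurable_scons)
    show "sets ?M = stream_events" by (rule sets_bernoulli)
    fix \<sigma> :: "'a list list"
    have N: "emeasure ?N (sstart UNIV \<sigma>) = emeasure ?PQ ((\<lambda>(X, Y). scons X Y) -` sstart UNIV \<sigma> \<inter> space ?PQ)"
      by (rule emeasure_distr[OF measurable_scons sets_sstart])
    show "emeasure ?M (sstart UNIV \<sigma>) = emeasure ?N (sstart UNIV \<sigma>)"
    proof (cases "[] \<in> set \<sigma>")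
      case True
      then have "(\<lambda>(X, Y). scons X Y) -` sstart UNIV \<sigma> \<inter> space ?PQ = {}"
        using scons_notin_sstart[OF True] by auto
      moreover have "prod_list (map (pmf (cons_pmf p q)) \<sigma>) = 0"
        using True pmf_cons_pmf_Nil[of p q] by (auto simp: prod_list_zero_iff image_iff intro!: bexI[of _ "[]"])
      ultimately show ?thesis by (simp add: N emeasure_bernoulli_sstart)
    next
      case False
      then have "(\<lambda>(X, Y). scons X Y) -` sstart UNIV \<sigma> \<inter> space ?PQ =
          sstart UNIV (map hd \<sigma>) \<times> sstart UNIV (map tl \<sigma>)"
        using scons_in_sstart[OF False] by (auto simp: space_pair_measure)
      then have "emeasure ?N (sstart UNIV \<sigma>) =
          ennreal (prod_list (map (pmf p) (map hd \<sigma>))) * ennreal (prod_list (map (pmf q) (map tl \<sigma>)))"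
        unfolding N by (simp add: q.emeasure_pair_measure_Times ss emeasure_bernoulli_sstart del: map_map)
      also have "\<dots> = ennreal (prod_list (map (pmf p) (map hd \<sigma>)) * prod_list (map (pmf q) (map tl \<sigma>)))"
        by (rule ennreal_mult[symmetric]) (auto intro!: prod_list_nonneg)
      also have "prod_list (map (pmf p) (map hd \<sigma>)) * prod_list (map (pmf q) (map tl \<sigma>)) =
          prod_list (map (pmf (cons_pmf p q)) \<sigma>)"
        using False
      proof (induction \<sigma>)
        case (Cons r \<sigma>)
        then show ?case by (cases r) (auto simp: pmf_cons_pmf)
      qed simp
      finally show ?thesis by (simp add: emeasure_bernoulli_sstart)
    qed
  qed auto
qed

lemma
  fixes p :: "'a::countable pmf"
  assumes "U \<in> stream_events"
  shows emeasure_bernoulli_cons: "emeasure (bernoulli_measure (cons_pmf p q)) U =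
      (\<integral>\<^sup>+ Y. emeasure (bernoulli_measure p) {X. scons X Y \<in> U} \<partial>bernoulli_measure q)"
    and sets_section: "{X. scons X Y \<in> U} \<in> sets (bernoulli_measure p)"
proof -
  let ?PQ = "bernoulli_measure p \<Otimes>\<^sub>M bernoulli_measure q"
  interpret p: prob_space "bernoulli_measure p" by (rule prob_space_bernoulli)
  interpret q: prob_space "bernoulli_measure q" by (rule prob_space_bernoulli)
  interpret pq: pair_prob_space "bernoulli_measure p" "bernoulli_measure q" ..
  let ?A = "(\<lambda>(X, Y). scons X Y) -` U \<inter> space ?PQ"
  have A: "?A \<in> sets ?PQ" by (rule measurable_sets[OF measurable_scons assms])
  have eq: "(\<lambda>X. (X, Y)) -` ?A = {X. scons X Y \<in> U}" for Y by (auto simp: space_pair_measure)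
  show "emeasure (bernoulli_measure (cons_pmf p q)) U =
      (\<integral>\<^sup>+ Y. emeasure (bernoulli_measure p) {X. scons X Y \<in> U} \<partial>bernoulli_measure q)"
    unfolding bernoulli_cons emeasure_distr[OF measurable_scons assms] pq.emeasure_pair_measure_alt2[OF A] eq ..
  show "{X. scons X Y \<in> U} \<in> sets (bernoulli_measure p)"
    using sets_Pair2[OF A, of Y] unfolding eq .
qed

lemma measure_le_of_sections:
  fixes p :: "'a::countable pmf"
  assumes U: "U \<in> stream_events"
    and le: "\<And>Y. mu p {X. scons X Y \<in> U} \<le> c"
  shows "mu (cons_pmf p q) U \<le> c"
proof -
  interpret p: prob_space "bernoulli_measure p" by (rule prob_space_bernoulli)
  interpret q: prob_space "bernoulli_measure q" by (rule prob_space_bernoulli)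
  interpret pq: prob_space "bernoulli_measure (cons_pmf p q)" by (rule prob_space_bernoulli)
  have c: "0 \<le> c" using le[of undefined] measure_nonneg order_trans by blast
  have "emeasure (bernoulli_measure (cons_pmf p q)) U \<le> (\<integral>\<^sup>+ Y. ennreal c \<partial>bernoulli_measure q)"
    unfolding emeasure_bernoulli_cons[OF U] p.emeasure_eq_measure
    by (intro nn_integral_mono ennreal_leI le)
  also have "\<dots> = ennreal c" by (simp add: q.emeasure_space_1[simplified])
  finally show ?thesis by (simp add: pq.emeasure_eq_measure c)
qed

text \<open>
  Markov's inequality for the measures of the sections of \<open>U\<close>.
\<close>

lemma measure_large_sections:
  fixes p :: "'a::countable pmf"
  assumes U: "U \<in> stream_events"
    and V: "V \<in> stream_events"
    and le: "\<And>Y. Y \<in> V \<Longrightarrow> c \<le> mu p {X. scons X Y \<in> U}"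
    and c: "0 \<le> c"
  shows "c * mu q V \<le> mu (cons_pmf p q) U"
proof -
  interpret p: prob_space "bernoulli_measure p" by (rule prob_space_bernoulli)
  interpret q: prob_space "bernoulli_measure q" by (rule prob_space_bernoulli)
  interpret pq: prob_space "bernoulli_measure (cons_pmf p q)" by (rule prob_space_bernoulli)
  have V': "V \<in> sets (bernoulli_measure q)" using V by (simp add: sets_bernoulli)
  have "ennreal c * emeasure (bernoulli_measure q) V = (\<integral>\<^sup>+ Y. ennreal c * indicator V Y \<partial>bernoulli_measure q)"
    using V' by (simp add: nn_integral_cmult_indicator)
  also have "\<dots> \<le> emeasure (bernoulli_measure (cons_pmf p q)) U"
    unfolding emeasure_bernoulli_cons[OF U] p.emeasure_eq_measure
    by (intro nn_integral_mono) (auto simp: indicator_def intro!: ennreal_leI le)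
  finally show ?thesis
    using c by (simp add: pq.emeasure_eq_measure q.emeasure_eq_measure flip: ennreal_mult)
qed

lemma measure_vimage_tl:
  fixes p :: "'a::countable pmf"
  assumes W: "W \<in> stream_events"
  shows "smap tl -` W \<in> stream_events"
    and "mu (cons_pmf p q) (smap tl -` W) = mu q W"
proof -
  interpret p: prob_space "bernoulli_measure p" by (rule prob_space_bernoulli)
  have "smap tl \<in> measurable (stream_space (count_space UNIV)) (stream_space (count_space (UNIV :: 'a list set)))"
    by (rule measurable_smap) simp
  from measurable_sets[OF this W] show *: "smap tl -` W \<in> stream_events"
    by (simp add: space_stream_space)
  have "smap tl (scons X Y) = Y" for X :: "'a stream" and Y by (simp add: smap2_alt)
  then have "{X. scons X Y \<in> smap tl -` W} = (if Y \<in> W then UNIV else {})" for Y by auto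
  then have "emeasure (bernoulli_measure p) {X. scons X Y \<in> smap tl -` W} = indicator W Y" for Y
    using p.emeasure_space_1 by simp
  then have "emeasure (bernoulli_measure (cons_pmf p q)) (smap tl -` W) = emeasure (bernoulli_measure q) W"
    unfolding emeasure_bernoulli_cons[OF *] using W by (simp add: sets_bernoulli)
  then show "mu (cons_pmf p q) (smap tl -` W) = mu q W"
    by (simp add: measure_def)
qed

section \<open>Sums of computable probabilities\<close>

text \<open>
  Numerator and denominator of a rational number, read off from its code.  A negative numerator counts
  as \<open>0\<close>: approximations of probabilities may be rounded up to \<open>0\<close>.
\<close>

definition code_num :: "nat \<Rightarrow> nat" where
  "code_num v = (if fst (prod_decode v) = 2 * (fst (prod_decode v) div 2) then fst (prod_decode v) div 2 else 0)"

definition code_den :: "nat \<Rightarrow> nat" where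
  "code_den v = snd (prod_decode v) div 2"

lemma code_num_den:
  "code_den (encode (r :: rat)) > 0" "real (code_num (encode r)) / real (code_den (encode r)) = max 0 (of_rat r)"
proof -
  obtain a b where q: "quotient_of r = (a, b)" by fastforce
  then have b: "b > 0" and r: "r = of_int a / of_int b"
    using quotient_of_denom_pos quotient_of_div by blast+
  have den: "code_den (encode r) = nat b"
    using b q by (simp add: code_den_def encode_rat_def int_encode_def sum_encode_def)
  show "code_den (encode r) > 0" using b den by simp
  have num: "code_num (encode r) = nat a"
  proof (cases "a \<ge> 0")
    case True
    then show ?thesis using q by (simp add: code_num_def encode_rat_def int_encode_def sum_encode_def)
  next
    case False
    have "Suc (2 * n) \<noteq> 2 * (Suc (2 * n) div 2)" for n by simp
    then show ?thesis using False q by (simp add: code_num_def encode_rat_def int_encode_def sum_encode_def)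
  qed
  show "real (code_num (encode r)) / real (code_den (encode r)) = max 0 (of_rat r)"
  proof -
    have "real_of_rat r = of_int a / of_int b" by (simp add: r of_rat_divide)
    moreover have "real (code_num (encode r)) / real (code_den (encode r)) = real (nat a) / real (nat b)"
      by (simp only: num den)
    ultimately show ?thesis
      using b by (cases "a \<ge> 0") (auto simp: max_def divide_le_0_iff zero_le_divide_iff)
  qed
qed

lemma real_div_nat_bounds:
  fixes a b :: nat assumes "b > 0"
  shows "real (a div b) \<le> real a / real b" "real a / real b < real (a div b) + 1"
proof -
  show "real (a div b) \<le> real a / real b" by (rule of_nat_div_le_of_nat)
  have "a < (a div b + 1) * b" using dividend_less_div_times[OF assms, of a] by (simp add: algebra_simps)
  then have "real a < (real (a div b) + 1) * real b"
    by (metis of_nat_1 of_nat_add of_nat_less_iff of_nat_mult)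
  then show "real a / real b < real (a div b) + 1" using assms by (simp add: pos_divide_less_eq)
qed

text \<open>
  The machine of a computable probability space is run for \<open>t\<close> steps on \<open>(a, k)\<close>; \<open>ok\<close> says that it
  has halted, and then \<open>N / 2\<^sup>k\<close> is its result, rounded down to a multiple of \<open>2\<^sup>-\<^sup>k\<close> and clipped to
  \<open>[0, 1]\<close>.  The approximation of the machine and the rounding contribute \<open>2\<^sup>-\<^sup>k\<close> each to the error.
\<close>

lemma computable_prob_approx:
  fixes P :: "'a::encodable pmf"
  assumes "computable_prob \<Omega> P"
  obtains ok :: "nat \<times> nat \<times> nat \<Rightarrow> bool" and N :: "nat \<times> nat \<times> nat \<Rightarrow> nat"
  where "primrec0 ok" "primrec0 N"
    "\<And>t a k. a \<in> \<Omega> \<Longrightarrow> ok (t, encode a, k) \<Longrightarrow> \<bar>pmf P a - real (N (t, encode a, k)) / 2 ^ k\<bar> \<le> 2 / 2 ^ k"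
    "\<And>t a k. N (t, a, k) \<le> 2 ^ k"
    "\<And>a k. a \<in> \<Omega> \<Longrightarrow> \<exists>t0. \<forall>t\<ge>t0. ok (t, encode a, k)"
proof -
  obtain f :: "'a \<times> nat \<rightharpoonup> rat" where f: "partial_recursive f" "dom f = \<Omega> \<times> UNIV"
    and approx: "\<And>a k. a \<in> \<Omega> \<Longrightarrow> \<bar>pmf P a - of_rat (the (f (a, k)))\<bar> \<le> (1 / 2) ^ k"
    using assms unfolding computable_prob_def by blast
  obtain M where M: "oracle_TM M"
    "\<And>i j. computes Map.empty M i j \<longleftrightarrow> (\<exists>x y. f x = Some y \<and> i = encode x \<and> j = encode y)"
    using f(1) unfolding partial_recursive_def by blast
  define run where "run p = sim Map.empty M (prod_encode (snd p)) (fst p)" for p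
  define ok where "ok p \<longleftrightarrow> fst (run p) = accept_state M" for p
  define v where "v p = tape_value (nth_or ([], []) (snd (run p)) 0)" for p
  define N where "N p = min (2 ^ snd (snd p)) (code_num (v p) * 2 ^ snd (snd p) div code_den (v p))" for p
  have pe: "primrec0 (\<lambda>p :: nat \<times> nat \<times> nat. prod_encode (snd p))"
  proof -
    have "(\<lambda>p :: nat \<times> nat \<times> nat. prod_encode (snd p)) = (\<lambda>p. encode (snd p))"
      by (auto simp: fun_eq_iff encode_prod_def encode_nat_def)
    then show ?thesis by (simp only:) (intro pr)
  qed
  have run: "primrec0 run"
    unfolding run_def[abs_def]
    by (rule primrec_sim[OF M(1), of "\<lambda>_ :: nat. Map.empty" "\<lambda>_. 0"]) (auto intro!: pr pe)
  have ok: "primrec0 ok"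
    unfolding ok_def[abs_def] by (intro pr run)
  have v: "primrec0 v"
    unfolding v_def[abs_def] by (intro pr run)
  have N: "primrec0 N"
    unfolding N_def[abs_def] code_num_def code_den_def by (intro pr v)
  show thesis
  proof (rule that[OF ok N])
    show "N (t, a, k) \<le> 2 ^ k" for t a k by (simp add: N_def)
    fix a k assume a: "a \<in> \<Omega>"
    then obtain r where r: "f (a, k) = Some r" using f(2) by auto
    have code: "prod_encode (encode a, k) = encode (a, k)" by (simp add: encode_prod_def encode_nat_def)
    show "\<exists>t0. \<forall>t\<ge>t0. ok (t, encode a, k)"
    proof -
      have "computes Map.empty M (encode (a, k)) (encode r)" using M(2) r by blast
      then obtain ts where "reaches Map.empty M (init_config M (encode (a, k))) (accept_state M, ts)"
        by (auto simp: computes_def)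
      then obtain t0 where t0: "sim Map.empty M (encode (a, k)) t0 = (accept_state M, ts)"
        using reaches_iff_sim[OF M(1)] by blast
      have "ok (t, encode a, k)" if "t \<ge> t0" for t
        using sim_halted[of Map.empty M "encode (a, k)" t0 t] that t0 by (simp add: ok_def run_def code)
      then show ?thesis by blast
    qed
    fix t assume "ok (t, encode a, k)"
    then obtain ts where ts: "sim Map.empty M (encode (a, k)) t = (accept_state M, ts)"
      by (cases "sim Map.empty M (encode (a, k)) t") (simp add: ok_def run_def code)
    then have re: "reaches Map.empty M (init_config M (encode (a, k))) (accept_state M, ts)"
      using reaches_iff_sim[OF M(1)] by blast
    have "length ts = work_tapes M + 2"
    proof -
      have "reaches Map.empty M (init_config M (encode (a, k))) d \<Longrightarrow> proper M d" for d
        unfolding reaches_def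
        by (induction rule: rtranclp_induct) (auto intro: proper_init proper_step[OF M(1)])
      from this[OF re] show ?thesis by (simp add: proper_def)
    qed
    then have vt: "v (t, encode a, k) = tape_value (ts ! 0)"
      using ts by (simp add: v_def run_def code nth_or_nth)
    have "computes Map.empty M (encode (a, k)) (v (t, encode a, k))"
      using re vt by (auto simp: computes_def)
    then obtain x y where "f x = Some y" "encode (a, k) = encode x" "v (t, encode a, k) = encode y"
      using M(2) by blast
    then have vr: "v (t, encode a, k) = encode r"
      using r inj_eq[OF inj_encode, of "(a, k)" x] by auto
    define q where "q = max 0 (real_of_rat r)"
    define y where "y = code_num (encode r) * 2 ^ k div code_den (encode r)"
    have "\<bar>pmf P a - of_rat r\<bar> \<le> (1 / 2) ^ k" using approx[OF a, of k] r by simp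
    moreover have "\<bar>x - max 0 R\<bar> \<le> c" if "\<bar>x - R\<bar> \<le> c" "0 \<le> x" for x R c :: real using that by auto
    ultimately have 1: "\<bar>pmf P a - q\<bar> \<le> 1 / 2 ^ k" by (simp add: q_def power_one_over)
    have "q * 2 ^ k = real (code_num (encode r) * 2 ^ k) / real (code_den (encode r))"
      by (simp add: q_def flip: code_num_den(2)[of r])
    then have "real y \<le> q * 2 ^ k" "q * 2 ^ k < real y + 1"
      using real_div_nat_bounds[OF code_num_den(1)[of r], of "code_num (encode r) * 2 ^ k"] by (simp_all add: y_def)
    then have 2: "real y / 2 ^ k \<le> q" "q \<le> real y / 2 ^ k + 1 / 2 ^ k"
      by (simp_all add: field_simps)
    have "real (N (t, encode a, k)) / 2 ^ k = min 1 (real y / 2 ^ k)"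
      by (simp add: N_def vr y_def min_def field_simps)
    moreover have "\<bar>p - min 1 z\<bar> \<le> 2 * c"
      if "\<bar>p - q\<bar> \<le> c" "z \<le> q" "q \<le> z + c" "p \<le> 1" for p z c :: real
      using that by (auto simp: min_def abs_le_iff)
    from this[OF 1 2 pmf_le_1] have "\<bar>pmf P a - min 1 (real y / 2 ^ k)\<bar> \<le> 2 / 2 ^ k" by simp
    ultimately show "\<bar>pmf P a - real (N (t, encode a, k)) / 2 ^ k\<bar> \<le> 2 / 2 ^ k" by simp
  qed
qed

text \<open>
  A product of fixed-point numbers with truncation after each factor.  Each factor adds \<open>2 / 2\<^sup>k\<close> to the
  error for its own approximation and \<open>1 / 2\<^sup>k\<close> for the truncation, since the other factors are at
  most \<open>1\<close>.
\<close>

lemma fixed_point_product: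
  fixes p :: "'a \<Rightarrow> real" and N :: "'a \<Rightarrow> nat"
  assumes "\<And>a. a \<in> set \<sigma> \<Longrightarrow> \<bar>p a - real (N a) / 2 ^ k\<bar> \<le> 2 / 2 ^ k \<and>
      N a \<le> 2 ^ k \<and> 0 \<le> p a \<and> p a \<le> 1"
    and "A \<le> 2 ^ k" "\<bar>x - real A / 2 ^ k\<bar> \<le> e" "0 \<le> x" "x \<le> 1"
  shows "\<bar>x * prod_list (map p \<sigma>) - real (foldl (\<lambda>acc a. acc * N a div 2 ^ k) A \<sigma>) / 2 ^ k\<bar> \<le> e + 3 * real (length \<sigma>) / 2 ^ k"
  using assms
proof (induction \<sigma> arbitrary: A x e)
  case Nil
  then show ?case by simp
next
  case (Cons a \<sigma>)
  let ?A = "A * N a div 2 ^ k"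
  let ?u = "real A / 2 ^ k" and ?w = "real (N a) / 2 ^ k"
  have a: "\<bar>p a - ?w\<bar> \<le> 2 / 2 ^ k" "N a \<le> 2 ^ k" "0 \<le> p a" "p a \<le> 1" using Cons.prems(1)[of a] by auto
  have u: "0 \<le> ?u" "?u \<le> 1" using Cons.prems(2) by (simp_all add: divide_le_eq)
  have A: "?A \<le> 2 ^ k"
  proof -
    have "A * N a div 2 ^ k \<le> 2 ^ k * 2 ^ k div 2 ^ k"
      by (intro div_le_mono mult_le_mono Cons.prems(2) a(2))
    then show ?thesis by simp
  qed
  have fl: "real ?A \<le> real (A * N a) / 2 ^ k" "real (A * N a) / 2 ^ k < real ?A + 1"
    using real_div_nat_bounds[of "2 ^ k" "A * N a"] by simp_all
  have tr: "\<bar>?u * ?w - real ?A / 2 ^ k\<bar> \<le> 1 / 2 ^ k"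
  proof -
    have "?u * ?w - real ?A / 2 ^ k = (real (A * N a) / 2 ^ k - real ?A) / 2 ^ k" by (simp add: diff_divide_distrib)
    moreover have "0 \<le> (real (A * N a) / 2 ^ k - real ?A) / 2 ^ k" using fl(1) by simp
    moreover have "(real (A * N a) / 2 ^ k - real ?A) / 2 ^ k \<le> 1 / 2 ^ k" using fl(2) by (intro divide_right_mono) auto
    ultimately show ?thesis by simp
  qed
  have "x * p a - ?u * ?w = (x - ?u) * p a + ?u * (p a - ?w)" by (simp add: algebra_simps)
  also have "\<bar>\<dots>\<bar> \<le> \<bar>x - ?u\<bar> * p a + ?u * \<bar>p a - ?w\<bar>"
    using u a by (metis abs_mult abs_of_nonneg abs_triangle_ineq)
  also have "\<dots> \<le> e * 1 + 1 * (2 / 2 ^ k)"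
    using u a Cons.prems(3) by (intro add_mono mult_mono) auto
  finally have "\<bar>x * p a - ?u * ?w\<bar> \<le> e + 2 / 2 ^ k" by simp
  moreover have "\<bar>a - c\<bar> \<le> e + 3 / 2 ^ k" if "\<bar>a - b\<bar> \<le> e + 2 / 2 ^ k" "\<bar>b - c\<bar> \<le> 1 / 2 ^ k" for a b c :: real
  proof -
    have "(3 :: real) / 2 ^ k = 2 / 2 ^ k + 1 / 2 ^ k" by (simp flip: add_divide_distrib)
    then show ?thesis using that by linarith
  qed
  ultimately have "\<bar>x * p a - real ?A / 2 ^ k\<bar> \<le> e + 3 / 2 ^ k"
    using tr by blast
  then have "\<bar>(x * p a) * prod_list (map p \<sigma>) - real (foldl (\<lambda>acc a. acc * N a div 2 ^ k) ?A \<sigma>) / 2 ^ k\<bar>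
      \<le> (e + 3 / 2 ^ k) + 3 * real (length \<sigma>) / 2 ^ k"
    using Cons.prems a A by (intro Cons.IH) (auto simp: mult_le_one)
  then show ?case by (simp add: mult.assoc field_simps)
qed

lemma foldl_add_sum_list: "foldl (\<lambda>acc x. acc + g x) a xs = a + (\<Sum>x\<leftarrow>xs. g x)" for a :: nat
  by (induction xs arbitrary: a) auto

text \<open>
  A strict inequality between the sum of the weights of finitely many strings and \<open>2\<^sup>-\<^sup>m\<close> is confirmed
  as soon as the precision exceeds the gap.  So both directions of the inequality are enumerable.
\<close>

lemma computable_prob_sums:
  fixes P :: "'a::encodable pmf"
  assumes "computable_prob \<Omega> P"
  obtains Less Greater :: "nat list \<times> nat \<Rightarrow> bool"
  where "re0 Less" "re0 Greater"
    "\<And>L m. L \<in> lists (lists \<Omega>) \<Longrightarrow> Less (map encode L, m) \<longleftrightarrow>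
        (\<Sum>\<sigma>\<leftarrow>L. prod_list (map (pmf P) \<sigma>)) < (1 / 2) ^ m"
    "\<And>L m. L \<in> lists (lists \<Omega>) \<Longrightarrow> Greater (map encode L, m) \<longleftrightarrow>
        (1 / 2) ^ m < (\<Sum>\<sigma>\<leftarrow>L. prod_list (map (pmf P) \<sigma>))"
proof -
  obtain ok :: "nat \<times> nat \<times> nat \<Rightarrow> bool" and N :: "nat \<times> nat \<times> nat \<Rightarrow> nat"
  where ok: "primrec0 ok" and N: "primrec0 N"
    and apx: "\<And>t a k. a \<in> \<Omega> \<Longrightarrow> ok (t, encode a, k) \<Longrightarrow>
        \<bar>pmf P a - real (N (t, encode a, k)) / 2 ^ k\<bar> \<le> 2 / 2 ^ k"
    and N_le: "\<And>t a k. N (t, a, k) \<le> 2 ^ k"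
    and conv: "\<And>a k. a \<in> \<Omega> \<Longrightarrow> \<exists>t0. \<forall>t\<ge>t0. ok (t, encode a, k)"
    by (rule computable_prob_approx[OF assms]) blast
  define str where "str t k s = foldl (\<lambda>acc c. acc * N (t, c, k) div 2 ^ k) (2 ^ k) (list_decode s)" for t k s
  define tot where "tot t k L = foldl (\<lambda>acc s. acc + str t k s) 0 L" for t k L
  define err where "err L = foldl (\<lambda>acc s. acc + 3 * length (list_decode s)) 0 L" for L
  define fin where "fin t k L \<longleftrightarrow> (\<forall>s\<in>set L. \<forall>c\<in>set (list_decode s). ok (t, c, k))" for t k L
  define Less where "Less p \<longleftrightarrow> (\<exists>t k. fin t k (fst p) \<and> (tot t k (fst p) + err (fst p)) * 2 ^ snd p < 2 ^ k)" for p
  define Greater where "Greater p \<longleftrightarrow> (\<exists>t k. fin t k (fst p) \<and> 2 ^ k + err (fst p) * 2 ^ snd p < tot t k (fst p) * 2 ^ snd p)" for p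
  have tot: "primrec0 (\<lambda>q :: ((nat list \<times> nat) \<times> nat) \<times> nat. tot (snd (fst q)) (snd q) (fst (fst (fst q))))"
    unfolding tot_def str_def by (intro pr primrec_comp[OF N])
  have err: "primrec0 (\<lambda>q :: ((nat list \<times> nat) \<times> nat) \<times> nat. err (fst (fst (fst q))))"
    unfolding err_def by (intro pr)
  have fin: "primrec0 (\<lambda>q :: ((nat list \<times> nat) \<times> nat) \<times> nat. fin (snd (fst q)) (snd q) (fst (fst (fst q))))"
    unfolding fin_def by (intro pr primrec_comp[OF ok])
  have rL: "re0 Less"
    unfolding Less_def[abs_def] by (intro re_ex_nat re_primrec primrec_conj fin primrec_less primrec_mult primrec_add tot err pr)
  have rG: "re0 Greater"
    unfolding Greater_def[abs_def] by (intro re_ex_nat re_primrec primrec_conj fin primrec_less primrec_mult primrec_add tot err pr)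
  let ?S = "\<lambda>L. \<Sum>\<sigma>\<leftarrow>L. prod_list (map (pmf P) \<sigma>)"
  have dec: "list_decode (encode \<sigma>) = map encode \<sigma>" for \<sigma> :: "'a list" by (simp add: encode_list_def)
  have str: "\<bar>prod_list (map (pmf P) \<sigma>) - real (str t k (encode \<sigma>)) / 2 ^ k\<bar> \<le> real (3 * length \<sigma>) / 2 ^ k"
    if "\<sigma> \<in> lists \<Omega>" "\<forall>c\<in>set (list_decode (encode \<sigma>)). ok (t, c, k)" for \<sigma> t k
    using fixed_point_product[of \<sigma> "pmf P" "\<lambda>a. N (t, encode a, k)" k "2 ^ k" 1 0] that
    by (auto simp: str_def dec apx N_le pmf_le_1 in_lists_conv_set foldl_map)
  have err_Cons: "err (s # L) = 3 * length (list_decode s) + err L" for s L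
    by (simp add: err_def foldl_add_sum_list)
  have tot_Cons: "tot t k (s # L) = str t k s + tot t k L" for t k s L
    by (simp add: tot_def foldl_add_sum_list)
  have close: "\<bar>?S L - real (tot t k (map encode L)) / 2 ^ k\<bar> \<le> real (err (map encode L)) / 2 ^ k"
    if "L \<in> lists (lists \<Omega>)" "fin t k (map encode L)" for L t k
    using that
  proof (induction L)
    case Nil
    then show ?case by (simp add: tot_def err_def)
  next
    case (Cons \<sigma> L)
    then show ?case using str[of \<sigma> t k] by (simp add: tot_Cons err_Cons fin_def add_divide_distrib dec)
  qed
  have conv_letter: "\<exists>t0. \<forall>t\<ge>t0. \<forall>c\<in>set (map encode \<sigma>). ok (t, c, k)" if "\<sigma> \<in> lists \<Omega>" for \<sigma> k
    using that
  proof (induction \<sigma>)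
    case (Cons a \<sigma>)
    then obtain t0 where "\<forall>t\<ge>t0. \<forall>c\<in>set (map encode \<sigma>). ok (t, c, k)" by auto
    moreover obtain t1 where "\<forall>t\<ge>t1. ok (t, encode a, k)" using conv[of a k] Cons by auto
    ultimately show ?case by (intro exI[of _ "max t0 t1"]) auto
  qed simp
  have conv_list: "\<exists>t0. \<forall>t\<ge>t0. fin t k (map encode L)" if "L \<in> lists (lists \<Omega>)" for L k
    using that
  proof (induction L)
    case (Cons \<sigma> L)
    then obtain t0 where "\<forall>t\<ge>t0. fin t k (map encode L)" by auto
    moreover obtain t1 where "\<forall>t\<ge>t1. \<forall>c\<in>set (map encode \<sigma>). ok (t, c, k)" using conv_letter[of \<sigma> k] Cons by auto
    ultimately show ?case by (intro exI[of _ "max t0 t1"]) (auto simp: fin_def dec)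
  qed (simp add: fin_def)
  have small: "\<exists>k. 2 * real e / 2 ^ k < d" if "d > 0" for d :: real and e :: nat
  proof -
    have "0 < d / (2 * real e + 1)" using that by simp
    then obtain k where "(1 / 2) ^ k < d / (2 * real e + 1)"
      using real_arch_pow_inv[of "d / (2 * real e + 1)" "1 / 2"] by auto
    then have "(2 * real e + 1) * (1 / 2) ^ k < d" by (simp add: field_simps)
    moreover have "2 * real e / 2 ^ k \<le> (2 * real e + 1) * (1 / 2) ^ k" by (simp add: power_one_over field_simps)
    ultimately show ?thesis by (meson le_less_trans)
  qed
  have iffL: "(tot t k M + err M) * 2 ^ m < 2 ^ k \<longleftrightarrow> real (tot t k M) / 2 ^ k + real (err M) / 2 ^ k < (1 / 2) ^ m" for t k M m
  proof -
    have "(tot t k M + err M) * 2 ^ m < 2 ^ k \<longleftrightarrow> real ((tot t k M + err M) * 2 ^ m) < real (2 ^ k)"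
      by (rule of_nat_less_iff[symmetric])
    then show ?thesis by (simp add: power_one_over field_simps)
  qed
  have iffG: "2 ^ k + err M * 2 ^ m < tot t k M * 2 ^ m \<longleftrightarrow> (1 / 2) ^ m < real (tot t k M) / 2 ^ k - real (err M) / 2 ^ k" for t k M m
  proof -
    have "2 ^ k + err M * 2 ^ m < tot t k M * 2 ^ m \<longleftrightarrow> real (2 ^ k + err M * 2 ^ m) < real (tot t k M * 2 ^ m)"
      by (rule of_nat_less_iff[symmetric])
    then show ?thesis by (simp add: power_one_over field_simps)
  qed
  show thesis
  proof (rule that[OF rL rG])
    fix L :: "'a list list" and m assume L: "L \<in> lists (lists \<Omega>)"
    let ?E = "map encode L"
    show "Less (?E, m) \<longleftrightarrow> ?S L < (1 / 2) ^ m"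
    proof
      assume "Less (?E, m)"
      then obtain t k where "fin t k ?E" "real (tot t k ?E) / 2 ^ k + real (err ?E) / 2 ^ k < (1 / 2) ^ m"
        by (auto simp: Less_def iffL)
      then show "?S L < (1 / 2) ^ m" using close[OF L, of t k] by linarith
    next
      assume *: "?S L < (1 / 2) ^ m"
      then obtain k where k: "2 * real (err ?E) / 2 ^ k < (1 / 2) ^ m - ?S L" using small[of "(1 / 2) ^ m - ?S L"] by auto
      obtain t where t: "fin t k ?E" using conv_list[OF L, of k] by auto
      have "2 * real (err ?E) / 2 ^ k = real (err ?E) / 2 ^ k + real (err ?E) / 2 ^ k" by simp
      with k close[OF L t] have "real (tot t k ?E) / 2 ^ k + real (err ?E) / 2 ^ k < (1 / 2) ^ m" by linarith
      with t show "Less (?E, m)" by (auto simp: Less_def iffL)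
    qed
    show "Greater (?E, m) \<longleftrightarrow> (1 / 2) ^ m < ?S L"
    proof
      assume "Greater (?E, m)"
      then obtain t k where "fin t k ?E" "(1 / 2) ^ m < real (tot t k ?E) / 2 ^ k - real (err ?E) / 2 ^ k"
        by (auto simp: Greater_def iffG)
      then show "(1 / 2) ^ m < ?S L" using close[OF L, of t k] by linarith
    next
      assume *: "(1 / 2) ^ m < ?S L"
      then obtain k where k: "2 * real (err ?E) / 2 ^ k < ?S L - (1 / 2) ^ m" using small[of "?S L - (1 / 2) ^ m"] by auto
      obtain t where t: "fin t k ?E" using conv_list[OF L, of k] by auto
      have "2 * real (err ?E) / 2 ^ k = real (err ?E) / 2 ^ k + real (err ?E) / 2 ^ k" by simp
      with k close[OF L t] have "(1 / 2) ^ m < real (tot t k ?E) / 2 ^ k - real (err ?E) / 2 ^ k" by linarith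
      with t show "Greater (?E, m)" by (auto simp: Greater_def iffG)
    qed
  qed
qed

section \<open>Effectively open sets and the use of the oracle\<close>

text \<open>
  Membership in \<open>A\<close> has to be part of the enumeration, as the codes of \<open>A\<close> need not be decidable.
\<close>

lemma re_restrict:
  fixes A :: "'a::encodable set"
  assumes "rec_enum A" "re_in orc R"
  shows "re_in orc (\<lambda>n. n \<in> encode ` {x \<in> A. R x})"
proof -
  obtain f where f: "primrec_in orc f" "\<And>x. R x \<longleftrightarrow> (\<exists>w::nat. f (x, w))"
    using assms(2) unfolding re_in_def by blast
  obtain g where g: "tracks orc g f" using f(1) by (rule primrec_inE)
  have g': "primrec_in orc g"
    using g by (auto simp: primrec_in_def tracks_def encode_nat_def)
  have gf: "g (prod_encode (encode x, w)) = 1 \<longleftrightarrow> f (x, w)" for x w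
    using tracksD(2)[OF g, of "(x, w)"] by (simp add: encode_prod_def encode_nat_def encode_bool_def)
  have pe: "primrec_in orc (\<lambda>p :: nat \<times> nat. prod_encode (fst p, snd p))"
  proof -
    have "(\<lambda>p :: nat \<times> nat. prod_encode (fst p, snd p)) = (\<lambda>p. encode p)"
      by (auto simp: fun_eq_iff encode_prod_def encode_nat_def)
    then show ?thesis by (simp only:) (intro pr)
  qed
  have A: "re_in orc (\<lambda>n. n \<in> encode ` A)"
    using assms(1) unfolding rec_enum_iff by (rule re_in_mono)
  have "re_in orc (\<lambda>n. n \<in> encode ` A \<and> (\<exists>w. g (prod_encode (n, w)) = 1))"
    by (rule re_conj[OF A]) (intro re_ex_nat re_primrec primrec_eq primrec_const primrec_comp[OF g'] pe)
  moreover have "n \<in> encode ` A \<and> (\<exists>w. g (prod_encode (n, w)) = 1) \<longleftrightarrow> n \<in> encode ` {x \<in> A. R x}" for n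
    using gf f(2) by auto
  ultimately show ?thesis by simp
qed

lemma rec_enum_Times:
  assumes "rec_enum A" "rec_enum B"
  shows "rec_enum (A \<times> B)"
proof -
  have "n \<in> encode ` (A \<times> B) \<longleftrightarrow> fst (prod_decode n) \<in> encode ` A \<and> snd (prod_decode n) \<in> encode ` B" for n
  proof
    assume "fst (prod_decode n) \<in> encode ` A \<and> snd (prod_decode n) \<in> encode ` B"
    then obtain a b where "a \<in> A" "b \<in> B" "prod_decode n = (encode a, encode b)" by (cases "prod_decode n") auto
    then show "n \<in> encode ` (A \<times> B)"
      by (intro image_eqI[of _ _ "(a, b)"]) (simp_all add: encode_prod_def, metis prod_decode_inverse)
  qed (auto simp: encode_prod_def)
  moreover have A: "re0 (\<lambda>n. n \<in> encode ` A)" and B: "re0 (\<lambda>n. n \<in> encode ` B)"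
    using assms by (simp_all add: rec_enum_iff)
  have "re0 (\<lambda>n. fst (prod_decode n) \<in> encode ` A \<and> snd (prod_decode n) \<in> encode ` B)"
    by (intro re_conj re_comp[OF A] re_comp[OF B] pr)
  ultimately show ?thesis by (simp add: rec_enum_iff)
qed

lemma rec_enum_positive: "rec_enum {1::nat..}"
proof -
  have "re0 (\<lambda>n :: nat. 1 \<le> n)" by (intro re_primrec pr)
  then show ?thesis by (simp add: rec_enum_iff encode_nat_def[abs_def])
qed

text \<open>
  Over an infinite alphabet the complement of a cylinder is not a finite union of cylinders, so
  prefix-freeness is achieved by waiting instead of subtracting.  Say that a string is ready
  (\<open>Q\<close>) if one of its prefixes has been enumerated within as many steps as the string is long.
  This is decidable and is passed on to longer strings; the shortest ready prefixes form a prefix-free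
  set that generates the same open set.
\<close>

lemma re_open_set:
  fixes \<Omega> :: "'a::encodable set"
  assumes \<Omega>: "rec_enum \<Omega>" and E: "re_in orc E"
  obtains C :: "(nat \<times> 'a list) set" where
    "C \<subseteq> {1..} \<times> lists \<Omega>" "re_in orc (\<lambda>n. n \<in> encode ` C)"
    "\<And>m. prefix_free (section_at C m)"
    "\<And>m. 1 \<le> m \<Longrightarrow> cylinder \<Omega> (section_at C m) = {\<alpha> \<in> streams \<Omega>. \<exists>l. E (m, stake l \<alpha>)}"
proof -
  obtain f where f: "primrec_in orc f" "\<And>x. E x \<longleftrightarrow> (\<exists>w::nat. f (x, w))"
    using E unfolding re_in_def by blast
  define Q where "Q m \<rho> \<longleftrightarrow> (\<exists>l<Suc (length \<rho>). \<exists>w<Suc (length \<rho>). f ((m, take l \<rho>), w))" for m \<rho>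
  define R where "R p \<longleftrightarrow> Q (fst p) (snd p) \<and> (\<forall>l<length (snd p). \<not> Q (fst p) (take l (snd p)))" for p
  define C where "C = {p \<in> {1..} \<times> lists \<Omega>. R p}"
  have Q: "primrec_in orc (\<lambda>p. Q (fst p) (snd p))"
    unfolding Q_def by (intro pr primrec_comp[OF f(1)])
  have R: "primrec_in orc R"
    unfolding R_def[abs_def]
    by (intro pr primrec_comp[OF Q, of "\<lambda>p. (fst (fst p), take (snd p) (snd (fst p)))", simplified] Q)
  have Q_mono: "Q m (take l \<rho>) \<Longrightarrow> Q m \<rho>" for m l \<rho>
  proof -
    assume "Q m (take l \<rho>)"
    then obtain l' w where L: "l' < Suc (length (take l \<rho>))" "w < Suc (length (take l \<rho>))" "f ((m, take l' (take l \<rho>)), w)"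
      by (auto simp: Q_def)
    have "take l' (take l \<rho>) = take l' \<rho>" using L(1) by (simp add: min_def split: if_splits)
    then show "Q m \<rho>" unfolding Q_def
      using L by (intro exI[of _ l'] exI[of _ w] conjI) (simp_all add: min_def split: if_splits)
  qed
  show thesis
  proof (rule that[of C])
    show "C \<subseteq> {1..} \<times> lists \<Omega>" by (auto simp: C_def)
    show "re_in orc (\<lambda>n. n \<in> encode ` C)"
      unfolding C_def by (intro re_restrict rec_enum_Times rec_enum_positive rec_enum_lists \<Omega> re_primrec R)
    show "prefix_free (section_at C m)" for m
      unfolding prefix_free_def
    proof (intro ballI notI)
      fix \<sigma> \<tau> assume \<sigma>: "\<sigma> \<in> section_at C m" and \<tau>: "\<tau> \<in> section_at C m" and p: "strict_prefix \<sigma> \<tau>"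
      have "\<sigma> = take (length \<sigma>) \<tau>" "length \<sigma> < length \<tau>"
        using p by (auto simp: strict_prefix_def prefix_def)
      then show False using \<sigma> \<tau> by (auto simp: C_def R_def)
    qed
    fix m :: nat assume m: "1 \<le> m"
    show "cylinder \<Omega> (section_at C m) = {\<alpha> \<in> streams \<Omega>. \<exists>l. E (m, stake l \<alpha>)}"
    proof (intro set_eqI iffI)
      fix \<alpha> assume "\<alpha> \<in> cylinder \<Omega> (section_at C m)"
      then obtain n where n: "\<alpha> \<in> streams \<Omega>" "Q m (stake n \<alpha>)" by (auto simp: cylinder_def C_def R_def)
      then obtain l w where "f ((m, take l (stake n \<alpha>)), w)" by (auto simp: Q_def)
      then have "E (m, stake (min l n) \<alpha>)" by (auto simp: f(2) take_stake min.commute)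
      then show "\<alpha> \<in> {\<alpha> \<in> streams \<Omega>. \<exists>l. E (m, stake l \<alpha>)}" using n by blast
    next
      fix \<alpha> assume "\<alpha> \<in> {\<alpha> \<in> streams \<Omega>. \<exists>l. E (m, stake l \<alpha>)}"
      then obtain l w where \<alpha>: "\<alpha> \<in> streams \<Omega>" and lw: "f ((m, stake l \<alpha>), w)" by (auto simp: f(2))
      have "Q m (stake (l + w) \<alpha>)"
        unfolding Q_def by (intro exI[of _ l] exI[of _ w] conjI) (auto simp: take_stake lw)
      define n where "n = (LEAST n. Q m (stake n \<alpha>))"
      have n: "Q m (stake n \<alpha>)" unfolding n_def by (rule LeastI) fact
      have "\<not> Q m (stake l \<alpha>)" if "l < n" for l using that not_less_Least unfolding n_def by blast
      then have "R (m, stake n \<alpha>)" using n by (auto simp: R_def take_stake min_def)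
      moreover have "stake n \<alpha> \<in> lists \<Omega>"
        using \<alpha> by (auto simp: in_lists_conv_set in_set_conv_nth snth_in)
      ultimately show "\<alpha> \<in> cylinder \<Omega> (section_at C m)"
        using \<alpha> m by (auto simp: cylinder_def C_def)
    qed
  qed
qed

text \<open>
  Randomness in the form in which it is used: a test need not be prefix-free, it may be given by any
  enumerable set of strings.
\<close>

lemma random_avoids:
  fixes \<Omega> :: "'a::encodable set"
  assumes "martin_lof_random \<Omega> P \<alpha>" "rec_enum \<Omega>" "re0 E"
    and small: "\<And>m. 1 \<le> m \<Longrightarrow> mu P {\<alpha> \<in> streams \<Omega>. \<exists>l. E (m, stake l \<alpha>)} < (1 / 2) ^ m"
  shows "\<exists>m\<ge>1. \<forall>l. \<not> E (m, stake l \<alpha>)"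
proof -
  obtain C where C: "C \<subseteq> {1..} \<times> lists \<Omega>" "re0 (\<lambda>n. n \<in> encode ` C)"
    "\<And>m. prefix_free (section_at C m)"
    "\<And>m. 1 \<le> m \<Longrightarrow> cylinder \<Omega> (section_at C m) = {\<alpha> \<in> streams \<Omega>. \<exists>l. E (m, stake l \<alpha>)}"
    by (rule re_open_set[OF assms(2,3)]) blast
  have "martin_lof_test \<Omega> P C"
    using C small by (auto simp: martin_lof_test_def rec_enum_iff)
  then obtain m where "m \<ge> 1" "\<alpha> \<notin> cylinder \<Omega> (section_at C m)" and \<alpha>: "\<alpha> \<in> streams \<Omega>"
    using assms(1) by (auto simp: martin_lof_random_def)
  then show ?thesis using C(4)[of m] by blast
qed

lemma random_rel_avoids:
  fixes \<Omega> :: "'a::encodable set" and \<beta>s :: "'b::encodable stream list"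
  assumes "martin_lof_random_rel \<beta>s \<Omega> P \<alpha>" "rec_enum \<Omega>" "re_in (oracle_of \<beta>s) E"
    and small: "\<And>m. 1 \<le> m \<Longrightarrow> mu P {\<alpha> \<in> streams \<Omega>. \<exists>l. E (m, stake l \<alpha>)} < (1 / 2) ^ m"
  shows "\<exists>m\<ge>1. \<forall>l. \<not> E (m, stake l \<alpha>)"
proof -
  obtain C where C: "C \<subseteq> {1..} \<times> lists \<Omega>" "re_in (oracle_of \<beta>s) (\<lambda>n. n \<in> encode ` C)"
    "\<And>m. prefix_free (section_at C m)"
    "\<And>m. 1 \<le> m \<Longrightarrow> cylinder \<Omega> (section_at C m) = {\<alpha> \<in> streams \<Omega>. \<exists>l. E (m, stake l \<alpha>)}"
    by (rule re_open_set[OF assms(2,3)]) blast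
  obtain M where M: "oracle_TM M" "\<And>x. accepts (oracle_of \<beta>s) M x \<longleftrightarrow> x \<in> encode ` C"
    using re_in_machine[OF C(2)] by blast
  have Ceq: "C = {x \<in> {1..} \<times> lists \<Omega>. accepts (oracle_of \<beta>s) M (encode x)}"
    using C(1) by (auto simp: M(2) inj_image_mem_iff[OF inj_encode])
  have "martin_lof_test_rel \<beta>s \<Omega> P C"
    unfolding martin_lof_test_rel_def
  proof (intro conjI exI[of _ M] allI impI)
    show "mu P (cylinder \<Omega> (section_at C m)) < (1 / 2) ^ m" if "1 \<le> m" for m
      unfolding C(4)[OF that] by (rule small[OF that])
  qed (rule M(1) Ceq C(3))+
  then obtain m where "m \<ge> 1" "\<alpha> \<notin> cylinder \<Omega> (section_at C m)" and \<alpha>: "\<alpha> \<in> streams \<Omega>"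
    using assms(1) by (auto simp: martin_lof_random_rel_def)
  then show ?thesis using C(4)[of m] by blast
qed

text \<open>
  The oracle that knows the first rows \<open>\<tau>\<close> of the product of \<open>w\<close> sequences, and answers no query
  beyond them.
\<close>

definition rows_oracle :: "nat \<Rightarrow> 'a::encodable list list \<Rightarrow> nat \<rightharpoonup> nat" where
  "rows_oracle w \<tau> x = (let k = fst (prod_decode x); m = snd (prod_decode x) in
     if 1 \<le> k \<and> k \<le> w \<and> 1 \<le> m \<and> m \<le> length \<tau>
     then Some (nth_or 0 (map encode (nth_or [] \<tau> (m - 1))) (k - 1)) else None)"

definition row_stream :: "'a stream list \<Rightarrow> 'a list stream" where
  "row_stream \<beta>s = to_stream (\<lambda>m. map (\<lambda>\<beta>. \<beta> !! m) \<beta>s)"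

lemma snth_to_stream: "to_stream f !! n = f n"
  by (simp add: to_stream_def)

lemma row_stream_Cons: "row_stream (\<beta> # \<beta>s) = scons \<beta> (row_stream \<beta>s)"
proof -
  have "scons \<beta> (row_stream \<beta>s) = row_stream (\<beta> # \<beta>s)"
    unfolding smap2_alt by (simp add: row_stream_def snth_to_stream)
  then show ?thesis by simp
qed

lemma rows_oracle_eq:
  "rows_oracle (length \<beta>s) (stake l (row_stream \<beta>s)) x = (if snd (prod_decode x) \<le> l then oracle_of \<beta>s x else None)"
proof -
  obtain k m where x: "prod_decode x = (k, m)" by fastforce
  show ?thesis
    by (auto simp: rows_oracle_def oracle_of_def x nth_or_nth row_stream_def snth_to_stream)
qed

lemma accepts_use:
  "accepts (oracle_of \<beta>s) M x \<longleftrightarrow> (\<exists>l. accepts (rows_oracle (length \<beta>s) (stake l (row_stream \<beta>s))) M x)"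
proof
  let ?o = "\<lambda>l. rows_oracle (length \<beta>s) (stake l (row_stream \<beta>s))"
  assume "\<exists>l. accepts (?o l) M x"
  then obtain l ts where "reaches (?o l) M (init_config M x) (accept_state M, ts)" by (auto simp: accepts_def)
  moreover have st: "step (?o l) M c = Some d \<Longrightarrow> step (oracle_of \<beta>s) M c = Some d" for c d
    by (auto simp: step_def rows_oracle_eq split: prod.splits option.splits if_splits)
  have "reaches (oracle_of \<beta>s) M c d" if "reaches (?o l) M c d" for c d
    using that unfolding reaches_def
    by (induction rule: rtranclp_induct) (auto intro: rtranclp.rtrancl_into_rtrancl st)
  ultimately show "accepts (oracle_of \<beta>s) M x" unfolding accepts_def by blast
next
  let ?o = "\<lambda>l. rows_oracle (length \<beta>s) (stake l (row_stream \<beta>s))"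
  assume "accepts (oracle_of \<beta>s) M x"
  then obtain ts where "reaches (oracle_of \<beta>s) M (init_config M x) (accept_state M, ts)" by (auto simp: accepts_def)
  moreover have "reaches (oracle_of \<beta>s) M c d \<Longrightarrow> \<exists>l0. \<forall>l\<ge>l0. reaches (?o l) M c d" for c d
    unfolding reaches_def
  proof (induction rule: rtranclp_induct)
    case (step d e)
    then obtain l0 where l0: "\<And>l. l \<ge> l0 \<Longrightarrow> (\<lambda>c d. Defs.step (?o l) M c = Some d)\<^sup>*\<^sup>* c d" by blast
    let ?m = "snd (prod_decode (tape_value (snd d ! 1)))"
    have "Defs.step (?o l) M d = Some e" if "l \<ge> ?m" for l
      using step(2) that by (auto simp: step_def rows_oracle_eq split: prod.splits option.splits if_splits)
    then show ?case using l0 by (intro exI[of _ "max l0 ?m"]) (auto intro: rtranclp.rtrancl_into_rtrancl)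
  qed auto
  ultimately obtain l0 where "\<And>l. l \<ge> l0 \<Longrightarrow> reaches (?o l) M (init_config M x) (accept_state M, ts)" by blast
  then show "\<exists>l. accepts (?o l) M x" unfolding accepts_def by blast
qed

lemma re_accepts_rows:
  assumes "oracle_TM M"
  shows "re0 (\<lambda>p. accepts (rows_oracle w (fst p :: 'a::encodable list list)) M (snd p))"
proof (rule re_accepts[OF assms])
  have eq: "(case rows_oracle w (fst p) (snd p) of None \<Rightarrow> 0 | Some a \<Rightarrow> Suc a) =
    (if 1 \<le> fst (prod_decode (snd p)) \<and> fst (prod_decode (snd p)) \<le> w \<and> 1 \<le> snd (prod_decode (snd p)) \<and>
        snd (prod_decode (snd p)) \<le> length (fst p)
     then Suc (nth_or 0 (map encode (nth_or [] (fst p) (snd (prod_decode (snd p)) - 1))) (fst (prod_decode (snd p)) - 1)) else 0)"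
    for p :: "'a list list \<times> nat"
    by (simp add: rows_oracle_def Let_def)
  show "primrec0 (\<lambda>p :: 'a list list \<times> nat. case rows_oracle w (fst p) (snd p) of None \<Rightarrow> 0 | Some a \<Rightarrow> Suc a)"
    unfolding eq by (intro primrec_if primrec_conj primrec_Suc primrec_nth_or primrec_codes pr)
qed

text \<open>
  The sequences and the elements of the sequences are counted from \<open>1\<close> in queries.
\<close>

lemma primrec_oracle_snth:
  assumes "j < length \<beta>s"
  shows "primrec_in (oracle_of \<beta>s) (\<lambda>i. (\<beta>s ! j) !! i)"
proof -
  have pe: "primrec_in (oracle_of \<beta>s) (\<lambda>i :: nat. prod_encode (Suc j, Suc i))"
  proof -
    have "(\<lambda>i :: nat. prod_encode (Suc j, Suc i)) = (\<lambda>i. encode (Suc j, Suc i))"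
      by (auto simp: fun_eq_iff encode_prod_def encode_nat_def)
    then show ?thesis by (simp only:) (intro pr)
  qed
  have "primrec_in (oracle_of \<beta>s) (\<lambda>i. the (oracle_of \<beta>s (prod_encode (Suc j, Suc i))))"
    by (rule primrec_oracle[OF pe]) (use assms in \<open>auto simp: oracle_of_def\<close>)
  then have "primrec_in (oracle_of \<beta>s) (\<lambda>i. encode ((\<beta>s ! j) !! i))"
    using assms by (simp add: oracle_of_def)
  then show ?thesis by (simp add: primrec_in_def tracks_def encode_nat_def)
qed

lemma primrec_oracle_rows: "primrec_in (oracle_of \<beta>s) (\<lambda>i. row_stream \<beta>s !! i)"
proof -
  have "primrec_in (oracle_of \<beta>s) (\<lambda>i. map (\<lambda>\<beta>. \<beta> !! i) (drop (length \<beta>s - n) \<beta>s))" if "n \<le> length \<beta>s" for n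
    using that
  proof (induction n)
    case 0
    then show ?case by (simp add: pr)
  next
    case (Suc n)
    let ?j = "length \<beta>s - Suc n"
    have d: "drop ?j \<beta>s = \<beta>s ! ?j # drop (length \<beta>s - n) \<beta>s"
      using Suc.prems by (metis Cons_nth_drop_Suc Suc_diff_Suc Suc_le_eq diff_less length_greater_0_conv less_nat_zero_code list.size(3)
          zero_less_Suc le_imp_less_Suc not_less_eq)
    have "primrec_in (oracle_of \<beta>s) (\<lambda>i. (\<beta>s ! ?j) !! i # map (\<lambda>\<beta>. \<beta> !! i) (drop (length \<beta>s - n) \<beta>s))"
      using Suc by (intro primrec_Cons primrec_oracle_snth) auto
    then show ?case by (simp add: d)
  qed
  from this[of "length \<beta>s"] show ?thesis by (simp add: row_stream_def snth_to_stream)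
qed

lemma primrec_oracle_stake:
  fixes \<beta>s :: "'a::encodable stream list"
  assumes "primrec_in (oracle_of \<beta>s) n"
  shows "primrec_in (oracle_of \<beta>s) (\<lambda>x. stake (n x) (row_stream \<beta>s))"
proof -
  have "rec_nat [] (\<lambda>i r. r @ [s !! i]) m = stake m s" for m and s :: "'a list stream"
    by (induction m) (simp_all add: stake_Suc del: stake.simps(2))
  moreover have "primrec_in (oracle_of \<beta>s) (\<lambda>x. rec_nat [] (\<lambda>i r. r @ [row_stream \<beta>s !! i]) (n x))"
    by (intro pr assms primrec_comp[OF primrec_oracle_rows])
  ultimately show ?thesis by simp
qed

section \<open>The theorem of van Lambalgen\<close>

lemma open_set_eq_cylinder:
  "{\<alpha> \<in> streams \<Omega>. \<exists>l. E (stake l \<alpha>)} = cylinder \<Omega> {\<sigma> \<in> lists \<Omega>. E \<sigma>}"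
proof -
  have "stake l \<alpha> \<in> lists \<Omega>" if "\<alpha> \<in> streams \<Omega>" for l \<alpha>
    using that by (auto simp: in_lists_conv_set in_set_conv_nth snth_in)
  then show ?thesis by (auto simp: cylinder_def)
qed

lemma sets_open_set:
  fixes \<Omega> :: "'a::countable set"
  shows "{\<alpha> \<in> streams \<Omega>. \<exists>l. E (stake l \<alpha>)} \<in> stream_events"
  unfolding open_set_eq_cylinder using sets_cylinder[of "{\<sigma> \<in> lists \<Omega>. E \<sigma>}" \<Omega>] by (simp add: sets_bernoulli)

lemma prefix_free_subset: "prefix_free S \<Longrightarrow> T \<subseteq> S \<Longrightarrow> prefix_free T"
  unfolding prefix_free_def by blast

lemma scons_in_streams:
  "scons X Y \<in> streams (set_Cons A B) \<longleftrightarrow> X \<in> streams A \<and> Y \<in> streams B"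
  by (auto simp: streams_iff_snth set_Cons_def)

lemma stake_scons: "stake l (scons X Y) = map2 (#) (stake l X) (stake l Y)"
  by (rule stake_smap2)

lemma map_tl_stake_scons: "map tl (stake l (scons X Y)) = stake l Y"
  by (rule nth_equalityI) auto

lemma sum_list_distinct_image:
  assumes "distinct L" "set L \<subseteq> encode ` A"
  obtains \<sigma>s where "L = map encode \<sigma>s" "set \<sigma>s \<subseteq> A" "distinct \<sigma>s"
proof -
  have "L \<in> map encode ` lists A" using assms(2) by (auto simp: in_lists_conv_set simp flip: lists_image)
  then obtain \<sigma>s where "L = map encode \<sigma>s" "set \<sigma>s \<subseteq> A" by auto
  with that assms(1) show thesis by (simp add: distinct_map)
qed

text \<open>
  The preimage of a test under the projection that deletes the first component is a test.
\<close>

lemma random_tail: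
  fixes \<Omega> :: "'a::encodable set"
  assumes rand: "martin_lof_random (set_Cons \<Omega> R) (cons_pmf p q) (scons X Y)"
    and re: "rec_enum (set_Cons \<Omega> R)"
  shows "martin_lof_random R q Y"
  unfolding martin_lof_random_def
proof (intro conjI allI impI)
  show "Y \<in> streams R" using rand by (simp add: martin_lof_random_def scons_in_streams)
  fix C assume C: "martin_lof_test R q C"
  define E where "E p \<longleftrightarrow> (fst p, map tl (snd p)) \<in> C" for p :: "nat \<times> 'a list list"
  have CR: "section_at C m \<subseteq> lists R" for m using C by (auto simp: martin_lof_test_def)
  have "re0 (\<lambda>x. x \<in> C)" using C by (simp add: martin_lof_test_def rec_enum_re)
  then have E: "re0 E"
    unfolding E_def[abs_def] by (rule re_comp) (intro pr)
  have "\<exists>m\<ge>1. \<forall>l. \<not> E (m, stake l (scons X Y))"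
  proof (rule random_avoids[OF rand re E])
    fix m :: nat assume m: "1 \<le> m"
    let ?W = "cylinder R (section_at C m)"
    interpret prob_space "bernoulli_measure (cons_pmf p q)" by (rule prob_space_bernoulli)
    have W: "?W \<in> stream_events"
      using sets_cylinder[OF CR, of m q] by (simp add: sets_bernoulli)
    have "{Z \<in> streams (set_Cons \<Omega> R). \<exists>l. E (m, stake l Z)} \<subseteq> smap tl -` ?W"
    proof
      fix Z assume "Z \<in> {Z \<in> streams (set_Cons \<Omega> R). \<exists>l. E (m, stake l Z)}"
      then obtain l where Z: "Z \<in> streams (set_Cons \<Omega> R)" and "E (m, stake l Z)" by blast
      then have "(m, stake l (smap tl Z)) \<in> C" by (simp add: E_def stake_smap)
      moreover have "smap tl Z \<in> streams R" using Z by (auto simp: streams_iff_snth set_Cons_def) (metis list.sel(3))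
      ultimately show "Z \<in> smap tl -` ?W" by (auto simp: cylinder_def)
    qed
    then have "mu (cons_pmf p q) {Z \<in> streams (set_Cons \<Omega> R). \<exists>l. E (m, stake l Z)} \<le>
        mu (cons_pmf p q) (smap tl -` ?W)"
      using measure_vimage_tl(1)[OF W] by (intro finite_measure_mono) (simp_all add: sets_bernoulli)
    also have "\<dots> = mu q ?W" by (rule measure_vimage_tl(2)[OF W])
    also have "\<dots> < (1 / 2) ^ m" using C m by (simp add: martin_lof_test_def)
    finally show "mu (cons_pmf p q) {Z \<in> streams (set_Cons \<Omega> R). \<exists>l. E (m, stake l Z)} < (1 / 2) ^ m" .
  qed
  then obtain m where "1 \<le> m" "\<forall>l. (m, stake l Y) \<notin> C"
    by (auto simp only: E_def map_tl_stake_scons fst_conv snd_conv)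
  then show "\<exists>m\<ge>1. Y \<notin> cylinder R (section_at C m)"
    by (auto simp: cylinder_def)
qed

text \<open>
  A product of one factor differs from that factor only in having lists of length one as letters.  The
  other factor of \<open>cons_pmf\<close> is the trivial measure on the empty list.
\<close>

lemma random_singleton:
  fixes \<Omega> :: "'a::encodable set"
  assumes rand: "martin_lof_random \<Omega> p X" and \<Omega>: "rec_enum \<Omega>" and p: "p \<in> prob_on \<Omega>"
  shows "martin_lof_random (set_Cons \<Omega> {[]}) (cons_pmf p (return_pmf [])) (row_stream [X])"
proof -
  define Y :: "'a list stream" where "Y = row_stream []"
  have Y: "Y \<in> streams {[]}" by (simp add: Y_def row_stream_def streams_iff_snth snth_to_stream)
  have st: "stake l (scons X Y) = map (\<lambda>a. [a]) (stake l X)" if "Y \<in> streams {[]}" for l X and Y :: "'a list stream"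
    using that by (intro nth_equalityI) (auto simp: streams_iff_snth)
  have "martin_lof_random (set_Cons \<Omega> {[]}) (cons_pmf p (return_pmf [])) (scons X Y)"
    unfolding martin_lof_random_def
  proof (intro conjI allI impI)
    show "scons X Y \<in> streams (set_Cons \<Omega> {[]})"
      unfolding scons_in_streams using rand Y by (simp add: martin_lof_random_def)
    fix C assume C: "martin_lof_test (set_Cons \<Omega> {[]}) (cons_pmf p (return_pmf [])) C"
    define E where "E x \<longleftrightarrow> (fst x, map (\<lambda>a. [a]) (snd x)) \<in> C" for x :: "nat \<times> 'a list"
    have CR: "section_at C m \<subseteq> lists (set_Cons \<Omega> {[]})" for m using C by (auto simp: martin_lof_test_def)
    have "re0 (\<lambda>x. x \<in> C)" using C by (simp add: martin_lof_test_def rec_enum_re)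
    then have E: "re0 E"
      unfolding E_def[abs_def] by (rule re_comp) (intro pr)
    have "\<exists>m\<ge>1. \<forall>l. \<not> E (m, stake l X)"
    proof (rule random_avoids[OF rand \<Omega> E])
      fix m :: nat assume m: "1 \<le> m"
      let ?U = "cylinder (set_Cons \<Omega> {[]}) (section_at C m)"
      let ?A = "{X \<in> streams \<Omega>. \<exists>l. E (m, stake l X)}"
      interpret prob_space "bernoulli_measure p" by (rule prob_space_bernoulli)
      have U: "?U \<in> stream_events"
        using sets_cylinder[OF CR, of m "cons_pmf p (return_pmf [])"] by (simp add: sets_bernoulli)
      have V: "cylinder {[] :: 'a list} {[]} = streams {[]}" by (auto simp: cylinder_def intro: exI[of _ 0])
      have "mu p ?A * mu (return_pmf []) (streams {[] :: 'a list}) \<le>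
          mu (cons_pmf p (return_pmf [])) ?U"
      proof (rule measure_large_sections[OF U])
        show "streams {[] :: 'a list} \<in> stream_events"
          using sets_cylinder[of "{[]}" "{[] :: 'a list}" "return_pmf []"] by (simp add: V sets_bernoulli)
        show "mu p ?A \<le> mu p {X. scons X Y \<in> ?U}"
          if Y: "Y \<in> streams {[]}" for Y
          using sets_section[OF U, of Y p] Y st[OF Y]
          by (intro finite_measure_mono) (auto simp: cylinder_def E_def scons_in_streams simp del: set_Cons_sing_Nil)
      qed simp
      also have "mu (return_pmf []) (streams {[] :: 'a list}) = 1"
        using measure_bernoulli_cylinder[of "return_pmf []" "{[] :: 'a list}" "[]"] by (simp add: V prob_on_def)
      finally show "mu p ?A < (1 / 2) ^ m"
        using C m by (auto simp: martin_lof_test_def intro: le_less_trans)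
    qed
    then obtain m where "1 \<le> m" "\<forall>l. (m, stake l (scons X Y)) \<notin> C"
      by (auto simp only: E_def st[OF Y] fst_conv snd_conv)
    then show "\<exists>m\<ge>1. scons X Y \<notin> cylinder (set_Cons \<Omega> {[]}) (section_at C m)"
      by (auto simp: cylinder_def)
  qed
  then show ?thesis by (simp add: Y_def row_stream_Cons)
qed

text \<open>
  The code of the first component of a row.  The first component itself would have to be computed on
  the empty row as well.
\<close>

definition code_hd :: "'a::encodable list \<Rightarrow> nat" where
  "code_hd r = (case r of [] \<Rightarrow> 0 | a # _ \<Rightarrow> encode a)"

lemma primrec_code_hd [pr]: "primrec_in orc f \<Longrightarrow> primrec_in orc (\<lambda>x. code_hd (f x))"
  unfolding code_hd_def by (intro pr)

lemma map_code_hd_stake_scons: "map code_hd (stake l (scons X Y)) = map encode (stake l X)"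
  by (rule nth_equalityI) (auto simp: code_hd_def)

text \<open>
  \<open>A m \<tau> t\<close> lists the codes of the strings that the machine, with \<open>\<tau>\<close> as oracle, puts into level
  \<open>m\<close> of its test within \<open>t\<close> stages, and \<open>T Y m t\<close> are these strings when \<open>\<tau>\<close> is a prefix of
  \<open>Y\<close>.  A stage counts only if \<open>Less\<close> confirms that its weight is below \<open>2\<^sup>-\<^sup>m\<close>.  The stages increase
  with \<open>t\<close>, so every finite part of the union \<open>S Y m\<close> of the confirmed stages lies in one of them, and
  \<open>S Y m\<close> has measure at most \<open>2\<^sup>-\<^sup>m\<close>.  Passing from \<open>m\<close> to \<open>Suc m\<close> makes the bound strict.
\<close>

lemma independent_imp_random_rel:
  fixes \<Omega> :: "'a::encodable set" and \<beta>s :: "'a stream list"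
  assumes rand: "martin_lof_random (set_Cons \<Omega> R) (cons_pmf p q) (scons X (row_stream \<beta>s))"
    and \<Omega>: "rec_enum \<Omega>" and R: "rec_enum (set_Cons \<Omega> R)"
    and p: "p \<in> prob_on \<Omega>" and comp: "computable_prob \<Omega> p"
  shows "martin_lof_random_rel \<beta>s \<Omega> p X"
  unfolding martin_lof_random_rel_def
proof (intro conjI allI impI)
  let ?w = "length \<beta>s" and ?Y = "row_stream \<beta>s"
  let ?str = "\<lambda>\<sigma>. prod_list (map (pmf p) \<sigma>)"
  show X: "X \<in> streams \<Omega>" using rand by (simp add: martin_lof_random_def scons_in_streams)
  fix C assume C: "martin_lof_test_rel \<beta>s \<Omega> p C"
  then obtain M where M: "oracle_TM M" and CM: "C = {x \<in> {1..} \<times> lists \<Omega>. accepts (oracle_of \<beta>s) M (encode x)}"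
    by (auto simp: martin_lof_test_rel_def)
  have C_pf: "prefix_free (section_at C m)"
    and C_small: "mu p (cylinder \<Omega> (section_at C m)) < (1 / 2) ^ m"
    if "1 \<le> m" for m
    using C that unfolding martin_lof_test_rel_def by blast+
  obtain Less :: "nat list \<times> nat \<Rightarrow> bool" where
    Less: "re0 Less"
      "\<And>L m. L \<in> lists (lists \<Omega>) \<Longrightarrow> Less (map encode L, m) \<longleftrightarrow>
          (\<Sum>\<sigma>\<leftarrow>L. ?str \<sigma>) < (1 / 2) ^ m"
    by (rule computable_prob_sums[OF comp]) blast
  define acc where "acc x \<longleftrightarrow> snd (fst x) \<in> encode ` lists \<Omega> \<and>
      accepts (rows_oracle ?w (snd x)) M (encode (fst x))" for x :: "(nat \<times> nat) \<times> 'a list list"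
  have "re0 acc"
  proof -
    have "re0 (\<lambda>n. n \<in> encode ` lists \<Omega>)" using rec_enum_lists[OF \<Omega>] by (simp only: rec_enum_iff)
    then have "re0 (\<lambda>x :: (nat \<times> nat) \<times> 'a list list. snd (fst x) \<in> encode ` lists \<Omega>)"
      by (rule re_comp) (intro pr)
    moreover have "re0 (\<lambda>x :: (nat \<times> nat) \<times> 'a list list.
        accepts (rows_oracle ?w (fst (snd x, encode (fst x)))) M (snd (snd x, encode (fst x))))"
      by (rule re_comp[OF re_accepts_rows[OF M]]) (intro pr)
    ultimately show ?thesis unfolding acc_def[abs_def] by (intro re_conj) simp_all
  qed
  then obtain f where f: "primrec0 f" "\<And>x. acc x \<longleftrightarrow> (\<exists>u::nat. f (x, u))"
    unfolding re_in_def by blast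
  define A where "A m \<tau> t = filter (\<lambda>s. \<exists>l<Suc t. \<exists>u<Suc t. f (((m, s), take l \<tau>), u)) [0..<t]" for m \<tau> t
  have A: "primrec0 (\<lambda>x. A (a x) (b x) (c x))"
    if "primrec0 a" "primrec0 b" "primrec0 c" for a b and c :: "'z::encodable \<Rightarrow> nat"
    unfolding A_def by (intro pr primrec_comp[OF f(1)] that primrec_comp[OF that(1)] primrec_comp[OF that(2)] primrec_comp[OF that(3)])
  define E where "E x \<longleftrightarrow> (\<exists>t<Suc (length (snd x)). Less (A (Suc (fst x)) (map tl (take t (snd x))) t, Suc (fst x)) \<and>
     (\<exists>s\<in>set (A (Suc (fst x)) (map tl (take t (snd x))) t).
        length (list_decode s) \<le> length (snd x) \<and> s = encode (take (length (list_decode s)) (map code_hd (snd x)))))"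
    for x :: "nat \<times> 'a list list"
  have E: "re0 E"
    unfolding E_def[abs_def]
    by (intro re_ex_less re_conj re_comp[OF Less(1)] re_primrec primrec_bex_set A pr)
  define T where "T Y m t = {\<sigma> :: 'a list. encode \<sigma> \<in> set (A m (stake t Y) t)}" for Y m t
  have A_iff: "s \<in> set (A m (stake t Y) t) \<longleftrightarrow> s < t \<and> (\<exists>l\<le>t. \<exists>u\<le>t. f (((m, s), stake l Y), u))" for s m t Y
    by (auto simp: A_def less_Suc_eq_le take_stake min_def)
  have T_lists: "T Y m t \<subseteq> lists \<Omega>" for Y m t
  proof
    fix \<sigma> assume "\<sigma> \<in> T Y m t"
    then obtain l u where "f (((m, encode \<sigma>), stake l Y), u)" by (auto simp: T_def A_iff)
    then have "acc ((m, encode \<sigma>), stake l Y)" using f(2) by blast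
    then show "\<sigma> \<in> lists \<Omega>" by (auto simp: acc_def inj_image_mem_iff[OF inj_encode])
  qed
  have T_mono: "T Y m t \<subseteq> T Y m t'" if "t \<le> t'" for Y m t t'
    unfolding T_def A_iff using that by clarsimp (meson le_trans less_le_trans)
  have T: "finite (T Y m t)" "Less (A m (stake t Y) t, j) \<longleftrightarrow> (\<Sum>\<sigma>\<in>T Y m t. ?str \<sigma>) < (1 / 2) ^ j"
      "s \<in> set (A m (stake t Y) t) \<Longrightarrow> s \<in> encode ` T Y m t" for Y m t s j
  proof -
    let ?L = "A m (stake t Y) t"
    have "set ?L \<subseteq> encode ` lists \<Omega>"
    proof
      fix s assume "s \<in> set ?L"
      then obtain l u where "f (((m, s), stake l Y), u)" by (auto simp: A_iff)
      then have "acc ((m, s), stake l Y)" using f(2) by blast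
      then show "s \<in> encode ` lists \<Omega>" by (simp add: acc_def)
    qed
    moreover have "distinct ?L" by (simp add: A_def)
    ultimately obtain \<sigma>s where \<sigma>s: "?L = map encode \<sigma>s" "set \<sigma>s \<subseteq> lists \<Omega>" "distinct \<sigma>s"
      using sum_list_distinct_image by blast
    have set: "set \<sigma>s = T Y m t" unfolding T_def \<sigma>s(1) by (auto simp: inj_image_mem_iff[OF inj_encode])
    then show "finite (T Y m t)" by (metis List.finite_set)
    have "\<sigma>s \<in> lists (lists \<Omega>)" using \<sigma>s(2) by auto
    then show "Less (?L, j) \<longleftrightarrow> (\<Sum>\<sigma>\<in>T Y m t. ?str \<sigma>) < (1 / 2) ^ j"
      unfolding \<sigma>s(1) using Less(2) \<sigma>s(3) by (simp add: sum_list_distinct_conv_sum_set flip: set)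
    show "s \<in> encode ` T Y m t" if "s \<in> set ?L" using that by (simp add: \<sigma>s(1) flip: set)
  qed
  define S where "S Y m = (\<Union>t\<in>{t. (\<Sum>\<sigma>\<in>T Y m t. ?str \<sigma>) < (1 / 2) ^ m}. T Y m t)" for Y m
  have S_lists: "S Y m \<subseteq> lists \<Omega>" for Y m unfolding S_def using T_lists by blast
  have str_nonneg: "0 \<le> ?str \<sigma>" for \<sigma> by (induction \<sigma>) auto
  have S_measure: "mu p (cylinder \<Omega> (S Y m)) \<le> (1 / 2) ^ m" for Y m
  proof (rule measure_cylinder_le[OF p S_lists])
    fix F assume F: "finite F" "F \<subseteq> S Y m"
    have "F = {} \<or> (\<exists>t. (\<Sum>\<sigma>\<in>T Y m t. ?str \<sigma>) < (1 / 2) ^ m \<and> F \<subseteq> T Y m t)"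
      using F
    proof (induction F)
      case (insert \<sigma> F)
      then obtain t where t: "(\<Sum>\<sigma>\<in>T Y m t. ?str \<sigma>) < (1 / 2) ^ m" "\<sigma> \<in> T Y m t" by (auto simp: S_def)
      show ?case
      proof (cases "F = {}")
        case True
        then show ?thesis using t by auto
      next
        case False
        then obtain t' where t': "(\<Sum>\<sigma>\<in>T Y m t'. ?str \<sigma>) < (1 / 2) ^ m" "F \<subseteq> T Y m t'" using insert by auto
        have "insert \<sigma> F \<subseteq> T Y m (max t t')"
          using t(2) t'(2) T_mono[of t "max t t'" Y m] T_mono[of t' "max t t'" Y m] by auto
        moreover have "(\<Sum>\<sigma>\<in>T Y m (max t t'). ?str \<sigma>) < (1 / 2) ^ m" using t(1) t'(1) by (simp add: max_def)
        ultimately show ?thesis by blast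
      qed
    qed simp
    then show "(\<Sum>\<sigma>\<in>F. ?str \<sigma>) \<le> (1 / 2) ^ m"
    proof
      assume "\<exists>t. (\<Sum>\<sigma>\<in>T Y m t. ?str \<sigma>) < (1 / 2) ^ m \<and> F \<subseteq> T Y m t"
      then obtain t where t: "(\<Sum>\<sigma>\<in>T Y m t. ?str \<sigma>) < (1 / 2) ^ m" "F \<subseteq> T Y m t" by blast
      have "(\<Sum>\<sigma>\<in>F. ?str \<sigma>) \<le> (\<Sum>\<sigma>\<in>T Y m t. ?str \<sigma>)"
        by (rule sum_mono2[OF T(1) t(2)]) (rule str_nonneg)
      with t(1) show ?thesis by simp
    qed simp
  qed
  have E_iff: "E (m, stake n (scons X Y)) \<longleftrightarrow> (\<exists>t\<le>n. (\<Sum>\<sigma>\<in>T Y (Suc m) t. ?str \<sigma>) < (1 / 2) ^ Suc m \<and>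
      (\<exists>\<sigma>\<in>T Y (Suc m) t. length \<sigma> \<le> n \<and> \<sigma> = stake (length \<sigma>) X))" for m n X Y
  proof -
    have "map tl (take t (stake n (scons X Y))) = stake t Y" if "t \<le> n" for t
      using that by (simp add: take_stake map_tl_stake_scons min_absorb1 min_absorb2 del: stake_smap2)
    moreover have "(\<exists>s\<in>set (A (Suc m) (stake t Y) t). length (list_decode s) \<le> n \<and>
        s = encode (take (length (list_decode s)) (map code_hd (stake n (scons X Y))))) \<longleftrightarrow>
        (\<exists>\<sigma>\<in>T Y (Suc m) t. length \<sigma> \<le> n \<and> \<sigma> = stake (length \<sigma>) X)" for t
    proof -
      have *: "encode \<sigma> = encode (take (length \<sigma>) (map encode (stake n X))) \<longleftrightarrow> \<sigma> = stake (length \<sigma>) X"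
        if "length \<sigma> \<le> n" for \<sigma>
        using that by (simp add: take_map take_stake min_absorb1 encode_map_encode inj_eq[OF inj_encode])
      have set: "set (A (Suc m) (stake t Y) t) = encode ` T Y (Suc m) t" using T(3) by (auto simp: T_def)
      have dec: "length (list_decode (encode \<sigma>)) = length \<sigma>" for \<sigma> :: "'a list" by (simp add: encode_list_def)
      show ?thesis
        unfolding set map_code_hd_stake_scons using * by (auto simp: dec)
    qed
    ultimately show ?thesis
      by (simp add: E_def T(2) less_Suc_eq_le cong: conj_cong)
  qed
  show "\<exists>m\<ge>1. X \<notin> cylinder \<Omega> (section_at C m)"
  proof (rule ccontr)
    assume "\<not> (\<exists>m\<ge>1. X \<notin> cylinder \<Omega> (section_at C m))"
    then have XC: "\<And>m. 1 \<le> m \<Longrightarrow> X \<in> cylinder \<Omega> (section_at C m)" by blast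
    have "\<exists>m\<ge>1. \<forall>l. \<not> E (m, stake l (scons X ?Y))"
    proof (rule random_avoids[OF rand R E])
      fix m :: nat assume "1 \<le> m"
      let ?U = "{Z \<in> streams (set_Cons \<Omega> R). \<exists>l. E (m, stake l Z)}"
      interpret prob_space "bernoulli_measure p" by (rule prob_space_bernoulli)
      have "mu (cons_pmf p q) ?U \<le> (1 / 2) ^ Suc m"
      proof (rule measure_le_of_sections[OF sets_open_set])
        fix Y
        have "{X. scons X Y \<in> ?U} \<subseteq> cylinder \<Omega> (S Y (Suc m))"
        proof safe
          fix X l assume X: "scons X Y \<in> streams (set_Cons \<Omega> R)" and "E (m, stake l (scons X Y))"
          then obtain t \<sigma> where "(\<Sum>\<sigma>\<in>T Y (Suc m) t. ?str \<sigma>) < (1 / 2) ^ Suc m" "\<sigma> \<in> T Y (Suc m) t"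
            "\<sigma> = stake (length \<sigma>) X" unfolding E_iff by blast
          then have "stake (length \<sigma>) X \<in> S Y (Suc m)" unfolding S_def by auto
          then show "X \<in> cylinder \<Omega> (S Y (Suc m))"
            using X by (auto simp: cylinder_def scons_in_streams)
        qed
        then have "mu p {X. scons X Y \<in> ?U} \<le> mu p (cylinder \<Omega> (S Y (Suc m)))"
          by (intro finite_measure_mono sets_cylinder S_lists)
        also have "\<dots> \<le> (1 / 2) ^ Suc m" by (rule S_measure)
        finally show "mu p {X. scons X Y \<in> ?U} \<le> (1 / 2) ^ Suc m" .
      qed
      also have "\<dots> < (1 / 2) ^ m" by simp
      finally show "mu (cons_pmf p q) ?U < (1 / 2) ^ m" .
    qed
    then obtain m where "m \<ge> 1" and m: "\<And>l. \<not> E (m, stake l (scons X ?Y))" by blast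
    obtain n where n: "(Suc m, stake n X) \<in> C" using XC[of "Suc m"] by (auto simp: cylinder_def)
    let ?s = "encode (stake n X)"
    have enc: "encode (k, encode \<sigma>) = encode (k, \<sigma>)" for k and \<sigma> :: "'a list" by (simp add: encode_prod_def encode_nat_def)
    have "accepts (oracle_of \<beta>s) M (encode (Suc m, stake n X))" "stake n X \<in> lists \<Omega>" using n CM by auto
    then obtain l where "acc ((Suc m, ?s), stake l ?Y)"
      unfolding accepts_use by (auto simp: acc_def enc)
    then obtain u where u: "f (((Suc m, ?s), stake l ?Y), u)" using f(2) by blast
    \<comment> \<open>late enough for the string, the prefix of the oracle and the witness to be considered\<close>
    define t where "t = Suc (l + u + ?s)"
    have "?s \<in> set (A (Suc m) (stake t ?Y) t)"
      unfolding A_iff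
    proof (intro conjI exI)
      show "f (((Suc m, ?s), stake l ?Y), u)" by (rule u)
    qed (simp_all add: t_def)
    then have sT: "stake n X \<in> T ?Y (Suc m) t" by (simp add: T_def)
    have TC: "T ?Y (Suc m) t \<subseteq> section_at C (Suc m)"
    proof
      fix \<sigma> assume \<sigma>: "\<sigma> \<in> T ?Y (Suc m) t"
      then obtain l u where "f (((Suc m, encode \<sigma>), stake l ?Y), u)" by (auto simp: T_def A_iff)
      then have "acc ((Suc m, encode \<sigma>), stake l ?Y)" using f(2) by blast
      then have "accepts (oracle_of \<beta>s) M (encode (Suc m, \<sigma>))"
        unfolding accepts_use by (auto simp: acc_def enc)
      moreover have "\<sigma> \<in> lists \<Omega>" using T_lists \<sigma> by blast
      ultimately show "\<sigma> \<in> section_at C (Suc m)" by (simp add: CM)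
    qed
    have "prefix_free (T ?Y (Suc m) t)"
      by (rule prefix_free_subset[OF C_pf TC]) simp
    then have "(\<Sum>\<sigma>\<in>T ?Y (Suc m) t. ?str \<sigma>) = mu p (cylinder \<Omega> (T ?Y (Suc m) t))"
      using measure_cylinder_finite[OF p T(1) T_lists] by simp
    also have "\<dots> \<le> mu p (cylinder \<Omega> (section_at C (Suc m)))"
    proof -
      interpret prob_space "bernoulli_measure p" by (rule prob_space_bernoulli)
      show ?thesis by (intro finite_measure_mono cylinder_mono TC sets_cylinder) (auto simp: CM)
    qed
    also have "\<dots> < (1 / 2) ^ Suc m" by (rule C_small) simp
    finally have "E (m, stake (max t n) (scons X ?Y))"
      unfolding E_iff using sT by (intro exI[of _ t] conjI bexI[of _ "stake n X"]) auto
    then show False using m by blast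
  qed
qed

definition zip_codes :: "nat list \<Rightarrow> nat list list \<Rightarrow> nat list list" where
  "zip_codes \<sigma> \<tau> = map2 (#) \<sigma> \<tau>"

lemma primrec_zip_codes [pr]:
  assumes "primrec_in orc f" "primrec_in orc g"
  shows "primrec_in orc (\<lambda>x. zip_codes (f x) (g x))"
proof -
  have "zip_codes \<sigma> \<tau> = map (\<lambda>i. nth_or 0 \<sigma> i # nth_or [] \<tau> i) [0..<min (length \<sigma>) (length \<tau>)]" for \<sigma> \<tau>
    by (rule nth_equalityI) (auto simp: zip_codes_def nth_or_nth)
  moreover have "primrec_in orc (\<lambda>x. map (\<lambda>i. nth_or 0 (f x) i # nth_or [] (g x) i) [0..<min (length (f x)) (length (g x))])"
    by (intro pr assms primrec_comp[OF assms(1)] primrec_comp[OF assms(2)])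
  ultimately show ?thesis by simp
qed

lemma primrec_distinct [pr]:
  fixes f :: "'a::encodable \<Rightarrow> nat list"
  assumes "primrec_in orc f"
  shows "primrec_in orc (\<lambda>x. distinct (f x))"
proof -
  have "distinct l \<longleftrightarrow> (\<forall>i<length l. \<forall>j<i. nth_or 0 l i \<noteq> nth_or 0 l j)" for l :: "nat list"
    unfolding distinct_conv_nth by (auto simp: nth_or_nth) (metis linorder_neqE_nat nth_or_nth)
  moreover have "primrec_in orc (\<lambda>x. \<forall>i<length (f x). \<forall>j<i. nth_or 0 (f x) i \<noteq> nth_or 0 (f x) j)"
    by (intro pr assms primrec_comp[OF assms])
  ultimately show ?thesis by simp
qed

lemma encode_zip_codes:
  "encode (zip_codes (map encode \<sigma>) (map (\<lambda>r. map encode r) \<tau>)) = encode (map2 (#) \<sigma> \<tau>)"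
proof -
  have "zip_codes (map encode \<sigma>) (map (\<lambda>r. map encode r) \<tau>) = map (map encode) (map2 (#) \<sigma> \<tau>)"
    by (rule nth_equalityI) (auto simp: zip_codes_def)
  moreover have "encode (map (map encode) l) = encode l" for l :: "'a list list"
    by (simp add: encode_list_def[of l] encode_list_def[of "map (map encode) l"] encode_map_encode comp_def)
  ultimately show ?thesis by (simp only:)
qed

text \<open>
  \<open>F Y m\<close> consists of the strings whose cylinders make up the section at \<open>Y\<close> of level \<open>m\<close> of the
  test \<open>C\<close>.  \<open>W\<close> searches for a finite part of \<open>F Y (2 * m + 1)\<close> of weight above \<open>2\<^sup>-\<^sup>m\<close>; the
  sequences \<open>Y\<close> for which there is one form the set \<open>V m\<close>, of measure at most
  \<open>2\<^sup>-\<^sup>2\<^sup>m\<^sup>-\<^sup>1 / 2\<^sup>-\<^sup>m =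
      2\<^sup>-\<^sup>m\<^sup>-\<^sup>1\<close>.  Summed over all indices above \<open>j\<close> this is at most
          \<open>2\<^sup>-\<^sup>j\<^sup>-\<^sup>1\<close>, so that the
  unions of these sets are a test.
\<close>

lemma random_rel_imp_independent:
  fixes \<Omega> :: "'a::encodable set" and \<beta>s :: "'a stream list"
  assumes rel: "martin_lof_random_rel \<beta>s \<Omega> p X" and randY: "martin_lof_random R q (row_stream \<beta>s)"
    and \<Omega>: "rec_enum \<Omega>" and R: "rec_enum R"
    and p: "p \<in> prob_on \<Omega>" and comp: "computable_prob \<Omega> p"
  shows "martin_lof_random (set_Cons \<Omega> R) (cons_pmf p q) (scons X (row_stream \<beta>s))"
  unfolding martin_lof_random_def
proof (intro conjI allI impI)
  let ?Y = "row_stream \<beta>s"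
  let ?str = "\<lambda>\<sigma>. prod_list (map (pmf p) \<sigma>)"
  have X: "X \<in> streams \<Omega>" and Y: "?Y \<in> streams R"
    using rel randY by (auto simp: martin_lof_random_rel_def martin_lof_random_def)
  show XY: "scons X ?Y \<in> streams (set_Cons \<Omega> R)" using X Y by (simp add: scons_in_streams)
  fix C assume C: "martin_lof_test (set_Cons \<Omega> R) (cons_pmf p q) C"
  have CR: "section_at C m \<subseteq> lists (set_Cons \<Omega> R)" for m using C by (auto simp: martin_lof_test_def)
  have C_pf: "prefix_free (section_at C m)" and C_small: "mu (cons_pmf p q) (cylinder (set_Cons \<Omega> R) (section_at C m)) < (1 / 2) ^ m"
    if "1 \<le> m" for m using C that by (auto simp: martin_lof_test_def)
  obtain Greater :: "nat list \<times> nat \<Rightarrow> bool" where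
    Greater: "re0 Greater"
      "\<And>L m. L \<in> lists (lists \<Omega>) \<Longrightarrow> Greater (map encode L, m) \<longleftrightarrow>
          (1 / 2) ^ m < (\<Sum>\<sigma>\<leftarrow>L. ?str \<sigma>)"
    by (rule computable_prob_sums[OF comp]) blast
  have Ccode: "re0 (\<lambda>n. n \<in> encode ` C)" using C by (simp add: martin_lof_test_def rec_enum_iff)
  have code_iff: "encode (m, zip_codes (map encode \<sigma>) (map (\<lambda>r. map encode r) \<tau>)) \<in> encode ` C
      \<longleftrightarrow> (m, map2 (#) \<sigma> \<tau>) \<in> C"
    for m \<sigma> and \<tau> :: "'a list list"
  proof -
    have "encode (m, zip_codes (map encode \<sigma>) (map (\<lambda>r. map encode r) \<tau>)) = encode (m, map2 (#) \<sigma> \<tau>)"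
      by (simp add: encode_prod_def encode_zip_codes)
    then show ?thesis by (simp add: inj_image_mem_iff[OF inj_encode])
  qed
  define F where "F Y m = {\<sigma> \<in> lists \<Omega>. (m, map2 (#) \<sigma> (stake (length \<sigma>) Y)) \<in> C}" for Y m
  have F_lists: "F Y m \<subseteq> lists \<Omega>" for Y m by (auto simp: F_def)
  have F_pf: "prefix_free (F Y m)" if "1 \<le> m" for Y m
    unfolding prefix_free_def
  proof (intro ballI notI)
    fix \<sigma> \<tau> assume *: "\<sigma> \<in> F Y m" "\<tau> \<in> F Y m" "strict_prefix \<sigma> \<tau>"
    then obtain \<rho> where \<rho>: "\<tau> = \<sigma> @ \<rho>" "\<rho> \<noteq> []" by (auto simp: strict_prefix_def prefix_def)
    have "map2 (#) \<tau> (stake (length \<tau>) Y) = map2 (#) \<sigma> (stake (length \<sigma>) Y) @ map2 (#) \<rho> (stake (length \<rho>) (sdrop (length \<sigma>) Y))"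
      by (simp add: \<rho>(1) flip: stake_add)
    then have "strict_prefix (map2 (#) \<sigma> (stake (length \<sigma>) Y)) (map2 (#) \<tau> (stake (length \<tau>) Y))"
      using \<rho>(2) by (simp add: strict_prefix_def)
    then show False using C_pf[OF that] * by (auto simp: F_def prefix_free_def)
  qed
  have cyl_F: "scons X Y \<in> cylinder (set_Cons \<Omega> R) (section_at C m) \<longleftrightarrow> X \<in> cylinder \<Omega> (F Y m) \<and> Y \<in> streams R" for X Y m
  proof -
    have "stake n X \<in> lists \<Omega>" if "X \<in> streams \<Omega>" for n
      using that by (auto simp: in_lists_conv_set in_set_conv_nth snth_in)
    then show ?thesis by (auto simp: cylinder_def F_def scons_in_streams simp del: stake_smap2 simp flip: stake_scons)
  qed
  define W where "W x \<longleftrightarrow> (\<exists>L. distinct L \<and> (\<forall>s\<in>set L. length (list_decode s) \<le> length (snd x) \<and>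
       encode (Suc (2 * fst x), zip_codes (list_decode s) (map (\<lambda>r. map encode r) (take (length (list_decode s)) (snd x)))) \<in> encode ` C \<and>
       s \<in> encode ` lists \<Omega>) \<and> Greater (L, fst x))" for x :: "nat \<times> 'a list list"
  have W_re: "re0 W"
  proof -
    have l: "re0 (\<lambda>n. n \<in> encode ` lists \<Omega>)" using rec_enum_lists[OF \<Omega>] by (simp only: rec_enum_iff)
    show ?thesis
      unfolding W_def[abs_def]
      by (intro re_ex_surj surj_encode_list surj_encode_nat re_conj re_ball_set re_comp[OF Greater(1)] re_comp[OF Ccode] re_comp[OF l]
          re_primrec[OF primrec_distinct] re_primrec[OF primrec_le] pr)
  qed
  have W_iff: "W (m, stake l Y) \<longleftrightarrow> (\<exists>G. finite G \<and> G \<subseteq> F Y (Suc (2 * m)) \<and>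
      (\<forall>\<sigma>\<in>G. length \<sigma> \<le> l) \<and> (1 / 2) ^ m < (\<Sum>\<sigma>\<in>G. ?str \<sigma>))"
    for m l Y
  proof
    assume "W (m, stake l Y)"
    then obtain L where L: "distinct L" "set L \<subseteq> encode ` lists \<Omega>" "Greater (L, m)"
      and LC: "\<And>s. s \<in> set L \<Longrightarrow> length (list_decode s) \<le> l \<and>
          encode (Suc (2 * m), zip_codes (list_decode s) (map (\<lambda>r. map encode r) (take (length (list_decode s)) (stake l Y)))) \<in> encode ` C"
      unfolding W_def by auto
    obtain \<sigma>s where \<sigma>s: "L = map encode \<sigma>s" "set \<sigma>s \<subseteq> lists \<Omega>" "distinct \<sigma>s"
      using sum_list_distinct_image[OF L(1,2)] by blast
    have ll: "\<sigma>s \<in> lists (lists \<Omega>)" using \<sigma>s(2) by auto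
    have "length \<sigma> \<le> l \<and> \<sigma> \<in> F Y (Suc (2 * m))" if "\<sigma> \<in> set \<sigma>s" for \<sigma>
    proof -
      have d: "list_decode (encode \<sigma>) = map encode \<sigma>" by (simp add: encode_list_def)
      have "encode \<sigma> \<in> set L" using that \<sigma>s(1) by auto
      from LC[OF this] have "length \<sigma> \<le> l" "(Suc (2 * m), map2 (#) \<sigma> (take (length \<sigma>) (stake l Y))) \<in> C"
        unfolding d code_iff by simp_all
      then show ?thesis using \<sigma>s(2) that by (auto simp: F_def take_stake min_absorb1)
    qed
    moreover have "(1 / 2) ^ m < (\<Sum>\<sigma>\<in>set \<sigma>s. ?str \<sigma>)"
      using Greater(2)[OF ll, of m] L(3) \<sigma>s(1,3) by (simp add: sum_list_distinct_conv_sum_set)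
    ultimately show "\<exists>G. finite G \<and> G \<subseteq> F Y (Suc (2 * m)) \<and>
        (\<forall>\<sigma>\<in>G. length \<sigma> \<le> l) \<and> (1 / 2) ^ m < (\<Sum>\<sigma>\<in>G. ?str \<sigma>)"
      by (intro exI[of _ "set \<sigma>s"]) auto
  next
    assume "\<exists>G. finite G \<and> G \<subseteq> F Y (Suc (2 * m)) \<and> (\<forall>\<sigma>\<in>G. length \<sigma> \<le> l) \<and>
        (1 / 2) ^ m < (\<Sum>\<sigma>\<in>G. ?str \<sigma>)"
    then obtain G where G: "finite G" "G \<subseteq> F Y (Suc (2 * m))" "\<forall>\<sigma>\<in>G. length \<sigma> \<le>
        l" "(1 / 2) ^ m < (\<Sum>\<sigma>\<in>G. ?str \<sigma>)" by blast
    obtain \<sigma>s where \<sigma>s: "set \<sigma>s = G" "distinct \<sigma>s" using finite_distinct_list[OF G(1)] by blast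
    have ll: "\<sigma>s \<in> lists (lists \<Omega>)" using \<sigma>s(1) G(2) F_lists by blast
    show "W (m, stake l Y)"
      unfolding W_def fst_conv snd_conv
    proof (intro exI[of _ "map encode \<sigma>s"] conjI ballI)
      show "distinct (map encode \<sigma>s)" using \<sigma>s(2) by (simp add: distinct_map inj_on_subset[OF inj_encode])
      show "Greater (map encode \<sigma>s, m)" using Greater(2)[OF ll, of m] G(4) \<sigma>s by (simp add: sum_list_distinct_conv_sum_set)
      fix s assume "s \<in> set (map encode \<sigma>s)"
      then obtain \<sigma> where \<sigma>: "\<sigma> \<in> G" "s = encode \<sigma>" using \<sigma>s(1) by auto
      have d: "list_decode s = map encode \<sigma>" by (simp add: \<sigma>(2) encode_list_def)
      show "s \<in> encode ` lists \<Omega>" using \<sigma> G(2) F_lists by blast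
      show "length (list_decode s) \<le> length (stake l Y)" using G(3) \<sigma>(1) by (simp add: d)
      have "(Suc (2 * m), map2 (#) \<sigma> (take (length \<sigma>) (stake l Y))) \<in> C"
        using G(2,3) \<sigma>(1) by (auto simp: F_def take_stake min_absorb1)
      then show "encode (Suc (2 * m), zip_codes (list_decode s) (map (\<lambda>r. map encode r) (take (length (list_decode s)) (stake l Y)))) \<in> encode ` C"
        unfolding d length_map code_iff .
    qed
  qed
  define V where "V m = {Y \<in> streams R. \<exists>l. W (m, stake l Y)}" for m
  have V_sets: "V m \<in> sets (bernoulli_measure q)" for m unfolding V_def sets_bernoulli by (rule sets_open_set)
  have V_measure: "mu q (V m) \<le> (1 / 2) ^ Suc m" for m
  proof -
    let ?U = "cylinder (set_Cons \<Omega> R) (section_at C (Suc (2 * m)))"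
    have U: "?U \<in> stream_events"
      using sets_cylinder[OF CR, of "Suc (2 * m)" "cons_pmf p q"] by (simp add: sets_bernoulli)
    have "(1 / 2) ^ m * mu q (V m) \<le> mu (cons_pmf p q) ?U"
    proof (rule measure_large_sections[OF U])
      show "V m \<in> stream_events" using V_sets by (simp add: sets_bernoulli)
      fix Y assume "Y \<in> V m"
      then obtain l G where Y: "Y \<in> streams R" and G: "finite G" "G \<subseteq> F Y (Suc (2 * m))" "(1 / 2) ^ m < (\<Sum>\<sigma>\<in>G. ?str \<sigma>)"
        unfolding V_def W_iff by blast
      interpret prob_space "bernoulli_measure p" by (rule prob_space_bernoulli)
      have "prefix_free G" by (rule prefix_free_subset[OF F_pf G(2)]) simp
      then have "(\<Sum>\<sigma>\<in>G. ?str \<sigma>) = mu p (cylinder \<Omega> G)"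
        using measure_cylinder_finite[OF p G(1)] G(2) F_lists by (metis subset_trans)
      also have "\<dots> \<le> mu p {X. scons X Y \<in> ?U}"
        using cylinder_mono[OF G(2)] Y by (intro finite_measure_mono sets_section[OF U]) (auto simp: cyl_F)
      finally show "(1 / 2) ^ m \<le> mu p {X. scons X Y \<in> ?U}" using G(3) by simp
    qed simp
    also have "\<dots> \<le> (1 / 2) ^ Suc (2 * m)" using C_small[of "Suc (2 * m)"] by simp
    also have "\<dots> = (1 / 2) ^ m * (1 / 2) ^ Suc m" by (simp flip: power_add add: mult_2)
    finally show ?thesis by (simp del: power_Suc)
  qed
  define E where "E x \<longleftrightarrow> (\<exists>i. W (Suc (fst x + i), snd x))" for x :: "nat \<times> 'a list list"
  have E: "re0 E"
    unfolding E_def[abs_def] by (intro re_ex_nat re_comp[OF W_re] pr)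
  have "\<exists>j\<ge>1. \<forall>l. \<not> E (j, stake l ?Y)"
  proof (rule random_avoids[OF randY R E])
    fix j :: nat
    interpret prob_space "bernoulli_measure q" by (rule prob_space_bernoulli)
    have eq: "{Y \<in> streams R. \<exists>l. E (j, stake l Y)} = (\<Union>i. V (Suc (j + i)))"
      by (auto simp: E_def V_def)
    \<comment> \<open>the indices above \<open>j\<close> are \<open>Suc (j + i)\<close>,
        each with bound \<open>2\<^sup>-\<^sup>(\<^sup>j\<^sup>+\<^sup>i\<^sup>+\<^sup>2\<^sup>)\<close>\<close>
    have geo: "(\<lambda>i. (1 / 2 :: real) ^ Suc (Suc (j + i))) sums (1 / 2) ^ Suc j"
    proof -
      have "(\<lambda>i. (1 / 2 :: real) ^ Suc (Suc j) * (1 / 2) ^ i) sums ((1 / 2) ^ Suc (Suc j) * (1 / (1 - 1 / 2)))"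
        by (intro sums_mult geometric_sums) simp
      then show ?thesis by (simp add: power_add)
    qed
    have sm: "summable (\<lambda>i. mu q (V (Suc (j + i))))"
      by (rule summable_comparison_test'[OF sums_summable[OF geo], of 0]) (use V_measure[of "Suc (j + _)"] in simp)
    have "mu q (\<Union>i. V (Suc (j + i))) \<le> (\<Sum>i. mu q (V (Suc (j + i))))"
      using V_sets by (intro finite_measure_subadditive_countably sm) auto
    also have "\<dots> \<le> (\<Sum>i. (1 / 2 :: real) ^ Suc (Suc (j + i)))"
      by (intro suminf_le sm sums_summable[OF geo] V_measure)
    also have "\<dots> = (1 / 2) ^ Suc j" using geo by (rule sums_unique[symmetric])
    also have "\<dots> < (1 / 2) ^ j" by simp
    finally show "mu q {Y \<in> streams R. \<exists>l. E (j, stake l Y)} < (1 / 2) ^ j"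
      unfolding eq .
  qed
  then obtain j where noE: "\<And>l. \<not> E (j, stake l ?Y)" by blast
  have F_measure: "mu p (cylinder \<Omega> (F ?Y (Suc (2 * Suc (j + i))))) \<le> (1 / 2) ^ Suc (j + i)" for i
  proof (rule measure_cylinder_le[OF p F_lists])
    fix G assume G: "finite G" "G \<subseteq> F ?Y (Suc (2 * Suc (j + i)))"
    \<comment> \<open>the \<open>0\<close> keeps the maximum defined for empty \<open>G\<close>\<close>
    define l where "l = Max (insert 0 (length ` G))"
    have "\<forall>\<sigma>\<in>G. length \<sigma> \<le> l" unfolding l_def using G(1) by (intro ballI Max_ge) auto
    moreover have "\<not> W (Suc (j + i), stake l ?Y)" using noE[of l] by (auto simp: E_def)
    ultimately show "(\<Sum>\<sigma>\<in>G. ?str \<sigma>) \<le> (1 / 2) ^ Suc (j + i)"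
      using G unfolding W_iff by (meson not_le)
  qed
  define D where "D x \<longleftrightarrow> encode (Suc (2 * Suc (j + fst x)),
      zip_codes (map encode (snd x)) (map (\<lambda>r. map encode r) (stake (length (snd x)) ?Y))) \<in> encode ` C"
    for x :: "nat \<times> 'a list"
  have D_iff: "D (m, \<sigma>) \<longleftrightarrow> (Suc (2 * Suc (j + m)), map2 (#) \<sigma> (stake (length \<sigma>) ?Y)) \<in> C" for m \<sigma>
    unfolding D_def fst_conv snd_conv by (rule code_iff)
  have D: "re_in (oracle_of \<beta>s) D"
    unfolding D_def[abs_def] by (intro re_comp[OF re_in_mono[OF Ccode]] primrec_encode primrec_Pair primrec_zip_codes primrec_map primrec_oracle_stake pr)
  have "\<exists>m\<ge>1. \<forall>l. \<not> D (m, stake l X)"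
  proof (rule random_rel_avoids[OF rel \<Omega> D])
    fix m :: nat
    have "{\<alpha> \<in> streams \<Omega>. \<exists>l. D (m, stake l \<alpha>)} = cylinder \<Omega> (F ?Y (Suc (2 * Suc (j + m))))"
      unfolding open_set_eq_cylinder[of \<Omega> "\<lambda>\<sigma>. D (m, \<sigma>)"] by (simp add: D_iff F_def)
    then have "mu p {\<alpha> \<in> streams \<Omega>. \<exists>l. D (m, stake l \<alpha>)} \<le> (1 / 2) ^ Suc (j + m)"
      using F_measure by simp
    also have "\<dots> < (1 / 2) ^ m" by (rule power_strict_decreasing) auto
    finally show "mu p {\<alpha> \<in> streams \<Omega>. \<exists>l. D (m, stake l \<alpha>)} < (1 / 2) ^ m" .
  qed
  then obtain m where "\<And>l. \<not> D (m, stake l X)" by blast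
  then have "(Suc (2 * Suc (j + m)), stake l (scons X ?Y)) \<notin> C" for l
    by (simp add: D_iff stake_scons)
  then show "\<exists>m\<ge>1. scons X ?Y \<notin> cylinder (set_Cons \<Omega> R) (section_at C m)"
    by (intro exI[of _ "Suc (2 * Suc (j + m))"]) (auto simp: cylinder_def)
qed

definition independent_from :: "nat \<Rightarrow> nat \<Rightarrow> (nat \<Rightarrow> 'a::encodable set) \<Rightarrow> (nat \<Rightarrow>
    'a pmf) \<Rightarrow> (nat \<Rightarrow> 'a stream) \<Rightarrow> bool" where
  "independent_from k n \<Omega> P \<alpha> \<longleftrightarrow>
     martin_lof_random (listset (map \<Omega> [k..<Suc n])) (pmf_listprod (map P [k..<Suc n])) (row_stream (map \<alpha> [k..<Suc n]))"

lemma independent_ensembles_iff: "independent_ensembles n \<Omega> P \<alpha> \<longleftrightarrow> independent_from 1 n \<Omega> P \<alpha>"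
  by (simp add: independent_ensembles_def independent_from_def prod_alphabet_def prod_prob_def prod_seq_def
      row_stream_def comp_def del: upt_Suc)

theorem theorem59:
  fixes n :: nat
    and \<Omega> :: "nat \<Rightarrow> 'a::encodable set"
    and P :: "nat \<Rightarrow> 'a pmf"
    and \<alpha> :: "nat \<Rightarrow> 'a stream"
  assumes "n \<ge> 2"
    and "\<And>i. i \<in> {1..n} \<Longrightarrow> infinite (\<Omega> i) \<and> rec_enum (\<Omega> i)"
    and "\<And>i. i \<in> {1..n} \<Longrightarrow> P i \<in> prob_on (\<Omega> i)"
    and "\<And>i. i \<in> {1..n} \<Longrightarrow> ensemble (\<Omega> i) (P i) (\<alpha> i)"
    and "\<And>i. i \<in> {1..n - 1} \<Longrightarrow> computable_prob (\<Omega> i) (P i)"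
  shows "independent_ensembles n \<Omega> P \<alpha> \<longleftrightarrow>
    (\<forall>k\<in>{1..n - 1}. martin_lof_random_rel (map \<alpha> [Suc k..<Suc n]) (\<Omega> k) (P k) (\<alpha> k))"
proof -
  let ?rel = "\<lambda>k. martin_lof_random_rel (map \<alpha> [Suc k..<Suc n]) (\<Omega> k) (P k) (\<alpha> k)"
  have re: "rec_enum (listset (map \<Omega> [k..<Suc n]))" if "1 \<le> k" for k
    using assms(2) that by (intro rec_enum_listset) (auto simp del: upt_Suc)
  have step: "independent_from k n \<Omega> P \<alpha> \<longleftrightarrow> ?rel k \<and> independent_from (Suc k) n \<Omega> P \<alpha>" if k: "1 \<le> k" "k < n" for k
  proof -
    have upt: "[k..<Suc n] = k # [Suc k..<Suc n]" using k by (simp add: upt_conv_Cons del: upt_Suc)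
    have set: "listset (map \<Omega> [k..<Suc n]) = set_Cons (\<Omega> k) (listset (map \<Omega> [Suc k..<Suc n]))"
      and pmf: "pmf_listprod (map P [k..<Suc n]) = cons_pmf (P k) (pmf_listprod (map P [Suc k..<Suc n]))"
      and seq: "row_stream (map \<alpha> [k..<Suc n]) = scons (\<alpha> k) (row_stream (map \<alpha> [Suc k..<Suc n]))"
      unfolding upt by (simp_all add: cons_pmf_def row_stream_Cons del: upt_Suc)
    have \<Omega>: "rec_enum (\<Omega> k)" and P: "P k \<in> prob_on (\<Omega> k)" and comp: "computable_prob (\<Omega> k) (P k)"
      using assms(2,3,5) k by auto
    have re_k: "rec_enum (set_Cons (\<Omega> k) (listset (map \<Omega> [Suc k..<Suc n])))"
      using re[OF k(1)] unfolding set .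
    show ?thesis
      unfolding independent_from_def set pmf seq
    proof (intro iffI conjI; (elim conjE)?)
      assume ind: "martin_lof_random (set_Cons (\<Omega> k) (listset (map \<Omega> [Suc k..<Suc n])))
        (cons_pmf (P k) (pmf_listprod (map P [Suc k..<Suc n]))) (scons (\<alpha> k) (row_stream (map \<alpha> [Suc k..<Suc n])))"
      show "?rel k" by (rule independent_imp_random_rel[OF ind \<Omega> re_k P comp])
      show "martin_lof_random (listset (map \<Omega> [Suc k..<Suc n])) (pmf_listprod (map P [Suc k..<Suc n])) (row_stream (map \<alpha> [Suc k..<Suc n]))"
        by (rule random_tail[OF ind re_k])
    qed (rule random_rel_imp_independent[OF _ _ \<Omega> re P comp]; simp)
  qed
  have base: "independent_from n n \<Omega> P \<alpha>"
  proof -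
    have "martin_lof_random (set_Cons (\<Omega> n) {[]}) (cons_pmf (P n) (return_pmf [])) (row_stream [\<alpha> n])"
      using assms(1-4) by (intro random_singleton) auto
    then show ?thesis by (simp add: independent_from_def cons_pmf_def del: set_Cons_sing_Nil)
  qed
  have "independent_from k n \<Omega> P \<alpha> \<longleftrightarrow> (\<forall>i\<in>{k..<n}. ?rel i)" if "1 \<le> k" "k \<le> n" for k
    using that(2,1)
  proof (induction rule: inc_induct)
    case base
    then show ?case using \<open>independent_from n n \<Omega> P \<alpha>\<close> by simp
  next
    case (step i)
    have "{i..<n} = insert i {Suc i..<n}" using step.hyps by auto
    then show ?case using step \<open>\<And>k. 1 \<le> k \<Longrightarrow> k < n \<Longrightarrow>
        independent_from k n \<Omega> P \<alpha> \<longleftrightarrow> ?rel k \<and> independent_from (Suc k) n \<Omega> P \<alpha>\<close>[of i]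
      by simp
  qed
  from this[of 1] have "independent_ensembles n \<Omega> P \<alpha> \<longleftrightarrow> (\<forall>k\<in>{1..<n}. ?rel k)"
    using assms(1) by (simp add: independent_ensembles_iff del: upt_Suc)
  moreover have "{1..<n} = {1..n - 1}" using assms(1) by auto
  ultimately show ?thesis by (simp only:)
qed

end
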